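(* Let $1\le p\le q$ be integers. Construct random variables $\lambda^{(s)}=\{\lambda^{(s)}_j\}$, $s=1,\dots,p+q-1$, inductively as follows, where at every step $\Pi=\mathbb I-\vec x\vec x^\dagger$ with $\vec x$ a fresh independent normalized complex Gaussian vector of the appropriate size, and $(a)^m$ means that $a$ is repeated $m$ times. (i) For $r=1,\dots,p$, $\lambda^{(r)}_1>\dots>\lambda^{(r)}_r$ are the eigenvalues different from $0$ and $1$ of $M_r=\Pi A_r\Pi$, where $A_1=\operatorname{diag}((0)^p,(1)^q)$ and, for $r\ge2$, $A_r=\operatorname{diag}\left((0)^{p-r+1},\lambda^{(r-1)}_1,\dots,\lambda^{(r-1)}_{r-1},(1)^{q-r+1}\right)$. (ii) For $r=1,\dots,q-p$, $\lambda^{(p+r)}_1>\dots>\lambda^{(p+r)}_p$ are the eigenvalues different from $0$ and $1$ of $M_{p+r}=\Pi A_{p+r}\Pi$, where $A_{p+r}=\operatorname{diag}\left(\lambda_1^{(p+r-1)},\dots,\lambda_p^{(p+r-1)},(1)^{q-p-r+1}\right)$. (iii) For $r=1,\dots,p-1$, $\lambda^{(q+r)}_1>\dots>\lambda^{(q+r)}_{p-r}$ are the eigenvalues different from $0$ of $M_{q+r}=\Pi A_{q+r}\Pi$, where $A_{q+r}=\operatorname{diag}\left(\lambda_1^{(q+r-1)},\dots,\lambda_{p-r+1}^{(q+r-1)}\right)$. Then the joint probability density function of $\bigcup_{s=1}^{p+q-1}\{\lambda^{(s)}_j\}$ (positions in $(0,1)$) is proportional to $$\prod_{r=2}^p\chi(\lambda^{(r-1)},\lambda^{(r)})\prod_{r=p+1}^q\chi(\lambda^{(r-1)},\lambda^{(r)}\cup\{0\})\prod_{r=q+1}^{p+q-1}\chi(\lambda^{(r-1)},\lambda^{(r)}\cup\{0,1\}),$$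 i.e. it is the joint density of the finitized bead process with parameters $p,q$.
   Context: For finite sets $y=\{y_1>\dots>y_m\}$, $z=\{z_1>\dots>z_{m+1}\}$ of reals, $\chi(y,z)=1$ if $z_{m+1}<y_m<z_m<\dots<z_2<y_1<z_1$ and $\chi(y,z)=0$ otherwise. A normalized complex Gaussian vector is a vector with i.i.d. standard complex Gaussian entries divided by its Euclidean norm (equivalently, a uniformly distributed point on the complex unit sphere); its number of rows is the size of the matrix $A_r$ (resp. $A_{p+r}$, $A_{q+r}$) it is used with. Finitized bead process: on line $t=1,\dots,p+q-1$ there are $r(t)$ particles in $(0,1)$, where $r(t)=t$ for $t\le p$, $r(t)=p$ for $p\le t\le q$, $r(t)=p+q-t$ for $t\ge q$, with positions $x^{(t)}=\{x^{(t)}_1>\dots>x^{(t)}_{r(t)}\}$, and the joint density with respect to Lebesgue measure is proportional to $\prod_{t=1}^{p-1}\chi(x^{(t)},x^{(t+1)})\prod_{t=p}^{q-1}\chi(x^{(t)},x^{(t+1)}\cup\{0\})\prod_{t=q}^{p+q-1}\chi(x^{(t)},x^{(t+1)}\cup\{0,1\})$, with $x^{(p+q)}=\emptyset$. *)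

theory Defs
  imports
    "HOL-Probability.Probability"
    "HOL-Computational_Algebra.Computational_Algebra"
    "Jordan_Normal_Form.Matrix"
    "Jordan_Normal_Form.Char_Poly"
begin

(* Both HOL-Analysis and Jordan_Normal_Form define vec and mat; below they are the latter's. *)
hide_const (open) Finite_Cartesian_Product.vec Finite_Cartesian_Product.mat

subsection \<open>Interlacing and the finitized bead process\<close>

definition desc :: "real set \<Rightarrow> real list" where
  "desc S = rev (sorted_list_of_set S)"

definition chi :: "real set \<Rightarrow> real set \<Rightarrow> real" where
  "chi y z = (if card z = card y + 1 \<and>
      (\<forall>i < card y. desc z ! Suc i < desc y ! i \<and> desc y ! i < desc z ! i)
    then 1 else 0)"

definition num_part :: "nat \<Rightarrow> nat \<Rightarrow> nat \<Rightarrow> nat" where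
  "num_part p q t = (if t \<le> p then t else if t \<le> q then p else p + q - t)"

(* The pair (t, j) indexes the j-th largest particle on line t. *)
definition positions :: "nat \<Rightarrow> nat \<Rightarrow> (nat \<times> nat) set" where
  "positions p q = (SIGMA t:{1..<p + q}. {1..num_part p q t})"

definition line :: "nat \<Rightarrow> nat \<Rightarrow> (nat \<times> nat \<Rightarrow> real) \<Rightarrow> nat \<Rightarrow> real set" where
  "line p q x t = (\<lambda>j. x (t, j)) ` {1..num_part p q t}"

(* The function chi only sees the sets of positions; that a density lives on labelled
   configurations x_1 > ... > x_r(t) in (0,1) is recorded here. *)
definition admissible :: "nat \<Rightarrow> nat \<Rightarrow> (nat \<times> nat \<Rightarrow> real) \<Rightarrow> bool" where
  "admissible p q x \<longleftrightarrow> (\<forall>t \<in> {1..<p + q}.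
     (\<forall>j \<in> {1..num_part p q t}. 0 < x (t, j) \<and> x (t, j) < 1) \<and>
     (\<forall>j \<in> {1..<num_part p q t}. x (t, Suc j) < x (t, j)))"

(* Note that line p q x (p + q) is empty. *)
definition bead_weight :: "nat \<Rightarrow> nat \<Rightarrow> (nat \<times> nat \<Rightarrow> real) \<Rightarrow> real" where
  "bead_weight p q x = (if admissible p q x then
      (\<Prod>t\<in>{1..<p}. chi (line p q x t) (line p q x (t + 1))) *
      (\<Prod>t\<in>{p..<q}. chi (line p q x t) (line p q x (t + 1) \<union> {0})) *
      (\<Prod>t\<in>{q..<p + q}. chi (line p q x t) (line p q x (t + 1) \<union> {0, 1}))
    else 0)"

definition has_joint_density ::
  "'a measure \<Rightarrow> nat \<Rightarrow> nat \<Rightarrow> (nat \<times> nat \<Rightarrow> 'a \<Rightarrow> real) \<Rightarrow> ((nat \<times> nat \<Rightarrow> real) \<Rightarrow> real) \<Rightarrow> bool" where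
  "has_joint_density M p q X w \<longleftrightarrow>
     distributed M (\<Pi>\<^sub>M k\<in>positions p q. lborel) (\<lambda>\<omega>. \<lambda>k\<in>positions p q. X k \<omega>) (\<lambda>x. ennreal (w x))"

definition joint_density_proportional ::
  "'a measure \<Rightarrow> nat \<Rightarrow> nat \<Rightarrow> (nat \<times> nat \<Rightarrow> 'a \<Rightarrow> real) \<Rightarrow> ((nat \<times> nat \<Rightarrow> real) \<Rightarrow> real) \<Rightarrow> bool" where
  "joint_density_proportional M p q X w \<longleftrightarrow> (\<exists>c > 0. has_joint_density M p q X (\<lambda>x. c * w x))"

definition finitized_bead_process ::
  "'a measure \<Rightarrow> nat \<Rightarrow> nat \<Rightarrow> (nat \<times> nat \<Rightarrow> 'a \<Rightarrow> real) \<Rightarrow> bool" where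
  "finitized_bead_process M p q X \<longleftrightarrow> joint_density_proportional M p q X (bead_weight p q)"


subsection \<open>Random projections\<close>

(* Unit variance: E |Z|^2 = 1. *)
definition std_complex_gaussian :: "'a measure \<Rightarrow> ('a \<Rightarrow> complex) \<Rightarrow> bool" where
  "std_complex_gaussian M Z \<longleftrightarrow> distributed M lborel Z (\<lambda>z. ennreal (exp (- (cmod z)\<^sup>2) / pi))"

definition normalized_vec :: "nat \<Rightarrow> (nat \<Rightarrow> complex) \<Rightarrow> complex vec" where
  "normalized_vec n g = vec n (\<lambda>i. g i / complex_of_real (sqrt (\<Sum>k<n. (cmod (g k))\<^sup>2)))"

definition projection :: "complex vec \<Rightarrow> complex mat" where
  "projection x = 1\<^sub>m (dim_vec x) - mat (dim_vec x) (dim_vec x) (\<lambda>(i, j). vec_index x i * cnj (vec_index x j))"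

definition real_diag :: "real list \<Rightarrow> complex mat" where
  "real_diag as = mat_diag (length as) (\<lambda>i. complex_of_real (as ! i))"

(* Eigenvalues outside E, in decreasing order and repeated according to algebraic multiplicity.
   It is only applied to Hermitian matrices, so Re loses nothing. *)
definition eigenvalues_outside :: "complex set \<Rightarrow> complex mat \<Rightarrow> real list" where
  "eigenvalues_outside E B =
     rev (sorted_list_of_multiset (image_mset Re (filter_mset (\<lambda>z. z \<notin> E) (proots (char_poly B)))))"

(* With s the overall step number, the index r of each of the last two phases is s - p and s - q,
   so that q - p - r + 1 = q + 1 - s in the second one. The list l holds the entries
   coming from step s - 1. *)
definition A_mat :: "nat \<Rightarrow> nat \<Rightarrow> nat \<Rightarrow> real list \<Rightarrow> complex mat" where
  "A_mat p q s l = real_diag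
     (if s \<le> p then replicate (p + 1 - s) 0 @ l @ replicate (q + 1 - s) 1
      else if s \<le> q then l @ replicate (q + 1 - s) 1
      else l)"

definition A_size :: "nat \<Rightarrow> nat \<Rightarrow> nat \<Rightarrow> nat" where
  "A_size p q s = p + q + 1 - s"

lemma dim_A_mat:
  assumes "1 \<le> p" "p \<le> q" "s \<in> {1..<p + q}" "length l = num_part p q (s - 1)"
  shows "dim_row (A_mat p q s l) = A_size p q s"
  using assms by (auto simp: A_mat_def A_size_def real_diag_def num_part_def mat_diag_def)

definition M_mat :: "nat \<Rightarrow> nat \<Rightarrow> nat \<Rightarrow> (nat \<Rightarrow> complex) \<Rightarrow> real list \<Rightarrow> complex mat" where
  "M_mat p q s g l =
     (let P = projection (normalized_vec (A_size p q s) g) in P * A_mat p q s l * P)"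

(* The j-th entry (counted from 1); the default value 0 is only needed on a null event. *)
definition entry :: "real list \<Rightarrow> nat \<Rightarrow> real" where
  "entry l j = (if 1 \<le> j \<and> j \<le> length l then l ! (j - 1) else 0)"

(* g s i is the i-th Gaussian entry (i counted from 0) used in step s. *)
primrec eig_list :: "nat \<Rightarrow> nat \<Rightarrow> (nat \<Rightarrow> nat \<Rightarrow> complex) \<Rightarrow> nat \<Rightarrow> real list" where
  "eig_list p q g 0 = []"
| "eig_list p q g (Suc s) =
     eigenvalues_outside (if Suc s \<le> q then {0, 1} else {0})
       (M_mat p q (Suc s) (g (Suc s)) (map (entry (eig_list p q g s)) [1..<num_part p q s + 1]))"

definition lam :: "nat \<Rightarrow> nat \<Rightarrow> (nat \<Rightarrow> nat \<Rightarrow> complex) \<Rightarrow> nat \<times> nat \<Rightarrow> real" where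
  "lam p q g = (\<lambda>(s, j). entry (eig_list p q g s) j)"

end

theory Submission
  imports Defs "Jordan_Normal_Form.Schur_Decomposition"
begin

text \<open>
  If \<open>x\<close> is a unit vector and \<open>A\<close> is diagonal with distinct entries \<open>a\<^sub>i\<close> of multiplicity \<open>m\<^sub>i\<close>, then
  the characteristic polynomial of \<open>\<Pi> A \<Pi>\<close> is \<open>z \<Prod> (z - a\<^sub>i)\<close>, with multiplicities, times the partial fraction
  \<open>\<Sum> w\<^sub>i / (z - a\<^sub>i)\<close>, where \<open>w\<^sub>i\<close> collects the squared moduli of the entries of \<open>x\<close> belonging to \<open>a\<^sub>i\<close>.
  For a Gaussian vector, before normalization, these sums are independent Erlang variables \<open>\<Gamma>\<^sub>i\<close>. The new eigenvalues
  are the zeros of the partial fraction; they interlace the \<open>a\<^sub>i\<close>, and passing from the \<open>\<Gamma>\<^sub>i\<close> to their sum and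
  the zeros has an explicit Jacobian, a quotient of Vandermonde products. This is seen by induction on the number of
  poles: removing the lowest pole together with the lowest zero is a substitution in one variable followed by a
  rescaling of the remaining residues.

  The conditional density of a line given the previous one is therefore \<open>W\<^sub>s(\<lambda>\<^sup>s) / W\<^sub>s\<^sub>-\<^sub>1(\<lambda>\<^sup>s\<^sup>-\<^sup>1)\<close> on interlacing
  configurations, where \<open>W\<^sub>s\<close> is the Vandermonde product times \<open>\<Prod> \<lambda>\<^sub>j\<^sup>p\<^sup>-\<^sup>s (1 - \<lambda>\<^sub>j)\<^sup>q\<^sup>-\<^sup>s\<close> (truncated subtraction), and the
  product of these quotients telescopes to a constant.
\<close>

unbundle no vec_syntax
no_notation fps_nth (infixl "$" 75)

section \<open>Eigenvalues as measurable functions of a matrix\<close>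

text \<open>Normalizing the Gaussian vector is harmless because the residues sum to 1: the product
  of the Erlang densities is a function of the total S times a function of the zeros, so S splits
  off and integrates to 1. The exponents in \<open>W_s\<close> are the multiplicities of 0 and 1 in
  the matrix of step s, less one. The residues at these nodes occur with exactly these powers, and
  the Vandermonde product of the nodes adds one factor for each old eigenvalue, which raises the
  exponents to those of the previous weight.

  The interlacing coordinates exist only off a null set, since group sums may vanish. Conditional
  laws are replaced by Fubini on the product of the past and a fresh vector, which needs the step to
  be measurable in both arguments, degenerate ones included. Hence measurability of eigenvalues is
  proved for every matrix family with real spectrum, while the explicit kernel is used only at a
  fixed good previous line; elsewhere the density of the past is 0.\<close>

lemma of_real_sum_mset: "of_real (\<Sum>x\<in>#A. f x) = (\<Sum>x\<in>#A. of_real (f x) :: 'a :: real_algebra_1)"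
  by (induction A) auto

lemma sum_mset_polynomial:
  "(\<Sum>z\<in>#A. \<Sum>i\<le>m. a i * f z ^ i) = (\<Sum>i\<le>m. a i * (\<Sum>z\<in>#A. f z ^ i :: real))"
  by (induction A) (auto simp: sum.distrib algebra_simps)

definition mtrace :: "complex mat \<Rightarrow> complex" where
  "mtrace A = (\<Sum>i<dim_row A. A $$ (i, i))"

lemma mtrace_mult_comm:
  assumes "A \<in> carrier_mat n m" "B \<in> carrier_mat m n"
  shows "mtrace (A * B) = mtrace (B * A)"
proof -
  have "mtrace (A * B) = (\<Sum>i<n. \<Sum>j<m. A $$ (i, j) * B $$ (j, i))"
    using assms by (auto simp: mtrace_def scalar_prod_def atLeast0LessThan intro!: sum.cong)
  also have "\<dots> = (\<Sum>j<m. \<Sum>i<n. B $$ (j, i) * A $$ (i, j))"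
    by (subst sum.swap) (simp add: mult.commute)
  also have "\<dots> = mtrace (B * A)"
    using assms by (auto simp: mtrace_def scalar_prod_def atLeast0LessThan intro!: sum.cong)
  finally show ?thesis .
qed

lemma mult_upper_triangular:
  fixes A B :: "complex mat"
  assumes A: "A \<in> carrier_mat n n" "upper_triangular A"
    and B: "B \<in> carrier_mat n n" "upper_triangular B"
  shows "upper_triangular (A * B)"
    and "\<And>i. i < n \<Longrightarrow> (A * B) $$ (i, i) = A $$ (i, i) * B $$ (i, i)"
proof -
  have z: "A $$ (i, k) * B $$ (k, j) = 0" if "i < n" "k < n" "j < n" "k < i \<or> j < k" for i j k
    using that A B by (auto simp: upper_triangular_def)
  show "upper_triangular (A * B)"
    unfolding upper_triangular_def
  proof safe
    fix i j assume ij: "i < dim_row (A * B)" "j < i"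
    then have "(A * B) $$ (i, j) = (\<Sum>k<n. A $$ (i, k) * B $$ (k, j))"
      using A B by (auto simp: scalar_prod_def atLeast0LessThan)
    also have "\<dots> = 0"
      using z ij A B by (intro sum.neutral ballI) (metis carrier_matD(1) index_mult_mat(2) lessThan_iff less_trans linorder_less_linear)
    finally show "(A * B) $$ (i, j) = 0" .
  qed
  fix i assume i: "i < n"
  then have "(A * B) $$ (i, i) = (\<Sum>k<n. A $$ (i, k) * B $$ (k, i))"
    using A B by (auto simp: scalar_prod_def atLeast0LessThan)
  also have "\<dots> = (\<Sum>k<n. if k = i then A $$ (i, i) * B $$ (i, i) else 0)"
    using z i by (intro sum.cong) (auto simp: neq_iff)
  also have "\<dots> = A $$ (i, i) * B $$ (i, i)"
    using i by simp
  finally show "(A * B) $$ (i, i) = A $$ (i, i) * B $$ (i, i)" .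
qed

lemma pow_upper_triangular:
  fixes A :: "complex mat"
  assumes A: "A \<in> carrier_mat n n" "upper_triangular A"
  shows "upper_triangular (A ^\<^sub>m k) \<and> (\<forall>i<n. (A ^\<^sub>m k) $$ (i, i) = (A $$ (i, i)) ^ k)"
proof (induction k)
  case 0
  show ?case using A by (auto simp: upper_triangular_def)
next
  case (Suc k)
  have "A ^\<^sub>m k \<in> carrier_mat n n" using A by simp
  with Suc A mult_upper_triangular[of "A ^\<^sub>m k" n A] show ?case
    by (auto simp: mult.commute)
qed

lemma proots_prod_linear:
  "proots (\<Prod>e\<leftarrow>es. [:- e, 1:]) = mset (es :: complex list)"
proof -
  have "0 \<notin> set (map (\<lambda>e. [:- e, 1:]) es)" by auto
  then have "proots (\<Prod>e\<leftarrow>es. [:- e, 1:]) = sum_list (map proots (map (\<lambda>e. [:- e, 1:]) es))"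
    by (subst proots_prod_list[symmetric]) (auto)
  also have "\<dots> = mset es" by (induction es) auto
  finally show ?thesis .
qed

text \<open>Schur triangularization: the roots sit on the diagonal of a similar upper triangular
  matrix, their powers on the diagonal of its power, and the trace does not see the conjugation. The
  right side is a polynomial in the matrix entries, hence measurable.\<close>

lemma sum_proots_power_eq_mtrace:
  assumes A: "A \<in> carrier_mat n n"
  shows "(\<Sum>z\<in>#proots (char_poly A). z ^ k) = mtrace (A ^\<^sub>m k)"
proof -
  obtain es where es: "char_poly A = (\<Prod>e\<leftarrow>es. [:- e, 1:])" "length es = n"
    using char_poly_factorized[OF A] by auto
  obtain B P Q where sd: "schur_decomposition A es = (B, P, Q)" by (metis prod_cases3)
  from schur_decomposition[OF A es(1) sd]
  have sim: "similar_mat_wit A B P Q" and ut: "upper_triangular B" and diag: "diag_mat B = es" by auto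
  note D = similar_mat_witD2[OF A sim]
  have pw: "A ^\<^sub>m k = P * B ^\<^sub>m k * Q"
    using similar_mat_wit_pow[OF sim, of k] by (auto simp: similar_mat_wit_def Let_def)
  have B: "B \<in> carrier_mat n n" and Bk: "B ^\<^sub>m k \<in> carrier_mat n n" and P: "P \<in> carrier_mat n n" and Q: "Q \<in> carrier_mat n n"
    using D by auto
  have "mtrace (A ^\<^sub>m k) = mtrace (Q * (P * B ^\<^sub>m k))"
    unfolding pw using Bk P Q by (intro mtrace_mult_comm[of _ n n]) auto
  also have "Q * (P * B ^\<^sub>m k) = B ^\<^sub>m k"
    using D Bk P Q by (simp add: assoc_mult_mat[symmetric, of Q n n P n "B ^\<^sub>m k" n])
  also have "mtrace (B ^\<^sub>m k) = (\<Sum>i<n. (B $$ (i, i)) ^ k)"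
    using pow_upper_triangular[OF B ut, of k] B Bk by (simp add: mtrace_def)
  also have "\<dots> = sum_list (map (\<lambda>z. z ^ k) (diag_mat B))"
    using B by (simp add: diag_mat_def comp_def interv_sum_list_conv_sum_set_nat atLeast0LessThan)
  also have "\<dots> = (\<Sum>z\<in>#proots (char_poly A). z ^ k)"
    unfolding diag es(1) proots_prod_linear by (metis mset_map sum_mset_sum_list)
  finally show ?thesis by simp
qed

lemma real_roots_hermitian:
  assumes A: "A \<in> carrier_mat n n"
    and herm: "\<And>i j. i < n \<Longrightarrow> j < n \<Longrightarrow> A $$ (i, j) = cnj (A $$ (j, i))"
    and z: "z \<in># proots (char_poly A)"
  shows "Im z = 0"
proof -
  have "char_poly A \<noteq> 0"
    using degree_monic_char_poly[OF A] by auto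
  then have "poly (char_poly A) z = 0"
    using z by simp
  then have "eigenvalue A z"
    using eigenvalue_root_char_poly[OF A] by simp
  then obtain v where v: "v \<in> carrier_vec n" "v \<noteq> 0\<^sub>v n" "A *\<^sub>v v = z \<cdot>\<^sub>v v"
    using A by (auto simp: eigenvalue_def eigenvector_def)
  have e: "(\<Sum>j<n. A $$ (i, j) * v $ j) = z * v $ i" if "i < n" for i
  proof -
    have "(A *\<^sub>v v) $ i = (z \<cdot>\<^sub>v v) $ i" using v by simp
    then show ?thesis using that A v(1) by (simp add: scalar_prod_def atLeast0LessThan)
  qed
  define N where "N = (\<Sum>i<n. (cmod (v $ i))\<^sup>2)"
  \<comment> \<open>\<open>T\<close> is the Hermitian form of \<open>A\<close> at the eigenvector.
    It equals its own conjugate and also \<open>z\<close> times the nonzero real number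
    \<open>N\<close>, so \<open>z\<close> is real.\<close>
  define T where "T = (\<Sum>i<n. \<Sum>j<n. cnj (v $ i) * A $$ (i, j) * v $ j)"
  have T1: "T = z * of_real N"
  proof -
    have "T = (\<Sum>i<n. cnj (v $ i) * (z * v $ i))"
      unfolding T_def by (intro sum.cong refl) (simp add: e[symmetric] sum_distrib_left mult.assoc)
    also have "\<dots> = (\<Sum>i<n. z * of_real ((cmod (v $ i))\<^sup>2))"
      by (intro sum.cong refl) (simp only: complex_norm_square mult_ac)
    finally show ?thesis by (simp add: N_def sum_distrib_left)
  qed
  have "cnj T = (\<Sum>i<n. \<Sum>j<n. cnj (v $ j) * A $$ (j, i) * v $ i)"
    unfolding T_def cnj_sum
  proof (intro sum.cong refl)
    fix i j assume "i \<in> {..<n}" "j \<in> {..<n}"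
    then have "cnj (A $$ (i, j)) = A $$ (j, i)" using herm[of j i] by simp
    then show "cnj (cnj (v $ i) * A $$ (i, j) * v $ j) = cnj (v $ j) * A $$ (j, i) * v $ i"
      by (simp add: mult_ac)
  qed
  also have "\<dots> = T" unfolding T_def by (rule sum.swap)
  finally have "cnj z * of_real N = z * of_real N" by (simp add: T1)
  moreover have "N \<noteq> 0"
  proof
    assume "N = 0"
    then have "\<forall>i<n. v $ i = 0" unfolding N_def by (subst (asm) sum_nonneg_eq_0_iff) auto
    with v show False by (auto intro: eq_vecI)
  qed
  ultimately have "cnj z = z" by simp
  then show ?thesis by (simp add: complex_eq_iff)
qed

lemma measurable_pow_mat:
  fixes B :: "'b \<Rightarrow> complex mat"
  assumes B: "\<And>\<omega>. \<omega> \<in> space N \<Longrightarrow> B \<omega> \<in> carrier_mat n n"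
    and m: "\<And>i j. i < n \<Longrightarrow> j < n \<Longrightarrow> (\<lambda>\<omega>. B \<omega> $$ (i, j)) \<in> borel_measurable N"
  shows "i < n \<Longrightarrow> j < n \<Longrightarrow> (\<lambda>\<omega>. (B \<omega> ^\<^sub>m k) $$ (i, j)) \<in> borel_measurable N"
proof (induction k arbitrary: i j)
  case 0
  then have "(B \<omega> ^\<^sub>m 0) $$ (i, j) = (if i = j then 1 else 0)" if "\<omega> \<in> space N" for \<omega>
    using B[OF that] by simp
  then show ?case by (simp cong: measurable_cong)
next
  case (Suc k)
  have "(B \<omega> ^\<^sub>m Suc k) $$ (i, j) = (\<Sum>l<n. (B \<omega> ^\<^sub>m k) $$ (i, l) * B \<omega> $$ (l, j))"
    if "\<omega> \<in> space N" for \<omega>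
    using B[OF that] Suc.prems by (auto simp: scalar_prod_def atLeast0LessThan)
  moreover have "(\<lambda>\<omega>. \<Sum>l<n. (B \<omega> ^\<^sub>m k) $$ (i, l) * B \<omega> $$ (l, j)) \<in> borel_measurable N"
    using Suc m by (intro borel_measurable_sum borel_measurable_times) auto
  ultimately show ?case by (simp cong: measurable_cong)
qed

text \<open>Continuous functions that approximate the indicator of positivity pointwise; at 0 every
  term of the sequence is 0.\<close>

lemma tendsto_min_one_mult:
  fixes x :: real assumes "x > 0"
  shows "(\<lambda>k. min 1 (real k * x)) \<longlonglongrightarrow> 1"
proof (rule tendsto_eventually)
  obtain K where K: "1 / x \<le> real K" using real_arch_simple by blast
  show "eventually (\<lambda>k. min 1 (real k * x) = 1) sequentially"
    using eventually_ge_at_top[of K]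
  proof eventually_elim
    case (elim k)
    then have "1 / x \<le> real k" using K by linarith
    then show ?case using assms by (simp add: field_simps)
  qed
qed

text \<open>Reads the order statistics of a decreasing list off its counting function, which is how
  measurable counts become measurable entries.\<close>

lemma le_length_filter_sorted_desc:
  "sorted_wrt (\<ge>) (xs :: real list) \<Longrightarrow>
    Suc j \<le> length (filter (\<lambda>x. t < x) xs) \<longleftrightarrow> Suc j \<le> length xs \<and> t < xs ! j"
proof (induction xs arbitrary: j)
  case (Cons x xs)
  show ?case
  proof (cases "t < x")
    case True
    then show ?thesis using Cons by (cases j) auto
  next
    case False
    then have "\<forall>y\<in>set xs. \<not> t < y" using Cons.prems by auto
    then have "filter (\<lambda>x. t < x) xs = []" by (simp add: filter_empty_conv)
    moreover have "\<not> t < (x # xs) ! j" if "j < length (x # xs)"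
      using that False \<open>\<forall>y\<in>set xs. \<not> t < y\<close> by (cases j) auto
    ultimately show ?thesis using False by auto
  qed
qed simp

lemma sum_mset_if: "(\<Sum>z\<in>#A. if P z then 1 else 0 :: real) = real (size (filter_mset P A))"
  by (induction A) auto

locale measurable_real_spectrum =
  fixes N :: "'b measure" and B :: "'b \<Rightarrow> complex mat" and n :: nat
  assumes carrier: "\<And>\<omega>. \<omega> \<in> space N \<Longrightarrow> B \<omega> \<in> carrier_mat n n"
    and meas: "\<And>i j. i < n \<Longrightarrow> j < n \<Longrightarrow> (\<lambda>\<omega>. B \<omega> $$ (i, j)) \<in> borel_measurable N"
    and real: "\<And>\<omega> z. \<omega> \<in> space N \<Longrightarrow> z \<in># proots (char_poly (B \<omega>)) \<Longrightarrow> Im z = 0"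
begin

text \<open>Sums of powers are traces of powers of the matrix. Polynomial approximation and pointwise limits lead
  from there to counting functions, so that the ordered eigenvalues are measurable without an exceptional set.\<close>

definition spectral_sum :: "(real \<Rightarrow> real) \<Rightarrow> 'b \<Rightarrow> real" where
  "spectral_sum h \<omega> = (\<Sum>z\<in>#proots (char_poly (B \<omega>)). h (Re z))"

lemma spectral_sum_limit:
  assumes "\<And>i. spectral_sum (f i) \<in> borel_measurable N" "\<And>x. (\<lambda>i. f i x) \<longlonglongrightarrow> h x"
  shows "spectral_sum h \<in> borel_measurable N"
proof (rule borel_measurable_LIMSEQ_real[OF _ assms(1)])
  fix \<omega> 
  have "(\<lambda>i. \<Sum>z\<in>#A. f i (Re z)) \<longlonglongrightarrow> (\<Sum>z\<in>#A. h (Re z))" for A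
    by (induction A) (auto intro!: tendsto_add assms)
  then show "(\<lambda>i. spectral_sum (f i) \<omega>) \<longlonglongrightarrow> spectral_sum h \<omega>"
    by (simp add: spectral_sum_def)
qed

lemma spectral_sum_power: "spectral_sum (\<lambda>x. x ^ k) \<in> borel_measurable N"
proof -
  have "spectral_sum (\<lambda>x. x ^ k) \<omega> = Re (mtrace (B \<omega> ^\<^sub>m k))" if "\<omega> \<in> space N" for \<omega>
  proof -
    have "complex_of_real (spectral_sum (\<lambda>x. x ^ k) \<omega>) = (\<Sum>z\<in>#proots (char_poly (B \<omega>)). of_real (Re z ^ k))"
      unfolding spectral_sum_def by (rule of_real_sum_mset)
    also have "\<dots> = (\<Sum>z\<in>#proots (char_poly (B \<omega>)). z ^ k)"
      using real[OF that] by (intro arg_cong[where f = sum_mset] image_mset_cong) (simp add: complex_eq_iff flip: of_real_power)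
    finally show ?thesis
      unfolding sum_proots_power_eq_mtrace[OF carrier[OF that]] by (metis Re_complex_of_real)
  qed
  moreover have "(\<lambda>\<omega>. Re (\<Sum>i<n. (B \<omega> ^\<^sub>m k) $$ (i, i))) \<in> borel_measurable N"
    using measurable_pow_mat[OF carrier meas] by measurable
  moreover have "mtrace (B \<omega> ^\<^sub>m k) = (\<Sum>i<n. (B \<omega> ^\<^sub>m k) $$ (i, i))" if "\<omega> \<in> space N" for \<omega>
    using carrier[OF that] by (simp add: mtrace_def)
  ultimately show ?thesis by (simp cong: measurable_cong)
qed

lemma spectral_sum_continuous:
  assumes h: "continuous_on UNIV h"
  shows "spectral_sum h \<in> borel_measurable N"
proof -
  \<comment> \<open>The eigenvalues have no bound uniform in \<omega>, so the interval of
    approximation grows with \<open>k\<close> while the error shrinks; each fixed point lies in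
    almost all of these intervals.\<close>
  have "\<exists>g. real_polynomial_function g \<and> (\<forall>x\<in>{- real k..real k}. \<bar>h x - g x\<bar> < 1 / real (Suc k))" for k
  proof -
    have "continuous_on {- real k..real k} h" by (rule continuous_on_subset[OF h]) auto
    from Stone_Weierstrass_real_polynomial_function[OF _ this, of "1 / real (Suc k)"]
    show ?thesis by (metis compact_Icc of_nat_0_less_iff zero_less_Suc zero_less_divide_1_iff)
  qed
  then obtain g where g: "\<And>k. real_polynomial_function (g k)"
    and gh: "\<And>k x. x \<in> {- real k..real k} \<Longrightarrow> \<bar>h x - g k x\<bar> < 1 / real (Suc k)"
    by metis
  show ?thesis
  proof (rule spectral_sum_limit)
    fix k
    obtain a m where gk: "g k = (\<lambda>x. \<Sum>i\<le>m. a i * x ^ i)"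
      using g[of k] unfolding real_polynomial_function_iff_sum by auto
    have "spectral_sum (g k) \<omega> = (\<Sum>i\<le>m. a i * spectral_sum (\<lambda>x. x ^ i) \<omega>)" for \<omega>
      unfolding spectral_sum_def gk by (rule sum_mset_polynomial)
    then have "spectral_sum (g k) = (\<lambda>\<omega>. \<Sum>i\<le>m. a i * spectral_sum (\<lambda>x. x ^ i) \<omega>)" by auto
    then show "spectral_sum (g k) \<in> borel_measurable N"
      using spectral_sum_power by (auto intro!: borel_measurable_sum borel_measurable_times)
  next
    fix x :: real
    have "(\<lambda>k. g k x - h x) \<longlonglongrightarrow> 0"
    proof (rule Lim_null_comparison[OF _ LIMSEQ_inverse_real_of_nat])
      obtain K where K: "\<bar>x\<bar> \<le> real K" using real_arch_simple by blast
      show "eventually (\<lambda>k. norm (g k x - h x) \<le> inverse (real (Suc k))) sequentially"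
        using eventually_ge_at_top[of K]
      proof eventually_elim
        case (elim k)
        then have "x \<in> {- real k..real k}" using K by auto
        from gh[OF this] show ?case by (simp add: inverse_eq_divide abs_minus_commute)
      qed
    qed
    then show "(\<lambda>k. g k x) \<longlonglongrightarrow> h x" by (rule LIM_zero_cancel)
  qed
qed

lemma spectral_count_measurable:
  assumes E: "finite E"
  shows "spectral_sum (\<lambda>x. if t < x \<and> complex_of_real x \<notin> E then 1 else 0) \<in> borel_measurable N"
    and "spectral_sum (\<lambda>x. if complex_of_real x \<notin> E then 1 else 0) \<in> borel_measurable N"
proof -
  \<comment> \<open>Each factor vanishes at its excluded point and tends to 1 elsewhere, so the
    indicator of the complement of a finite set is a limit of continuous functions.\<close>
  have 1: "(\<lambda>k. \<Prod>e\<in>E. min 1 (real k * cmod (of_real x - e))) \<longlonglongrightarrow> (if complex_of_real x \<notin> E then 1 else 0)" for x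
  proof -
    have "(\<lambda>k. \<Prod>e\<in>E. min 1 (real k * cmod (of_real x - e))) \<longlonglongrightarrow> (\<Prod>e\<in>E. if e = of_real x then 0 else 1)"
      by (intro tendsto_prod) (auto intro: tendsto_min_one_mult)
    moreover have "(\<Prod>e\<in>E. if e = of_real x then 0 else 1) = (if complex_of_real x \<notin> E then 1 else 0 :: real)"
      using E by (auto intro: prod.neutral)
    ultimately show ?thesis by simp
  qed
  have 2: "(\<lambda>k. min 1 (real k * max 0 (x - t))) \<longlonglongrightarrow> (if t < x then 1 else 0)" for x
    by (auto intro: tendsto_min_one_mult)
  show "spectral_sum (\<lambda>x. if complex_of_real x \<notin> E then 1 else 0) \<in> borel_measurable N"
    by (rule spectral_sum_limit[OF spectral_sum_continuous 1]) (intro continuous_intros)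
  have "(\<lambda>k. min 1 (real k * max 0 (x - t)) * (\<Prod>e\<in>E. min 1 (real k * cmod (of_real x - e))))
      \<longlonglongrightarrow> (if t < x \<and> complex_of_real x \<notin> E then 1 else 0)" for x
    by (rule tendsto_eq_rhs[OF tendsto_mult[OF 2 1]]) auto
  then show "spectral_sum (\<lambda>x. if t < x \<and> complex_of_real x \<notin> E then 1 else 0) \<in> borel_measurable N"
    by (rule spectral_sum_limit[rotated]) (intro spectral_sum_continuous continuous_intros)
qed

lemma entry_eigenvalues_outside_measurable:
  assumes E: "finite E"
  shows "(\<lambda>\<omega>. entry (eigenvalues_outside E (B \<omega>)) j) \<in> borel_measurable N"
proof (cases j)
  case 0
  then show ?thesis by (simp add: entry_def)
next
  case (Suc i)
  let ?L = "\<lambda>\<omega>. eigenvalues_outside E (B \<omega>)"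
  have mset: "mset (?L \<omega>) = image_mset Re (filter_mset (\<lambda>z. z \<notin> E) (proots (char_poly (B \<omega>))))" for \<omega>
    by (simp add: eigenvalues_outside_def)
  \<comment> \<open>The roots are real, so exclusion by \<open>E\<close> can be tested on
    \<open>Re z\<close>, the only part that \<open>spectral_sum\<close> sees.\<close>
  have f: "filter_mset (\<lambda>z. z \<notin> E \<and> P z) (proots (char_poly (B \<omega>))) =
      filter_mset (\<lambda>z. complex_of_real (Re z) \<notin> E \<and> P z) (proots (char_poly (B \<omega>)))"
    if "\<omega> \<in> space N" for \<omega> P
    using real[OF that] by (intro filter_mset_cong refl) (metis complex_is_Real_iff of_real_Re)
  have len: "real (length (?L \<omega>)) = spectral_sum (\<lambda>x. if complex_of_real x \<notin> E then 1 else 0) \<omega>"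
    if "\<omega> \<in> space N" for \<omega>
    using f[OF that, of "\<lambda>_. True"] 
    by (simp add: spectral_sum_def sum_mset_if flip: size_mset mset)
       (simp add: mset)
  have cnt: "real (length (filter (\<lambda>x. t < x) (?L \<omega>))) =
      spectral_sum (\<lambda>x. if t < x \<and> complex_of_real x \<notin> E then 1 else 0) \<omega>" if "\<omega> \<in> space N" for \<omega> t
  proof -
    have "length (filter (\<lambda>x. t < x) (?L \<omega>)) = size (filter_mset (\<lambda>x. t < x) (mset (?L \<omega>)))"
      by (metis mset_filter size_mset)
    also have "\<dots> = size (filter_mset (\<lambda>z. z \<notin> E \<and> t < Re z) (proots (char_poly (B \<omega>))))"
      unfolding mset by (simp add: filter_mset_image_mset filter_filter_mset conj_commute)
    finally show ?thesis
      unfolding f[OF that, of "\<lambda>z. t < Re z"] by (simp add: spectral_sum_def sum_mset_if conj_commute)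
  qed
  have sorted: "sorted_wrt (\<ge>) (?L \<omega>)" for \<omega>
    unfolding eigenvalues_outside_def sorted_wrt_rev
    using sorted_sorted_list_of_multiset by (simp add: sorted_wrt_iff_nth_less)
  show ?thesis
  proof (rule borel_measurableI_greater)
    fix t
    \<comment> \<open>The second alternative belongs to lists shorter than \<open>j\<close>: there
      \<open>entry\<close> returns its default 0, which exceeds \<open>t\<close> exactly when
      \<open>t\<close> is negative.\<close>
    have "t < entry (?L \<omega>) j \<longleftrightarrow>
        real j \<le> spectral_sum (\<lambda>x. if t < x \<and> complex_of_real x \<notin> E then 1 else 0) \<omega> \<or>
        (spectral_sum (\<lambda>x. if complex_of_real x \<notin> E then 1 else 0) \<omega> < real j \<and> t < 0)"
      if "\<omega> \<in> space N" for \<omega>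
      unfolding len[OF that, symmetric] cnt[OF that, symmetric] of_nat_le_iff of_nat_less_iff
      using le_length_filter_sorted_desc[OF sorted, of i t \<omega>] unfolding Suc 
      by (auto simp: entry_def)
    then have "{\<omega> \<in> space N. t < entry (?L \<omega>) j} = {\<omega> \<in> space N. 
        real j \<le> spectral_sum (\<lambda>x. if t < x \<and> complex_of_real x \<notin> E then 1 else 0) \<omega> \<or>
        (spectral_sum (\<lambda>x. if complex_of_real x \<notin> E then 1 else 0) \<omega> < real j \<and> t < 0)}"
      by blast
    also have "\<dots> \<in> sets N"
      using spectral_count_measurable[OF E] by measurable
    finally show "{\<omega> \<in> space N. t < entry (?L \<omega>) j} \<in> sets N" .
  qed
qed

end

section \<open>The characteristic polynomial of a compressed diagonal matrix\<close>

text \<open>Two eliminations of the block matrix with blocks z, X, Y, 1. The Schur complement of the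
  identity block gives z - XY; left multiplication by \<open>?L\<close> clears the lower left block
  and leaves z - YX. The determinant of \<open>?L\<close> cancels because \<open>z\<close> is
  nonzero.\<close>

lemma det_diff_mult_comm:
  fixes X Y :: "complex mat"
  assumes X: "X \<in> carrier_mat n n" and Y: "Y \<in> carrier_mat n n" and z: "z \<noteq> 0"
  shows "Determinant.det (z \<cdot>\<^sub>m 1\<^sub>m n - X * Y) = Determinant.det (z \<cdot>\<^sub>m 1\<^sub>m n - Y * X)"
proof -
  let ?Z = "z \<cdot>\<^sub>m 1\<^sub>m n" 
  let ?F = "four_block_mat ?Z X Y (1\<^sub>m n)"
  let ?L = "four_block_mat (1\<^sub>m n) (0\<^sub>m n n) (- Y) ?Z"
  have "Determinant.det ?F = Determinant.det (?Z * 1\<^sub>m n - X * Y)"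
    using X Y by (intro det_four_block_mat) auto
  also have "?Z * 1\<^sub>m n = ?Z" by (rule right_mult_one_mat[of _ n n]) auto
  finally have 1: "Determinant.det ?F = Determinant.det (?Z - X * Y)" .
  have "?L * ?F = four_block_mat (1\<^sub>m n * ?Z + 0\<^sub>m n n * Y) (1\<^sub>m n * X + 0\<^sub>m n n * 1\<^sub>m n)
        (- Y * ?Z + ?Z * Y) (- Y * X + ?Z * 1\<^sub>m n)"
    using X Y by (intro mult_four_block_mat) auto
  also have "1\<^sub>m n * ?Z + 0\<^sub>m n n * Y = ?Z" using Y by auto
  also have "1\<^sub>m n * X + 0\<^sub>m n n * 1\<^sub>m n = X" using X by auto
  also have "- Y * ?Z + ?Z * Y = 0\<^sub>m n n"
    using Y by (auto simp: mult_smult_distrib[of Y n n] mult_smult_assoc_mat[of "1\<^sub>m n" n n Y n] 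
       mult_smult_distrib[of "- Y" n n] intro!: eq_matI)
  also have "- Y * X + ?Z * 1\<^sub>m n = ?Z - Y * X"
    using X Y by (auto intro!: eq_matI)
  finally have LF: "?L * ?F = four_block_mat ?Z X (0\<^sub>m n n) (?Z - Y * X)" .
  have "Determinant.det (?L * ?F) = Determinant.det ?Z * Determinant.det (?Z - Y * X)"
    unfolding LF using X Y by (intro det_four_block_mat_lower_left_zero) auto
  moreover have "Determinant.det (?L * ?F) = Determinant.det ?L * Determinant.det ?F"
    using X Y by (intro det_mult[of _ "n + n"]) auto
  moreover have "Determinant.det ?L = Determinant.det (1\<^sub>m n) * Determinant.det ?Z"
    using Y by (intro det_four_block_mat_upper_right_zero) auto
  moreover have "Determinant.det ?Z \<noteq> 0" using z by (simp add: det_smult)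
  ultimately show ?thesis using 1 z by simp
qed

text \<open>The matrix determinant lemma. The bordered matrix \<open>?F\<close> is reduced by the
  unimodular column operation \<open>?R\<close> to the rank one perturbation, and by the unimodular
  row operation \<open>?L\<close> to the diagonal matrix with Schur complement
  \<open>?c\<close>.\<close>

lemma det_diag_plus_rank_one:
  fixes d u v :: "nat \<Rightarrow> complex"
  assumes d: "\<And>i. i < n \<Longrightarrow> d i \<noteq> 0"
  shows "Determinant.det (mat n n (\<lambda>(i, j). (if i = j then d i else 0) + u i * v j)) =
    (\<Prod>i<n. d i) * (1 + (\<Sum>i<n. u i * v i / d i))"
proof -
  let ?D = "mat n n (\<lambda>(i, j). if i = j then d i else 0)"
  let ?U = "mat n 1 (\<lambda>(i, j). u i)"
  let ?V = "mat 1 n (\<lambda>(i, j). v j)"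
  let ?W = "mat 1 n (\<lambda>(i, j). v j / d j)"
  let ?F = "four_block_mat ?D ?U (- ?V) (1\<^sub>m 1)"
  let ?R = "four_block_mat (1\<^sub>m n) (0\<^sub>m n 1) ?V (1\<^sub>m 1)"
  let ?L = "four_block_mat (1\<^sub>m n) (0\<^sub>m n 1) ?W (1\<^sub>m 1)"
  let ?A = "mat n n (\<lambda>(i, j). (if i = j then d i else 0) + u i * v j)"
  let ?c = "1 + (\<Sum>i<n. u i * v i / d i)"
  have "?F * ?R = four_block_mat (?D * 1\<^sub>m n + ?U * ?V) (?D * 0\<^sub>m n 1 + ?U * 1\<^sub>m 1)
      (- ?V * 1\<^sub>m n + 1\<^sub>m 1 * ?V) (- ?V * 0\<^sub>m n 1 + 1\<^sub>m 1 * 1\<^sub>m 1)"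
    by (intro mult_four_block_mat) auto
  also have "\<dots> = four_block_mat ?A ?U (0\<^sub>m 1 n) (1\<^sub>m 1)"
    by (intro cong_four_block_mat eq_matI) (auto simp: scalar_prod_def)
  finally have FR: "?F * ?R = four_block_mat ?A ?U (0\<^sub>m 1 n) (1\<^sub>m 1)" .
  have "?L * ?F = four_block_mat (1\<^sub>m n * ?D + 0\<^sub>m n 1 * (- ?V)) (1\<^sub>m n * ?U + 0\<^sub>m n 1 * 1\<^sub>m 1)
      (?W * ?D + 1\<^sub>m 1 * (- ?V)) (?W * ?U + 1\<^sub>m 1 * 1\<^sub>m 1)"
    by (intro mult_four_block_mat) auto
  also have "\<dots> = four_block_mat ?D ?U (0\<^sub>m 1 n) (?c \<cdot>\<^sub>m 1\<^sub>m 1)"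
  proof (intro cong_four_block_mat)
    show "?W * ?D + 1\<^sub>m 1 * (- ?V) = 0\<^sub>m 1 n"
    proof (intro eq_matI)
      fix i j assume "i < dim_row (0\<^sub>m 1 n :: complex mat)" "j < dim_col (0\<^sub>m 1 n :: complex mat)"
      then have ij: "i = 0" "j < n" by auto
      have "(\<Sum>k = 0..<n. v k / d k * (if k = j then d k else 0)) = v j"
        using ij d by (subst sum.cong[OF refl, of _ _ "\<lambda>k. if k = j then v j else 0"]) auto
      then show "(?W * ?D + 1\<^sub>m 1 * (- ?V)) $$ (i, j) = 0\<^sub>m 1 n $$ (i, j)"
        using ij by (simp add: scalar_prod_def)
    qed auto
    show "?W * ?U + 1\<^sub>m 1 * 1\<^sub>m 1 = ?c \<cdot>\<^sub>m 1\<^sub>m 1"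
      by (intro eq_matI) (auto simp: scalar_prod_def atLeast0LessThan mult.commute)
  qed (auto intro!: eq_matI simp: scalar_prod_def)
  finally have LF: "?L * ?F = four_block_mat ?D ?U (0\<^sub>m 1 n) (?c \<cdot>\<^sub>m 1\<^sub>m 1)" .
  have R: "Determinant.det ?R = 1" 
    by (subst det_four_block_mat_upper_right_zero[of _ n _ 1]) auto
  have L: "Determinant.det ?L = 1" 
    by (subst det_four_block_mat_upper_right_zero[of _ n _ 1]) auto
  have D: "Determinant.det ?D = (\<Prod>i<n. d i)"
    by (subst det_upper_triangular[of _ n])
       (auto simp: upper_triangular_def diag_mat_def prod.list_conv_set_nth atLeast0LessThan)
  have "Determinant.det ?A = Determinant.det (?F * ?R)"
    unfolding FR by (subst det_four_block_mat_lower_left_zero[of _ n _ 1]) auto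
  also have "\<dots> = Determinant.det ?F * Determinant.det ?R" 
    by (intro det_mult[of _ "n + 1"]) auto
  also have "\<dots> = Determinant.det ?L * Determinant.det ?F" by (simp only: L R mult_1_left mult_1_right)
  also have "\<dots> = Determinant.det (?L * ?F)" 
    by (intro det_mult[of _ "n + 1", symmetric]) auto
  also have "\<dots> = Determinant.det ?D * Determinant.det (?c \<cdot>\<^sub>m 1\<^sub>m 1)"
    unfolding LF by (subst det_four_block_mat_lower_left_zero[of _ n _ 1]) auto
  finally show ?thesis by (simp add: D det_smult)
qed

lemma poly_char_poly:
  fixes A :: "complex mat"
  assumes A: "A \<in> carrier_mat n n"
  shows "poly (char_poly A) z = Determinant.det (z \<cdot>\<^sub>m 1\<^sub>m n - A)"
  using char_poly_matrix[OF A, of z] A 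
  by (auto simp: char_matrix_def intro!: arg_cong[where f = Determinant.det] eq_matI)

lemma poly_eqI_cofinite:
  fixes f g :: "complex poly"
  assumes "finite Z" "\<And>z. z \<notin> Z \<Longrightarrow> poly f z = poly g z"
  shows "f = g"
proof (rule ccontr)
  assume "f \<noteq> g"
  then have "finite {z. poly (f - g) z = 0}" by (intro poly_roots_finite) auto
  moreover have "- Z \<subseteq> {z. poly (f - g) z = 0}" using assms by auto
  ultimately have "finite (- Z)" by (rule finite_subset[rotated])
  then show False using assms(1) infinite_UNIV_char_0[where 'a = complex]
    by (metis Compl_partition finite_UnI)
qed

lemma projection_index:
  assumes "i < dim_vec x" "j < dim_vec x"
  shows "projection x $$ (i, j) = (if i = j then 1 else 0) - x $ i * cnj (x $ j)"
  using assms by (simp add: projection_def)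

lemma projection_carrier [simp]: "projection x \<in> carrier_mat (dim_vec x) (dim_vec x)"
  unfolding projection_def by (rule minus_carrier_mat) simp

lemma projection_idem:
  assumes x: "x \<in> carrier_vec n" and unit: "(\<Sum>i<n. x $ i * cnj (x $ i)) = 1"
  shows "projection x * projection x = projection x"
proof (intro eq_matI)
  fix i j assume "i < dim_row (projection x)" "j < dim_col (projection x)"
  then have ij: "i < n" "j < n" using x by (auto simp: projection_def)
  have "(projection x * projection x) $$ (i, j) =
      (\<Sum>k<n. ((if i = k then 1 else 0) - x $ i * cnj (x $ k)) * ((if k = j then 1 else 0) - x $ k * cnj (x $ j)))"
    using ij x by (simp add: scalar_prod_def projection_index projection_def atLeast0LessThan)
  also have "\<dots> = (\<Sum>k<n. (if k = i then (if i = j then 1 else 0) - x $ i * cnj (x $ j) else 0)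
      - (if k = j then x $ i * cnj (x $ j) else 0) + x $ i * cnj (x $ j) * (x $ k * cnj (x $ k)))"
    by (intro sum.cong refl) (auto simp: algebra_simps)
  also have "\<dots> = projection x $$ (i, j)"
    using ij x by (simp add: sum.distrib sum_subtractf projection_index sum_distrib_left[symmetric] unit)
  finally show "(projection x * projection x) $$ (i, j) = projection x $$ (i, j)" .
qed (auto simp: projection_def)

text \<open>Cyclicity and idempotence replace P A P by A P, which is the diagonal matrix minus a
  rank one matrix, so the determinant lemma applies away from 0 and the diagonal entries. The
  polynomial form extends to those points and tolerates repeated entries.\<close>

lemma char_poly_compress_diag:
  fixes as :: "real list" and x :: "complex vec"
  assumes n: "length as = n" and x: "x \<in> carrier_vec n" and unit: "(\<Sum>i<n. (cmod (x $ i))\<^sup>2) = 1"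
  shows "char_poly (projection x * real_diag as * projection x) =
    [:0, 1:] * (\<Sum>i<n. Polynomial.smult (of_real ((cmod (x $ i))\<^sup>2)) (\<Prod>k\<in>{..<n} - {i}. [:- of_real (as ! k), 1:]))"
    (is "char_poly ?M = ?q")
proof (rule poly_eqI_cofinite[of "insert 0 (of_real ` set as)"])
  fix z :: complex assume z: "z \<notin> insert 0 (of_real ` set as)"
  let ?P = "projection x" and ?A = "real_diag as" and ?w = "\<lambda>i. x $ i * cnj (x $ i)"
  have w: "complex_of_real ((cmod (x $ i))\<^sup>2) = ?w i" for i by (rule complex_norm_square)
  have unit': "(\<Sum>i<n. ?w i) = 1" unfolding w[symmetric] using unit by (metis of_real_1 of_real_sum)
  have P: "?P \<in> carrier_mat n n" using x by (metis carrier_vecD projection_carrier)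
  have A: "?A \<in> carrier_mat n n" using n by (simp add: real_diag_def mat_diag_def)
  have M: "?M \<in> carrier_mat n n" using P A by auto
  have z0: "z - of_real (as ! i) \<noteq> 0" if "i < n" for i using z that n by auto
  have "poly (char_poly ?M) z = Determinant.det (z \<cdot>\<^sub>m 1\<^sub>m n - ?P * (?A * ?P))"
    unfolding poly_char_poly[OF M] using P A by (simp add: assoc_mult_mat[of _ n n _ n _ n])
  also have "\<dots> = Determinant.det (z \<cdot>\<^sub>m 1\<^sub>m n - (?A * ?P) * ?P)"
    using P A z by (intro det_diff_mult_comm) auto
  also have "(?A * ?P) * ?P = ?A * ?P"
    using P A projection_idem[OF x unit'] by (simp add: assoc_mult_mat[of _ n n _ n _ n])
  also have "z \<cdot>\<^sub>m 1\<^sub>m n - ?A * ?P = mat n n (\<lambda>(i, j). (if i = j then z - of_real (as ! i) else 0) +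
      (of_real (as ! i) * x $ i) * cnj (x $ j))"
  proof (intro eq_matI)
    fix i j assume "i < dim_row (mat n n (\<lambda>(i, j). (if i = j then z - of_real (as ! i) else 0) +
      (of_real (as ! i) * x $ i) * cnj (x $ j)))" "j < dim_col (mat n n (\<lambda>(i, j). (if i = j then z - of_real (as ! i) else 0) +
      (of_real (as ! i) * x $ i) * cnj (x $ j)))"
    then have ij: "i < n" "j < n" by auto
    have "(?A * ?P) $$ (i, j) = (\<Sum>k<n. (if i = k then of_real (as ! k) else 0) * ?P $$ (k, j))"
      using ij A P n by (auto simp: scalar_prod_def real_diag_def mat_diag_def atLeast0LessThan)
    also have "\<dots> = (\<Sum>k<n. if k = i then of_real (as ! i) * ?P $$ (i, j) else 0)"
      by (intro sum.cong) auto
    also have "\<dots> = of_real (as ! i) * ?P $$ (i, j)" using ij by simp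
    finally show "(z \<cdot>\<^sub>m 1\<^sub>m n - ?A * ?P) $$ (i, j) = mat n n (\<lambda>(i, j). (if i = j then z - of_real (as ! i) else 0) +
      (of_real (as ! i) * x $ i) * cnj (x $ j)) $$ (i, j)"
      using ij A P x by (cases "i = j") (simp_all add: projection_index algebra_simps del: index_mult_mat(1))
  qed (use A P in auto)
  also have "Determinant.det \<dots> = (\<Prod>i<n. z - of_real (as ! i)) *
      (1 + (\<Sum>i<n. (of_real (as ! i) * x $ i) * cnj (x $ i) / (z - of_real (as ! i))))"
    by (rule det_diag_plus_rank_one) (use z0 in auto)
  \<comment> \<open>The 1 is written as the sum of the squared moduli w: each w + a w / (z - a)
    becomes z w / (z - a), and this produces the extra root 0.\<close>
  also have "1 + (\<Sum>i<n. (of_real (as ! i) * x $ i) * cnj (x $ i) / (z - of_real (as ! i))) =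
      (\<Sum>i<n. z * ?w i / (z - of_real (as ! i)))"
    unfolding unit'[symmetric] sum.distrib[symmetric] using z0 by (intro sum.cong refl) (simp add: field_simps)
  also have "(\<Prod>i<n. z - of_real (as ! i)) * \<dots> = poly ?q z"
    unfolding w sum_distrib_left
    by (simp add: poly_sum poly_prod sum_distrib_left)
       (intro sum.cong refl, use z0 in \<open>simp add: prod.remove[of "{..<n}"] field_simps\<close>)
  finally show "poly (char_poly ?M) z = poly ?q z" .
qed simp

section \<open>Lebesgue measure in residue and zero coordinates\<close>

abbreviation lborel_PiM :: "'i set \<Rightarrow> ('i \<Rightarrow> real) measure" where
  "lborel_PiM I \<equiv> Pi\<^sub>M I (\<lambda>_. lborel)"

text \<open>The nodes \<open>a\<close> carry the indices 0 to \<open>n\<close> in decreasing order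
  and the zeros \<open>x\<close> the indices 1 to \<open>n\<close>, one zero in each gap.\<close>

definition interlaced :: "nat \<Rightarrow> (nat \<Rightarrow> real) \<Rightarrow> (nat \<Rightarrow> real) \<Rightarrow> bool" where
  "interlaced n a x \<longleftrightarrow> (\<forall>j\<in>{1..n}. a j < x j \<and> x j < a (j - 1))"

text \<open>The residue at \<open>a i\<close> of the rational function with zeros \<open>x\<close>
  and simple poles \<open>a\<close>.\<close>

definition resid :: "nat \<Rightarrow> (nat \<Rightarrow> real) \<Rightarrow> (nat \<Rightarrow> real) \<Rightarrow> nat \<Rightarrow> real" where
  "resid n a x i = (\<Prod>j\<in>{1..n}. a i - x j) / (\<Prod>k\<in>{..n} - {i}. a i - a k)"

text \<open>Vandermonde product with the sign that makes it positive on decreasing sequences; the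
  lower index is 0 for nodes and 1 for zeros.\<close>

definition vdm :: "nat \<Rightarrow> nat \<Rightarrow> (nat \<Rightarrow> real) \<Rightarrow> real" where
  "vdm m n x = (\<Prod>k\<in>{m..n}. \<Prod>j\<in>{m..<k}. x j - x k)"

section \<open>Lagrange interpolation and partial fractions\<close>

lemma coeff_prod_linear:
  fixes f :: "'i \<Rightarrow> 'c :: idom"
  assumes "finite A"
  shows "degree (\<Prod>k\<in>A. [:- f k, 1:]) = card A" "coeff (\<Prod>k\<in>A. [:- f k, 1:]) (card A) = 1"
proof -
  show 1: "degree (\<Prod>k\<in>A. [:- f k, 1:]) = card A"
    by (subst degree_prod_eq_sum_degree) (auto)
  have "lead_coeff (\<Prod>k\<in>A. [:- f k, 1:]) = 1"
    by (subst lead_coeff_prod) auto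
  then show "coeff (\<Prod>k\<in>A. [:- f k, 1:]) (card A) = 1" unfolding 1 .
qed

lemma poly_eqI_many_roots:
  fixes p q :: "'c :: idom poly"
  assumes "degree p \<le> n" "degree q \<le> n" "card A > n" "\<And>x. x \<in> A \<Longrightarrow> poly p x = poly q x"
  shows "p = q"
proof (rule ccontr)
  assume ne: "p \<noteq> q"
  have "finite {x. poly (p - q) x = 0}" using ne by (intro poly_roots_finite) auto
  then have "card A \<le> card {x. poly (p - q) x = 0}"
    using assms(4) by (intro card_mono) auto
  also have "\<dots> \<le> degree (p - q)" using ne by (intro card_poly_roots_bound) auto
  also have "\<dots> \<le> n" using assms(1,2) by (rule degree_diff_le)
  finally show False using assms(3) by simp
qed

text \<open>Lagrange interpolation at the nodes: both sides have degree at most \<open>n\<close> and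
  agree at \<open>n + 1\<close> points.\<close>

lemma lagrange_resid:
  assumes a: "inj_on a {..n}"
  shows "(\<Prod>j\<in>{1..n}. [:- x j, 1:]) = (\<Sum>i\<le>n. Polynomial.smult (resid n a x i) (\<Prod>k\<in>{..n} - {i}. [:- a k, 1:]))"
    (is "?p = ?q")
proof (rule poly_eqI_many_roots[where A = "a ` {..n}"])
  show "degree ?p \<le> n" by (subst coeff_prod_linear) auto
  show "degree ?q \<le> n"
    by (intro degree_sum_le) (auto intro!: order_trans[OF degree_smult_le] simp: coeff_prod_linear)
  show "n < card (a ` {..n})" using a by (simp add: card_image)
  fix y assume "y \<in> a ` {..n}"
  then obtain i where i: "i \<le> n" "y = a i" by auto
  have nz: "(\<Prod>k\<in>{..n} - {i}. a i - a k) \<noteq> 0"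
    using a i by (auto simp: prod_zero_iff inj_on_def)
  have "poly ?q y = (\<Sum>l\<le>n. resid n a x l * (\<Prod>k\<in>{..n} - {l}. a i - a k))"
    by (simp add: poly_sum poly_prod i)
  also have "\<dots> = (\<Sum>l\<le>n. if l = i then resid n a x i * (\<Prod>k\<in>{..n} - {i}. a i - a k) else 0)"
    using i by (intro sum.cong refl) (auto simp: prod_zero_iff)
  also have "\<dots> = poly ?p y"
    using nz i by (simp add: resid_def poly_prod)
  finally show "poly ?p y = poly ?q y" ..
qed

text \<open>Comparison of the coefficients of degree \<open>n\<close> in the interpolation
  formula.\<close>

lemma sum_resid:
  assumes "inj_on a {..n}" shows "(\<Sum>i\<le>n. resid n a x i) = 1"
proof -
  have "coeff (\<Prod>j\<in>{1..n}. [:- x j, 1:]) n = 1" using coeff_prod_linear(2)[of "{1..n}" x] by simp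
  moreover have "coeff (\<Prod>k\<in>{..n} - {i}. [:- a k, 1:]) n = 1" if "i \<le> n" for i
    using coeff_prod_linear(2)[of "{..n} - {i}" a] that by simp
  ultimately show ?thesis
    unfolding lagrange_resid[OF assms, of x] by (simp add: coeff_sum)
qed

lemma sum_resid_divide:
  assumes a: "inj_on a {..n}" and z: "z \<notin> a ` {..n}"
  shows "(\<Sum>i\<le>n. resid n a x i / (z - a i)) = (\<Prod>j\<in>{1..n}. z - x j) / (\<Prod>i\<le>n. z - a i)"
proof -
  have nz: "z - a i \<noteq> 0" if "i \<le> n" for i using z that by auto
  have "(\<Prod>j\<in>{1..n}. z - x j) = poly (\<Prod>j\<in>{1..n}. [:- x j, 1:]) z" by (simp add: poly_prod)
  also have "\<dots> = (\<Sum>i\<le>n. resid n a x i * (\<Prod>k\<in>{..n} - {i}. z - a k))"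
    unfolding lagrange_resid[OF a] by (simp add: poly_sum poly_prod)
  also have "\<dots> / (\<Prod>i\<le>n. z - a i) = (\<Sum>i\<le>n. resid n a x i / (z - a i))"
    unfolding sum_divide_distrib using nz
    by (intro sum.cong refl) (simp add: prod.remove[of "{..n}"])
  finally show ?thesis ..
qed

lemma vdm_Suc: "m \<le> Suc n \<Longrightarrow> vdm m (Suc n) x = vdm m n x * (\<Prod>j\<in>{m..n}. x j - x (Suc n))"
  unfolding vdm_def by (subst prod.nat_ivl_Suc') (auto simp: atLeastLessThanSuc_atLeastAtMost mult.commute)

lemma vdm_cong: "(\<And>k. k \<in> {m..n} \<Longrightarrow> x k = y k) \<Longrightarrow> vdm m n x = vdm m n y"
  unfolding vdm_def by (intro prod.cong refl) auto

section \<open>Substitution in one variable and diagonal rescaling\<close>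

lemma SUP_nn_integral_incseq:
  assumes [measurable]: "f \<in> borel_measurable N" and A: "range A \<subseteq> sets N" "incseq A"
  shows "(SUP k. \<integral>\<^sup>+x. f x * indicator (A k) x \<partial>N) = (\<integral>\<^sup>+x. f x * indicator (\<Union>k. A k) x \<partial>N)"
proof -
  have "(SUP k. emeasure (density N f) (A k)) = emeasure (density N f) (\<Union>k. A k)"
    using A by (intro SUP_emeasure_incseq) auto
  moreover have "emeasure (density N f) (A k) = (\<integral>\<^sup>+x. f x * indicator (A k) x \<partial>N)" for k
    using A by (intro emeasure_density) auto
  moreover have "emeasure (density N f) (\<Union>k. A k) = (\<integral>\<^sup>+x. f x * indicator (\<Union>k. A k) x \<partial>N)"
    using A by (intro emeasure_density) auto
  ultimately show ?thesis by simp
qed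

text \<open>Here \<open>h\<close> may blow up at \<open>c\<close>, so the substitution is made on
  compact subintervals and passed to the limit by monotone convergence. The hypotheses
  \<open>pos\<close>, \<open>lo\<close> and \<open>hi\<close> make the images exhaust the positive
  half-line.\<close>

lemma nn_integral_substitution_open:
  fixes h h' :: "real \<Rightarrow> real" and f :: "real \<Rightarrow> ennreal"
  assumes bc: "b < c" and f [measurable]: "f \<in> borel_measurable borel"
    and deriv: "\<And>x. b < x \<Longrightarrow> x < c \<Longrightarrow> (h has_real_derivative h' x) (at x)"
    and cont: "continuous_on {b<..<c} h'"
    and nonneg: "\<And>x. b < x \<Longrightarrow> x < c \<Longrightarrow> 0 \<le> h' x"
    and pos: "\<And>x. b < x \<Longrightarrow> x < c \<Longrightarrow> 0 < h x"
    and lo: "\<And>y. 0 < y \<Longrightarrow> \<exists>u. b < u \<and> u < c \<and> h u \<le> y"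
    and hi: "\<And>y. 0 < y \<Longrightarrow> \<exists>u. b < u \<and> u < c \<and> y \<le> h u"
  shows "(\<integral>\<^sup>+y. f y * indicator {0<..} y \<partial>lborel) =
    (\<integral>\<^sup>+x. f (h x) * ennreal (h' x) * indicator {b<..<c} x \<partial>lborel)"
proof -
  \<comment> \<open>The 3 in the denominator keeps \<open>e k\<close> below half the length from
    \<open>k = 0\<close> on, so no subinterval is empty.\<close>
  define e where "e k = (c - b) / (real k + 3)" for k
  have e: "0 < e k" "e k < (c - b) / 2" for k
  proof -
    show "0 < e k" using bc by (simp add: e_def)
    show "e k < (c - b) / 2" unfolding e_def by (rule divide_strict_left_mono) (use bc in auto)
  qed
  have e_mono: "e l \<le> e k" if "k \<le> l" for k l using bc that by (auto simp: e_def intro!: divide_left_mono)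
  have e_small: "\<exists>k. e k \<le> d" if "0 < d" for d
  proof -
    obtain k where "(c - b) / d \<le> real k" using real_arch_simple by blast
    then have "e k \<le> d" using that bc by (simp add: e_def field_simps)
    then show ?thesis ..
  qed
  define A where "A k = {b + e k..c - e k}" for k
  define B where "B k = {h (b + e k)..h (c - e k)}" for k
  have mono: "h x \<le> h y" if "b < x" "x \<le> y" "y < c" for x y
  proof (rule DERIV_nonneg_imp_nondecreasing[OF that(2)])
    fix z assume "x \<le> z" "z \<le> y"
    then show "\<exists>w. (h has_real_derivative w) (at z) \<and> 0 \<le> w"
      using that deriv[of z] nonneg[of z] by (intro exI[of _ "h' z"]) auto
  qed
  have eq: "(\<integral>\<^sup>+y. f y * indicator (B k) y \<partial>lborel) =
      (\<integral>\<^sup>+x. (f (h x) * ennreal (h' x) * indicator {b<..<c} x) * indicator (A k) x \<partial>lborel)" for k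
  proof -
    have ek: "b < b + e k" "b + e k < c - e k" "c - e k < c" using e[of k] by auto
    have "(\<integral>\<^sup>+y. f y * indicator (B k) y \<partial>lborel) =
        (\<integral>\<^sup>+x. f (h x) * ennreal (h' x) * indicator (A k) x \<partial>lborel)"
      unfolding A_def B_def
      by (rule nn_integral_substitution_aux)
        (use ek in \<open>auto intro!: deriv nonneg continuous_on_subset[OF cont]\<close>)
    also have "\<dots> = (\<integral>\<^sup>+x. (f (h x) * ennreal (h' x) * indicator {b<..<c} x) * indicator (A k) x \<partial>lborel)"
      using ek by (intro nn_integral_cong) (auto simp: A_def indicator_def)
    finally show ?thesis .
  qed
  have fm: "(\<lambda>x. f (h x) * ennreal (h' x) * indicator {b<..<c} x) \<in> borel_measurable borel"
  proof -
    have "continuous_on {b<..<c} h"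
      using deriv by (intro continuous_at_imp_continuous_on ballI) (auto intro: DERIV_isCont)
    then have [measurable]: "h \<in> borel_measurable (restrict_space borel {b<..<c})"
      by (rule borel_measurable_continuous_on_restrict)
    have [measurable]: "h' \<in> borel_measurable (restrict_space borel {b<..<c})"
      using cont by (rule borel_measurable_continuous_on_restrict)
    show ?thesis
      by (subst borel_measurable_restrict_space_iff_ennreal[symmetric]) (auto, measurable)
  qed
  have inc: "incseq A" "incseq B"
  proof -
    show "incseq A" unfolding incseq_def A_def using e_mono by auto
    show "incseq B" unfolding incseq_def B_def
    proof safe
      fix k l :: nat and x assume kl: "k \<le> l" and x: "x \<in> {h (b + e k)..h (c - e k)}"
      have "h (b + e l) \<le> h (b + e k)" "h (c - e k) \<le> h (c - e l)"
        using e[of k] e[of l] e_mono[OF kl] by (auto intro!: mono)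
      with x show "x \<in> {h (b + e l)..h (c - e l)}" by auto
    qed
  qed
  have UA: "(\<Union>k. A k) = {b<..<c}"
  proof safe
    fix x k assume "x \<in> A k" then show "x \<in> {b<..<c}" using e[of k] by (auto simp: A_def)
  next
    fix x assume x: "x \<in> {b<..<c}"
    then obtain k where "e k \<le> min (x - b) (c - x)" using e_small[of "min (x - b) (c - x)"] by auto
    then show "x \<in> (\<Union>k. A k)" by (auto simp: A_def intro!: exI[of _ k])
  qed
  have UB: "(\<Union>k. B k) = {0<..}"
  proof safe
    fix x k assume "x \<in> B k" then show "0 < x" using e[of k] pos[of "b + e k"] by (auto simp: B_def)
  next
    fix y :: real assume y: "0 < y"
    obtain u where u: "b < u" "u < c" "h u \<le> y" using lo[OF y] by auto
    obtain v where v: "b < v" "v < c" "y \<le> h v" using hi[OF y] by auto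
    obtain k where k: "e k \<le> min (u - b) (c - v)" using e_small[of "min (u - b) (c - v)"] u v by auto
    have "h (b + e k) \<le> h u" "h v \<le> h (c - e k)"
      using k u v e[of k] by (auto intro!: mono)
    then show "y \<in> (\<Union>k. B k)" using u v by (auto simp: B_def intro!: exI[of _ k])
  qed
  have rA: "range A \<subseteq> sets lborel" and rB: "range B \<subseteq> sets lborel" by (auto simp: A_def B_def)
  have "(\<integral>\<^sup>+y. f y * indicator {0<..} y \<partial>lborel) = (SUP k. \<integral>\<^sup>+y. f y * indicator (B k) y \<partial>lborel)"
    unfolding UB[symmetric] by (rule SUP_nn_integral_incseq[OF _ rB inc(2), symmetric]) simp
  also have "\<dots> = (\<integral>\<^sup>+x. (f (h x) * ennreal (h' x) * indicator {b<..<c} x) * indicator {b<..<c} x \<partial>lborel)"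
    unfolding eq using SUP_nn_integral_incseq[OF _ rA inc(1)] fm by (simp add: UA)
  also have "\<dots> = (\<integral>\<^sup>+x. f (h x) * ennreal (h' x) * indicator {b<..<c} x \<partial>lborel)"
    by (intro nn_integral_cong) (auto simp: indicator_def)
  finally show ?thesis .
qed

interpretation lborel_prod: product_sigma_finite "\<lambda>_. lborel :: 'b :: euclidean_space measure"
  by unfold_locales

lemma nn_integral_PiM_scale:
  fixes F :: "('i \<Rightarrow> real) \<Rightarrow> ennreal"
  assumes "finite I" "\<And>i. i \<in> I \<Longrightarrow> 0 < c i" "F \<in> borel_measurable (lborel_PiM I)"
  shows "(\<integral>\<^sup>+x. F x \<partial>(lborel_PiM I)) =
    ennreal (\<Prod>i\<in>I. c i) * (\<integral>\<^sup>+x. F (\<lambda>i\<in>I. c i * x i) \<partial>(lborel_PiM I))"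
  using assms
proof (induction I arbitrary: F rule: finite_induct)
  case empty
  show ?case by (simp add: PiM_empty nn_integral_count_space_finite)
next
  case (insert i I)
  note F[measurable] = insert.prems(2)
  have ci: "0 < c i" using insert.prems by auto
  have [measurable]: "(\<lambda>(x, y). x(i := y)) \<in> measurable ((lborel_PiM I) \<Otimes>\<^sub>M lborel) (lborel_PiM (insert i I))"
    by (rule measurable_add_dim)
  have [measurable]: "(\<lambda>x. \<lambda>j\<in>insert i I. c j * x j) \<in> measurable (lborel_PiM (insert i I)) (lborel_PiM (insert i I))"
    by (intro measurable_restrict) measurable
  have [measurable]: "(\<lambda>x. \<lambda>j\<in>I. c j * x j) \<in> measurable (lborel_PiM I) (lborel_PiM I)"
    by (intro measurable_restrict) measurable
  have F2[measurable]: "(\<lambda>(x, y). F (x(i := y))) \<in> borel_measurable ((lborel_PiM I) \<Otimes>\<^sub>M lborel)"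
    using measurable_compose[OF measurable_add_dim[of i I "\<lambda>_. lborel"] F] by (simp add: split_beta')
  have Fy: "(\<lambda>y. F (x(i := y))) \<in> borel_measurable borel" if "x \<in> space (lborel_PiM I)" for x
    using measurable_compose_Pair1[OF that F2] by simp
  have "(\<integral>\<^sup>+x. F x \<partial>(lborel_PiM (insert i I))) = (\<integral>\<^sup>+x. \<integral>\<^sup>+y. F (x(i := y)) \<partial>lborel \<partial>(lborel_PiM I))"
    using insert by (intro lborel_prod.product_nn_integral_insert) auto
  also have "\<dots> = (\<integral>\<^sup>+x. ennreal (c i) * (\<integral>\<^sup>+y. F (x(i := c i * y)) \<partial>lborel) \<partial>(lborel_PiM I))"
    by (intro nn_integral_cong, subst nn_integral_real_affine[OF Fy, of _ "c i" 0]) (use ci in auto)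
  also have "\<dots> = ennreal (\<Prod>i\<in>I. c i) * (\<integral>\<^sup>+x. ennreal (c i) * (\<integral>\<^sup>+y. F ((\<lambda>j\<in>I. c j * x j)(i := c i * y)) \<partial>lborel) \<partial>(lborel_PiM I))"
  proof (intro insert.IH)
    have [measurable]: "(\<lambda>z. (fst z)(i := c i * snd z)) \<in> measurable ((lborel_PiM I) \<Otimes>\<^sub>M lborel) (lborel_PiM (insert i I))"
      by (rule measurable_fun_upd[where J = I]) (auto intro!: borel_measurable_times measurable_snd')
    show "(\<lambda>x. ennreal (c i) * (\<integral>\<^sup>+y. F (x(i := c i * y)) \<partial>lborel)) \<in> borel_measurable (lborel_PiM I)"
      by (intro borel_measurable_times_ennreal borel_measurable_const
            sigma_finite_measure.borel_measurable_nn_integral[OF sigma_finite_lborel])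
         (simp add: split_beta' measurable_compose[OF _ F])
  qed (use insert.prems in auto)
  also have "\<dots> = ennreal (\<Prod>i\<in>I. c i) * (ennreal (c i) * (\<integral>\<^sup>+x. (\<integral>\<^sup>+y. F ((\<lambda>j\<in>I. c j * x j)(i := c i * y)) \<partial>lborel) \<partial>(lborel_PiM I)))"
    by (subst nn_integral_cmult) auto
  also have "\<dots> = ennreal (\<Prod>i\<in>insert i I. c i) * (\<integral>\<^sup>+x. (\<integral>\<^sup>+y. F ((\<lambda>j\<in>I. c j * x j)(i := c i * y)) \<partial>lborel) \<partial>(lborel_PiM I))"
    using insert ci by (simp add: ennreal_mult prod_nonneg less_imp_le mult_ac)
  also have "(\<integral>\<^sup>+x. (\<integral>\<^sup>+y. F ((\<lambda>j\<in>I. c j * x j)(i := c i * y)) \<partial>lborel) \<partial>(lborel_PiM I)) =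
      (\<integral>\<^sup>+x. (\<integral>\<^sup>+y. F (\<lambda>j\<in>insert i I. c j * (x(i := y)) j) \<partial>lborel) \<partial>(lborel_PiM I))"
    using insert by (intro nn_integral_cong arg_cong[where f = F]) (auto simp: fun_eq_iff)
  also have "\<dots> = (\<integral>\<^sup>+x. F (\<lambda>j\<in>insert i I. c j * x j) \<partial>(lborel_PiM (insert i I)))"
    using insert by (intro lborel_prod.product_nn_integral_insert[symmetric]) auto
  finally show ?case .
qed

section \<open>Adding one pole and one zero\<close>

text \<open>The new pole and the new zero multiply an old residue by a factor free of
  \<open>x\<close>. For a fixed new zero, old and new residues thus differ by a diagonal
  rescaling.\<close>

lemma resid_Suc:
  assumes i: "i \<le> n"
  shows "resid (Suc n) a (x(Suc n := \<mu>)) i = (a i - \<mu>) / (a i - a (Suc n)) * resid n a x i"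
proof -
  have "{..Suc n} - {i} = insert (Suc n) ({..n} - {i})" using i by auto
  moreover have "(\<Prod>j\<in>{1..n}. a i - (x(Suc n := \<mu>)) j) = (\<Prod>j\<in>{1..n}. a i - x j)"
    by (intro prod.cong) auto
  ultimately show ?thesis unfolding resid_def by simp
qed

text \<open>The old partial fraction evaluated at the new pole. Expressed through the rescaled
  residues, this is \<open>pole_balance\<close> at \<mu>.\<close>

lemma resid_Suc_last:
  assumes a: "inj_on a {..Suc n}"
  shows "resid (Suc n) a (x(Suc n := \<mu>)) (Suc n) = (\<mu> - a (Suc n)) * (\<Sum>i\<le>n. resid n a x i / (a i - a (Suc n)))"
proof -
  have inj: "inj_on a {..n}" using a by (rule inj_on_subset) auto
  have ni: "a (Suc n) \<notin> a ` {..n}"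
  proof
    assume "a (Suc n) \<in> a ` {..n}"
    then obtain i where "i \<le> n" "a (Suc n) = a i" by auto
    with inj_on_eq_iff[OF a, of "Suc n" i] show False by auto
  qed
  have eq: "(\<Prod>j\<in>{1..n}. a (Suc n) - (x(Suc n := \<mu>)) j) = (\<Prod>j\<in>{1..n}. a (Suc n) - x j)"
    by (intro prod.cong) auto
  have "{..Suc n} - {Suc n} = {..n}" by auto
  then have "resid (Suc n) a (x(Suc n := \<mu>)) (Suc n) =
      (a (Suc n) - \<mu>) * ((\<Prod>j\<in>{1..n}. a (Suc n) - x j) / (\<Prod>i\<le>n. a (Suc n) - a i))"
    unfolding resid_def using eq by simp
  also have "\<dots> = (a (Suc n) - \<mu>) * (\<Sum>i\<le>n. resid n a x i / (a (Suc n) - a i))"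
    by (simp only: sum_resid_divide[OF inj ni])
  also have "(\<Sum>i\<le>n. resid n a x i / (a (Suc n) - a i)) = - (\<Sum>i\<le>n. resid n a x i / (a i - a (Suc n)))"
    unfolding sum_negf[symmetric] by (intro sum.cong refl) (simp add: minus_divide_right)
  also have "(a (Suc n) - \<mu>) * - (\<Sum>i\<le>n. resid n a x i / (a i - a (Suc n))) =
      (\<mu> - a (Suc n)) * (\<Sum>i\<le>n. resid n a x i / (a i - a (Suc n)))"
    by (simp add: algebra_simps)
  finally show ?thesis .
qed

lemma sum_resid_divide':
  assumes a: "inj_on a {..n}" and z: "z \<notin> a ` {..n}"
  shows "(\<Sum>i\<le>n. resid n a x i / (a i - z)) = (\<Prod>j\<in>{1..n}. x j - z) / (\<Prod>i\<le>n. a i - z)"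
proof -
  have m: "(\<Prod>j\<in>A. f j - z) = (- 1) ^ card A * (\<Prod>j\<in>A. z - f j)" for A and f :: "nat \<Rightarrow> real"
    using prod_uminus[of "\<lambda>j. z - f j" A] by simp
  have "(\<Sum>i\<le>n. resid n a x i / (a i - z)) = - (\<Sum>i\<le>n. resid n a x i / (z - a i))"
    unfolding sum_negf[symmetric] by (intro sum.cong refl) (simp add: minus_divide_right)
  also have "\<dots> = (\<Prod>j\<in>{1..n}. x j - z) / (\<Prod>i\<le>n. a i - z)"
    unfolding sum_resid_divide[OF a z] m by (simp add: field_simps)
  finally show ?thesis .
qed

lemma decseq_on_less:
  fixes a :: "nat \<Rightarrow> real"
  assumes "\<And>i. i < n \<Longrightarrow> a (Suc i) < a i"
  shows "i < j \<Longrightarrow> j \<le> n \<Longrightarrow> a j < a i"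
proof (induction j)
  case (Suc j)
  then show ?case using assms[of j] by (cases "i = j") auto
qed simp

lemma decseq_on_inj:
  fixes a :: "nat \<Rightarrow> real"
  assumes "\<And>i. i < n \<Longrightarrow> a (Suc i) < a i"
  shows "inj_on a {..n}"
proof (rule inj_onI)
  fix i j assume ij: "i \<in> {..n}" "j \<in> {..n}" "a i = a j"
  have less: "a l < a k" if "k < l" "l \<le> n" for k l
    using decseq_on_less[of n a k l] assms that by blast
  show "i = j" using ij less[of i j] less[of j i]
    by (cases i j rule: linorder_cases) auto
qed

text \<open>The three factors are the determinant of the rescaling, the derivative of the
  one-variable substitution and the Jacobian of the smaller problem. The derivative is
  \<open>S\<close> times the old partial fraction at \<mu>; its denominator cancels the numerators
  of the rescaling, and what remains are the new factors of the two Vandermonde products.\<close>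

lemma resid_jacobian:
  fixes a x :: "nat \<Rightarrow> real"
  assumes dec: "\<And>i. i < Suc n \<Longrightarrow> a (Suc i) < a i"
    and \<mu>: "a (Suc n) < \<mu>" "\<mu> < a n"
  shows "(\<Prod>i\<le>n. (a i - \<mu>) / (a i - a (Suc n))) *
      (\<Sum>i\<le>n. (a i - \<mu>) / (a i - a (Suc n)) * (S * resid n a x i) * (a i - a (Suc n)) / (a i - \<mu>)\<^sup>2) *
      (S ^ n * vdm 1 n x / vdm 0 n a) =
    S ^ Suc n * vdm 1 (Suc n) (x(Suc n := \<mu>)) / vdm 0 (Suc n) a" (is "?C * ?H * _ = _")
    and "(\<Sum>i\<le>n. (a i - \<mu>) / (a i - a (Suc n)) * (S * resid n a x i) * (a i - a (Suc n)) / (a i - \<mu>)\<^sup>2) =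
      S * ((\<Prod>j\<in>{1..n}. x j - \<mu>) / (\<Prod>i\<le>n. a i - \<mu>))"
proof -
  have inj: "inj_on a {..n}" by (rule decseq_on_inj) (use dec in auto)
  have le: "a n \<le> a i" if "i \<le> n" for i using decseq_on_less[of n a i n] dec that by (cases "i = n") auto
  have ni: "\<mu> \<notin> a ` {..n}" using le \<mu> by force
  have nz: "a i - \<mu> \<noteq> 0" "a i - a (Suc n) \<noteq> 0" if "i \<le> n" for i using le[OF that] \<mu> by auto
  have "?H = (\<Sum>i\<le>n. S * (resid n a x i / (a i - \<mu>)))"
    using nz by (intro sum.cong refl) (simp add: power2_eq_square)
  also have "\<dots> = S * ((\<Prod>j\<in>{1..n}. x j - \<mu>) / (\<Prod>i\<le>n. a i - \<mu>))"
    unfolding sum_distrib_left[symmetric] sum_resid_divide'[OF inj ni] ..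
  finally show H: "?H = S * ((\<Prod>j\<in>{1..n}. x j - \<mu>) / (\<Prod>i\<le>n. a i - \<mu>))" .
  have nz': "(\<Prod>i\<le>n. a i - \<mu>) \<noteq> 0" using nz by auto
  have v1: "vdm 1 (Suc n) (x(Suc n := \<mu>)) = vdm 1 n x * (\<Prod>j\<in>{1..n}. x j - \<mu>)"
  proof -
    have "vdm 1 n (x(Suc n := \<mu>)) = vdm 1 n x" by (intro vdm_cong) auto
    moreover have "(\<Prod>j\<in>{1..n}. (x(Suc n := \<mu>)) j - \<mu>) = (\<Prod>j\<in>{1..n}. x j - \<mu>)" by (intro prod.cong) auto
    ultimately show ?thesis using vdm_Suc[of 1 n "x(Suc n := \<mu>)"] by simp
  qed
  have v0: "vdm 0 (Suc n) a = vdm 0 n a * (\<Prod>i\<le>n. a i - a (Suc n))"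
    using vdm_Suc[of 0 n a] by (simp add: atLeast0AtMost)
  show "?C * ?H * (S ^ n * vdm 1 n x / vdm 0 n a) = S ^ Suc n * vdm 1 (Suc n) (x(Suc n := \<mu>)) / vdm 0 (Suc n) a"
    unfolding H v0 v1 prod_dividef using nz' by (simp add: mult.commute mult.left_commute)
qed

lemma measurable_resid [measurable]:
  "i \<le> n \<Longrightarrow> (\<lambda>x. resid n a x i) \<in> borel_measurable (lborel_PiM {1..n})"
  unfolding resid_def by measurable

lemma measurable_vdm [measurable]:
  "(\<lambda>x. vdm m n x) \<in> borel_measurable (lborel_PiM {m..n})"
  unfolding vdm_def
proof (intro borel_measurable_prod borel_measurable_diff)
  fix k j assume "k \<in> {m..n}" "j \<in> {m..<k}"
  then have "k \<in> {m..n}" "j \<in> {m..n}" by auto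
  then show "(\<lambda>x. x k) \<in> borel_measurable (lborel_PiM {m..n})"
      "(\<lambda>x. x j) \<in> borel_measurable (lborel_PiM {m..n})"
    using measurable_component_singleton[of k "{m..n}" "\<lambda>_. lborel :: real measure"]
      measurable_component_singleton[of j "{m..n}" "\<lambda>_. lborel :: real measure"] by simp_all
qed

lemma measurable_interlaced [measurable]:
  "Measurable.pred (lborel_PiM {1..n}) (interlaced n a)"
  unfolding interlaced_def by measurable

text \<open>The integrand after replacing the \<open>n + 1\<close> residues by their sum
  \<open>S\<close> and the \<open>n\<close> zeros; the last factor is the Jacobian.\<close>

definition resid_integrand :: "((nat \<Rightarrow> real) \<Rightarrow> ennreal) \<Rightarrow> nat \<Rightarrow> (nat \<Rightarrow> real) \<Rightarrow> real \<Rightarrow> (nat \<Rightarrow> real) \<Rightarrow> ennreal" where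
  "resid_integrand G n a S x = (if 0 < S \<and> interlaced n a x
    then G (\<lambda>i\<in>{..n}. S * resid n a x i) * ennreal (S ^ n * vdm 1 n x / vdm 0 n a) else 0)"

lemma measurable_resid_integrand:
  assumes G [measurable]: "G \<in> borel_measurable (lborel_PiM {..n})"
  shows "(\<lambda>(S, x). resid_integrand G n a S x) \<in> borel_measurable (lborel \<Otimes>\<^sub>M (lborel_PiM {1..n}))"
proof -
  have [measurable]: "(\<lambda>z. \<lambda>i\<in>{..n}. fst z * resid n a (snd z) i) \<in>
      measurable (lborel \<Otimes>\<^sub>M (lborel_PiM {1..n})) (lborel_PiM {..n})"
  proof (rule measurable_restrict)
    fix i assume "i \<in> {..n}"
    then have [measurable]: "(\<lambda>z. resid n a (snd z) i) \<in> borel_measurable (lborel \<Otimes>\<^sub>M (lborel_PiM {1..n}))"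
      by (intro measurable_compose[OF measurable_snd measurable_resid]) auto
    show "(\<lambda>z. fst z * resid n a (snd z) i) \<in> measurable (lborel \<Otimes>\<^sub>M (lborel_PiM {1..n})) lborel"
      by measurable
  qed
  show ?thesis unfolding resid_integrand_def split_beta' by measurable
qed

lemma nn_integral_swap_sigma_finite:
  assumes "sigma_finite_measure A" "sigma_finite_measure B"
    and "(\<lambda>(x, y). f x y) \<in> borel_measurable (A \<Otimes>\<^sub>M B)"
  shows "(\<integral>\<^sup>+y. \<integral>\<^sup>+x. f x y \<partial>A \<partial>B) = (\<integral>\<^sup>+x. \<integral>\<^sup>+y. f x y \<partial>B \<partial>A)"
  using assms by (intro pair_sigma_finite.Fubini') (simp_all add: pair_sigma_finite_def)

lemma sigma_finite_PiM_lborel: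
  "finite I \<Longrightarrow> sigma_finite_measure (lborel_PiM I)"
  by (rule lborel_prod.sigma_finite)

text \<open>Given the residues at the nodes other than \<open>b\<close>, the residue \<open>pole_balance n a b \<Gamma> \<mu>\<close> at \<open>b\<close> is
  the one for which \<open>\<mu>\<close> becomes a zero of the partial fraction.\<close>

definition pole_balance :: "nat \<Rightarrow> (nat \<Rightarrow> real) \<Rightarrow> real \<Rightarrow> (nat \<Rightarrow> real) \<Rightarrow> real \<Rightarrow> real" where
  "pole_balance n a b \<Gamma> \<mu> = (\<mu> - b) * (\<Sum>i\<le>n. \<Gamma> i / (a i - \<mu>))"

definition pole_balance_deriv :: "nat \<Rightarrow> (nat \<Rightarrow> real) \<Rightarrow> real \<Rightarrow> (nat \<Rightarrow> real) \<Rightarrow> real \<Rightarrow> real" where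
  "pole_balance_deriv n a b \<Gamma> \<mu> = (\<Sum>i\<le>n. \<Gamma> i * (a i - b) / (a i - \<mu>)\<^sup>2)"

text \<open>With the other residues fixed, the residue at \<open>b\<close> increases from 0 to
  infinity as the zero moves from \<open>b\<close> to the next pole \<open>a n\<close>, so either
  may serve as the coordinate.\<close>

lemma nn_integral_pole_balance:
  fixes f :: "real \<Rightarrow> ennreal"
  assumes f: "f \<in> borel_measurable borel" and \<Gamma>: "\<And>i. i \<le> n \<Longrightarrow> 0 < \<Gamma> i"
    and a: "\<And>i. i \<le> n \<Longrightarrow> a n \<le> a i" and b: "b < a n"
  shows "(\<integral>\<^sup>+y. f y * indicator {0<..} y \<partial>lborel) =
    (\<integral>\<^sup>+\<mu>. f (pole_balance n a b \<Gamma> \<mu>) * ennreal (pole_balance_deriv n a b \<Gamma> \<mu>) * indicator {b<..<a n} \<mu> \<partial>lborel)"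
proof (rule nn_integral_substitution_open[OF b f])
  fix x assume x: "b < x" "x < a n"
  have gt: "x < a i" if "i \<le> n" for i using a[OF that] x by simp
  have "((\<lambda>x. (x - b) * (\<Sum>i\<le>n. \<Gamma> i / (a i - x))) has_real_derivative
      (\<Sum>i\<le>n. \<Gamma> i / (a i - x)) + (x - b) * (\<Sum>i\<le>n. \<Gamma> i / (a i - x)\<^sup>2)) (at x)"
    by (rule derivative_eq_intros refl | use gt in force)+
       (auto simp: power2_eq_square)
  \<comment> \<open>Termwise, 1/(a - x) + (x - b)/(a - x)^2 collapses to (a - b)/(a - x)^2, whose
    sign is visible.\<close>
  also have "(\<Sum>i\<le>n. \<Gamma> i / (a i - x)) + (x - b) * (\<Sum>i\<le>n. \<Gamma> i / (a i - x)\<^sup>2) = pole_balance_deriv n a b \<Gamma> x"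
    unfolding pole_balance_deriv_def sum_distrib_left sum.distrib[symmetric]
  proof (intro sum.cong refl)
    fix i assume "i \<in> {..n}"
    then have "a i - x \<noteq> 0" using gt[of i] by auto
    then show "\<Gamma> i / (a i - x) + (x - b) * (\<Gamma> i / (a i - x)\<^sup>2) = \<Gamma> i * (a i - b) / (a i - x)\<^sup>2"
      by (simp add: divide_simps power2_eq_square) (simp add: algebra_simps)
  qed
  finally show "(pole_balance n a b \<Gamma> has_real_derivative pole_balance_deriv n a b \<Gamma> x) (at x)"
    unfolding pole_balance_def[abs_def] .
  show "0 \<le> pole_balance_deriv n a b \<Gamma> x" unfolding pole_balance_deriv_def
    using gt x \<Gamma> by (intro sum_nonneg divide_nonneg_nonneg mult_nonneg_nonneg) (force simp: less_imp_le)+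
  show "0 < pole_balance n a b \<Gamma> x" unfolding pole_balance_def
    using gt x \<Gamma> by (intro mult_pos_pos sum_pos divide_pos_pos) auto
next
  show "continuous_on {b<..<a n} (pole_balance_deriv n a b \<Gamma>)"
    unfolding pole_balance_deriv_def[abs_def]
    by (intro continuous_intros) (use a in force)
next
  fix y :: real assume y: "0 < y"
  define m where "m = (b + a n) / 2"
  define C where "C = (\<Sum>i\<le>n. \<Gamma> i / (a i - m))"
  have m: "b < m" "m < a n" using b by (auto simp: m_def)
  have gt: "m < a i" if "i \<le> n" for i using a[OF that] m by simp
  have C: "0 < C" unfolding C_def using gt \<Gamma> by (intro sum_pos divide_pos_pos) auto
  \<comment> \<open>Up to the midpoint \<open>m\<close> the sum is at most \<open>C\<close>, so a
    distance of at most \<open>y / C\<close> from \<open>b\<close> keeps the balance below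
    \<open>y\<close>.\<close>
  define u where "u = b + min (m - b) (y / C)"
  have u: "b < u" "u \<le> m" "u - b \<le> y / C" using m y C by (auto simp: u_def)
  have "pole_balance n a b \<Gamma> u \<le> (y / C) * C" unfolding pole_balance_def C_def[symmetric]
  proof (intro mult_mono u)
    show "(\<Sum>i\<le>n. \<Gamma> i / (a i - u)) \<le> C" unfolding C_def
      using gt u \<Gamma> by (intro sum_mono divide_left_mono mult_pos_pos) (force simp: less_imp_le)+
    show "0 \<le> (\<Sum>i\<le>n. \<Gamma> i / (a i - u))"
      using gt u \<Gamma> by (intro sum_nonneg divide_nonneg_nonneg) (force simp: less_imp_le)+
  qed (use y C in auto)
  then show "\<exists>u. b < u \<and> u < a n \<and> pole_balance n a b \<Gamma> u \<le> y" using u m C by (intro exI[of _ u]) auto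
next
  fix y :: real assume y: "0 < y"
  \<comment> \<open>At distance \<open>t\<close> from \<open>a n\<close> the term of the nearest
    pole alone contributes exactly \<open>y\<close>; the other terms are nonnegative.\<close>
  define t where "t = (a n - b) * \<Gamma> n / (y + \<Gamma> n)"
  have G: "0 < \<Gamma> n" using \<Gamma> by auto
  have t0: "0 < t" using G y b by (auto simp: t_def)
  have t1: "t < a n - b" using G y b by (simp add: t_def field_simps)
  have gt: "0 \<le> \<Gamma> i / (a i - (a n - t))" if "i \<le> n" for i using a[OF that] \<Gamma>[OF that] t0 by simp
  have yt: "y * t = (a n - b - t) * \<Gamma> n" using G y unfolding t_def by (simp add: field_simps)
  have "y = (a n - t - b) * (\<Gamma> n / (a n - (a n - t)))" using yt t0 by (simp add: field_simps)
  also have "\<dots> \<le> pole_balance n a b \<Gamma> (a n - t)"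
    unfolding pole_balance_def using t1 gt
    by (intro mult_left_mono member_le_sum[of n "{..n}" "\<lambda>i. \<Gamma> i / (a i - (a n - t))"]) auto
  finally show "\<exists>u. b < u \<and> u < a n \<and> y \<le> pole_balance n a b \<Gamma> u"
    using t0 t1 by (intro exI[of _ "a n - t"]) auto
qed

lemma ennreal_mult3:
  assumes "0 \<le> c" "0 \<le> h"
  shows "ennreal c * (g * ennreal h) * ennreal v = g * ennreal (c * h * v)"
  using assms by (simp add: ennreal_mult' mult_ac ennreal_mult'[of "c * h" v])

text \<open>In the induction step the lowest zero \<mu> ranges over the last gap whatever the other
  residues are, so Fubini allows \<mu> to be frozen. The other residues are then rescaled, and the
  induction hypothesis is applied to an integrand that has absorbed the factors collected so
  far.\<close>

theorem nn_integral_residues: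
  assumes "\<And>i. i < n \<Longrightarrow> a (Suc i) < a i" and "G \<in> borel_measurable (lborel_PiM {..n})"
  shows "(\<integral>\<^sup>+\<Gamma>. (if \<forall>i\<le>n. 0 < \<Gamma> i then G \<Gamma> else 0) \<partial>(lborel_PiM {..n})) =
    (\<integral>\<^sup>+S. \<integral>\<^sup>+x. resid_integrand G n a S x \<partial>(lborel_PiM {1..n}) \<partial>lborel)"
  using assms
proof (induction n arbitrary: G)
  case 0
  note G[measurable] = "0.prems"(2)
  have [measurable]: "(\<lambda>y. \<lambda>i\<in>{..0}. y) \<in> measurable lborel (lborel_PiM {..0::nat})"
    by (intro measurable_restrict) auto
  have "(\<integral>\<^sup>+\<Gamma>. (if \<forall>i\<le>0. 0 < \<Gamma> i then G \<Gamma> else 0) \<partial>(lborel_PiM {..0::nat})) =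
      (\<integral>\<^sup>+\<Gamma>. (\<lambda>y. if 0 < y then G (\<lambda>i\<in>{..0}. y) else 0) (\<Gamma> 0) \<partial>(lborel_PiM {0::nat}))"
    unfolding atMost_0
  proof (rule nn_integral_cong)
    fix \<Gamma> assume "\<Gamma> \<in> space (lborel_PiM {0::nat})"
    then have "(\<lambda>i\<in>{0}. \<Gamma> 0) = \<Gamma>" by (auto simp: space_PiM PiE_def extensional_def fun_eq_iff)
    then show "(if \<forall>i\<le>0. 0 < \<Gamma> i then G \<Gamma> else 0) = (if 0 < \<Gamma> 0 then G (\<lambda>i\<in>{0}. \<Gamma> 0) else 0)" by simp
  qed
  also have "\<dots> = (\<integral>\<^sup>+y. (if 0 < y then G (\<lambda>i\<in>{..0}. y) else 0) \<partial>lborel)"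
    by (rule lborel_prod.product_nn_integral_singleton) measurable
  also have "\<dots> = (\<integral>\<^sup>+S. \<integral>\<^sup>+x. resid_integrand G 0 a S x \<partial>(lborel_PiM {1..0}) \<partial>lborel)"
  proof -
    have "(\<lambda>i\<in>{..0}. S * resid 0 a x i) = (\<lambda>i\<in>{..0}. S)" for S x
      by (rule restrict_ext) (simp add: resid_def)
    then have "resid_integrand G 0 a S x = (if 0 < S then G (\<lambda>i\<in>{..0}. S) else 0)" for S x
      unfolding resid_integrand_def by (simp add: interlaced_def vdm_def del: atMost_0)
    then show ?thesis by (simp add: PiM_empty nn_integral_count_space_finite)
  qed
  finally show ?case .
next
  case (Suc n)
  note G[measurable] = Suc.prems(2)
  let ?PM = "lborel_PiM {..n}" and ?PM' = "lborel_PiM {..Suc n}"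
  let ?PX = "lborel_PiM {1..n}" and ?PX' = "lborel_PiM {1..Suc n}"
  define b where "b = a (Suc n)"
  have dec: "a (Suc i) < a i" if "i < Suc n" for i using Suc.prems(1) that by auto
  have inj: "inj_on a {..Suc n}" using dec by (rule decseq_on_inj)
  have b: "b < a n" using dec by (auto simp: b_def)
  have le: "a n \<le> a i" if "i \<le> n" for i using decseq_on_less[of n a i n] dec that by (cases "i = n") auto
  interpret PM: sigma_finite_measure ?PM by (rule sigma_finite_PiM_lborel) simp
  interpret PX: sigma_finite_measure ?PX by (rule sigma_finite_PiM_lborel) simp
  note sf = PM.sigma_finite_measure_axioms PX.sigma_finite_measure_axioms sigma_finite_lborel
  let ?h = "pole_balance n a b" and ?h' = "pole_balance_deriv n a b"
  \<comment> \<open>The rescaling factors of \<open>resid_Suc\<close>; they are positive while \<mu>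
    stays below \<open>a n\<close>.\<close>
  define c where "c \<mu> i = (a i - \<mu>) / (a i - b)" for \<mu> i
  have c: "0 < c \<mu> i" if "\<mu> < a n" "i \<le> n" for \<mu> i using le[OF that(2)] that(1) b by (auto simp: c_def)
  define T where "T S x \<mu> = resid_integrand G (Suc n) a S (x(Suc n := \<mu>))" for S x \<mu>
  have upd [measurable]: "(\<lambda>z. (fst z)(Suc n := snd z)) \<in> measurable (?PM \<Otimes>\<^sub>M lborel) ?PM'"
    by (rule measurable_fun_upd[where J = "{..n}"]) auto
  have updX: "(\<lambda>z. (fst z)(Suc n := snd z)) \<in> measurable (?PX \<Otimes>\<^sub>M lborel) ?PX'"
    by (rule measurable_fun_upd[where J = "{1..n}"]) auto
  have comp [measurable]: "(\<lambda>\<Gamma>. \<Gamma> i) \<in> borel_measurable ?PM" if "i \<le> n" for i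
    using measurable_component_singleton[of i "{..n}" "\<lambda>_. lborel :: real measure"] that by simp
  have hm [measurable]: "(\<lambda>z. ?h (fst z) (snd z)) \<in> borel_measurable (?PM \<Otimes>\<^sub>M lborel)"
    unfolding pole_balance_def by measurable
  have hm' [measurable]: "(\<lambda>z. ?h' (fst z) (snd z)) \<in> borel_measurable (?PM \<Otimes>\<^sub>M lborel)"
    unfolding pole_balance_deriv_def by measurable
  define F where "F \<Gamma> \<mu> = G (\<Gamma>(Suc n := ?h \<Gamma> \<mu>)) * ennreal (?h' \<Gamma> \<mu>)" for \<Gamma> \<mu>
  let ?F = "\<lambda>\<Gamma> \<mu>. if (\<forall>i\<le>n. 0 < \<Gamma> i) \<and> b < \<mu> \<and> \<mu> < a n then F \<Gamma> \<mu> else 0"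
  have Fm [measurable]: "(\<lambda>z. F (fst z) (snd z)) \<in> borel_measurable (?PM \<Otimes>\<^sub>M lborel)"
  proof -
    have "(\<lambda>z. (fst z)(Suc n := ?h (fst z) (snd z))) \<in> measurable (?PM \<Otimes>\<^sub>M lborel) ?PM'"
      by (rule measurable_fun_upd[where J = "{..n}"]) auto
    from measurable_compose[OF this G] show ?thesis unfolding F_def by measurable
  qed
  have Fm1: "(\<lambda>\<Gamma>. F \<Gamma> \<mu>) \<in> borel_measurable ?PM" for \<mu>
    using measurable_compose[OF measurable_Pair2'[of \<mu> lborel ?PM] Fm] by simp
  have scale [measurable]: "(\<lambda>\<Gamma>. \<lambda>i\<in>{..n}. c \<mu> i * \<Gamma> i) \<in> measurable ?PM ?PM" for \<mu>
    by (intro measurable_restrict) (auto intro!: borel_measurable_times)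
  have Tm: "(\<lambda>z. T (fst z) (fst (snd z)) (snd (snd z))) \<in> borel_measurable (lborel \<Otimes>\<^sub>M (?PX \<Otimes>\<^sub>M lborel))"
  proof -
    have "(\<lambda>z. (fst z, (fst (snd z))(Suc n := snd (snd z)))) \<in> measurable (lborel \<Otimes>\<^sub>M (?PX \<Otimes>\<^sub>M lborel)) (lborel \<Otimes>\<^sub>M ?PX')"
      using measurable_compose[OF measurable_snd updX] by (intro measurable_Pair) auto
    from measurable_compose[OF this measurable_resid_integrand[OF G]] show ?thesis
      unfolding T_def by simp
  qed

  \<comment> \<open>Both substitutions are undone at once: the rescaled residues together with their
    \<open>pole_balance\<close> are \<open>S\<close> times the residues of the enlarged problem, and
    the Jacobian factors combine by \<open>resid_jacobian\<close>.\<close>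
  have key: "ennreal (\<Prod>i\<le>n. c \<mu> i) * (F (\<lambda>i\<in>{..n}. c \<mu> i * (\<lambda>i\<in>{..n}. S * resid n a x i) i) \<mu>) * ennreal (S ^ n * vdm 1 n x / vdm 0 n a) = T S x \<mu>"
    if S: "0 < S" and \<mu>: "b < \<mu>" "\<mu> < a n" and x: "interlaced n a x" for S x \<mu>
  proof -
    let ?\<Gamma> = "\<lambda>i\<in>{..n}. c \<mu> i * (\<lambda>i\<in>{..n}. S * resid n a x i) i"
    have int: "interlaced (Suc n) a (x(Suc n := \<mu>))"
      using x \<mu> unfolding interlaced_def b_def by (auto simp: le_Suc_eq)
    have xg: "\<mu> < x j" if "j \<in> {1..n}" for j
      using x that le[of j] \<mu> unfolding interlaced_def by fastforce
    have r: "?\<Gamma> i = S * resid (Suc n) a (x(Suc n := \<mu>)) i" if "i \<le> n" for i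
      unfolding resid_Suc[OF that] using that by (simp add: c_def b_def)
    have nz: "a i - b \<noteq> 0" "a i - \<mu> \<noteq> 0" if "i \<le> n" for i using le[OF that] b \<mu> by auto
    have "?h ?\<Gamma> \<mu> = (\<mu> - b) * (\<Sum>i\<le>n. S * (resid n a x i / (a i - b)))"
      unfolding pole_balance_def using nz by (intro arg_cong2[where f = "(*)"] sum.cong refl) (simp add: c_def)
    also have "\<dots> = S * resid (Suc n) a (x(Suc n := \<mu>)) (Suc n)"
      unfolding resid_Suc_last[OF inj] b_def sum_distrib_left[symmetric] by simp
    finally have h: "?h ?\<Gamma> \<mu> = S * resid (Suc n) a (x(Suc n := \<mu>)) (Suc n)" .
    have arg: "?\<Gamma>(Suc n := ?h ?\<Gamma> \<mu>) = (\<lambda>i\<in>{..Suc n}. S * resid (Suc n) a (x(Suc n := \<mu>)) i)"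
    proof
      fix i show "(?\<Gamma>(Suc n := ?h ?\<Gamma> \<mu>)) i = (\<lambda>i\<in>{..Suc n}. S * resid (Suc n) a (x(Suc n := \<mu>)) i) i"
        using r[of i] h by (cases "i \<le> n"; cases "i = Suc n") auto
    qed
    have h': "?h' ?\<Gamma> \<mu> = (\<Sum>i\<le>n. (a i - \<mu>) / (a i - a (Suc n)) * (S * resid n a x i) * (a i - a (Suc n)) / (a i - \<mu>)\<^sup>2)"
      unfolding pole_balance_deriv_def by (intro sum.cong refl) (simp add: c_def b_def)
    note jac = resid_jacobian[OF dec \<mu>[unfolded b_def], where S = S and x = x]
    have "0 \<le> S * ((\<Prod>j\<in>{1..n}. x j - \<mu>) / (\<Prod>i\<le>n. a i - \<mu>))"
      using S xg le \<mu> by (intro mult_nonneg_nonneg divide_nonneg_nonneg prod_nonneg) (auto simp: less_imp_le intro: order_trans[of \<mu> "a n"])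
    then have pos: "0 \<le> ?h' ?\<Gamma> \<mu>" using trans[OF h' jac(2)] by (simp only:)
    have cpos: "0 \<le> (\<Prod>i\<le>n. c \<mu> i)" using c \<mu> by (intro prod_nonneg) (auto simp: less_imp_le)
    have "ennreal (\<Prod>i\<le>n. c \<mu> i) * (G (?\<Gamma>(Suc n := ?h ?\<Gamma> \<mu>)) * ennreal (?h' ?\<Gamma> \<mu>)) * ennreal (S ^ n * vdm 1 n x / vdm 0 n a)
      = G (?\<Gamma>(Suc n := ?h ?\<Gamma> \<mu>)) * ennreal ((\<Prod>i\<le>n. c \<mu> i) * ?h' ?\<Gamma> \<mu> * (S ^ n * vdm 1 n x / vdm 0 n a))"
      by (rule ennreal_mult3[OF cpos pos])
    also have "(\<Prod>i\<le>n. c \<mu> i) * ?h' ?\<Gamma> \<mu> * (S ^ n * vdm 1 n x / vdm 0 n a) =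
        S ^ Suc n * vdm 1 (Suc n) (x(Suc n := \<mu>)) / vdm 0 (Suc n) a"
      unfolding h' unfolding c_def b_def by (rule jac(1))
    finally show ?thesis unfolding F_def T_def resid_integrand_def arg if_P[OF conjI[OF S int]] .
  qed

  \<comment> \<open>Enlarged interlacing splits into interlacing of the first \<open>n\<close> zeros
    and \<mu> in the last gap, so the supports of the two integrands agree.\<close>
  have T0: "T S x \<mu> = 0" if "\<not> (0 < S \<and> interlaced n a x \<and> b < \<mu> \<and> \<mu> < a n)" for S x \<mu>
  proof -
    have "\<not> (0 < S \<and> interlaced (Suc n) a (x(Suc n := \<mu>)))"
    proof
      assume i: "0 < S \<and> interlaced (Suc n) a (x(Suc n := \<mu>))"
      then have "b < \<mu> \<and> \<mu> < a n" unfolding interlaced_def b_def by (auto dest!: bspec[of _ _ "Suc n"])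
      moreover have "interlaced n a x" unfolding interlaced_def
      proof
        fix j assume "j \<in> {1..n}"
        then show "a j < x j \<and> x j < a (j - 1)" using i unfolding interlaced_def by (auto dest!: bspec[of _ _ j])
      qed
      ultimately show False using that i by blast
    qed
    then show ?thesis by (auto simp: T_def resid_integrand_def)
  qed

  have "(\<integral>\<^sup>+\<Gamma>. (if \<forall>i\<le>Suc n. 0 < \<Gamma> i then G \<Gamma> else 0) \<partial>?PM') =
      (\<integral>\<^sup>+\<Gamma>. \<integral>\<^sup>+y. (if \<forall>i\<le>Suc n. 0 < (\<Gamma>(Suc n := y)) i then G (\<Gamma>(Suc n := y)) else 0) \<partial>lborel \<partial>?PM)"
    unfolding atMost_Suc by (intro lborel_prod.product_nn_integral_insert) (auto simp flip: atMost_Suc)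
  also have "\<dots> = (\<integral>\<^sup>+\<Gamma>. \<integral>\<^sup>+\<mu>. ?F \<Gamma> \<mu> \<partial>lborel \<partial>?PM)"
  proof (rule nn_integral_cong)
    fix \<Gamma> assume sp: "\<Gamma> \<in> space ?PM"
    show "(\<integral>\<^sup>+y. (if \<forall>i\<le>Suc n. 0 < (\<Gamma>(Suc n := y)) i then G (\<Gamma>(Suc n := y)) else 0) \<partial>lborel) =
        (\<integral>\<^sup>+\<mu>. ?F \<Gamma> \<mu> \<partial>lborel)"
    proof (cases "\<forall>i\<le>n. 0 < \<Gamma> i")
      case True
      have "(\<lambda>z. G ((fst z)(Suc n := snd z))) \<in> borel_measurable (?PM \<Otimes>\<^sub>M lborel)" by measurable
      from measurable_compose[OF measurable_Pair1'[OF sp, of lborel] this]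
      have f: "(\<lambda>y. G (\<Gamma>(Suc n := y))) \<in> borel_measurable borel" by simp
      have "(\<integral>\<^sup>+y. (if \<forall>i\<le>Suc n. 0 < (\<Gamma>(Suc n := y)) i then G (\<Gamma>(Suc n := y)) else 0) \<partial>lborel) =
          (\<integral>\<^sup>+y. G (\<Gamma>(Suc n := y)) * indicator {0<..} y \<partial>lborel)"
        using True by (intro nn_integral_cong) (auto simp: indicator_def le_Suc_eq)
      also have "\<dots> = (\<integral>\<^sup>+\<mu>. G (\<Gamma>(Suc n := ?h \<Gamma> \<mu>)) * ennreal (?h' \<Gamma> \<mu>) * indicator {b<..<a n} \<mu> \<partial>lborel)"
        by (rule nn_integral_pole_balance) (use f b True le in auto)
      also have "\<dots> = (\<integral>\<^sup>+\<mu>. ?F \<Gamma> \<mu> \<partial>lborel)"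
        using True by (intro nn_integral_cong) (auto simp: indicator_def F_def)
      finally show ?thesis .
    next
      case False
      then have n: "\<not> (\<forall>i\<le>Suc n. 0 < (\<Gamma>(Suc n := y)) i)" for y by (auto simp: le_Suc_eq)
      show ?thesis by (simp only: n False if_False simp_thms)
    qed
  qed
  also have "\<dots> = (\<integral>\<^sup>+\<mu>. \<integral>\<^sup>+\<Gamma>. ?F \<Gamma> \<mu> \<partial>?PM \<partial>lborel)"
    by (rule nn_integral_swap_sigma_finite[symmetric]) (use sf in \<open>auto simp: split_beta'\<close>)
  also have "\<dots> = (\<integral>\<^sup>+\<mu>. \<integral>\<^sup>+S. \<integral>\<^sup>+x. T S x \<mu> \<partial>?PX \<partial>lborel \<partial>lborel)"
  proof (rule nn_integral_cong)
    fix \<mu>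
    show "(\<integral>\<^sup>+\<Gamma>. ?F \<Gamma> \<mu> \<partial>?PM) = (\<integral>\<^sup>+S. \<integral>\<^sup>+x. T S x \<mu> \<partial>?PX \<partial>lborel)"
    proof (cases "b < \<mu> \<and> \<mu> < a n")
      case False
      then have "T S x \<mu> = 0" for S x using T0 by blast
      moreover have "?F \<Gamma> \<mu> = 0" for \<Gamma>
        using False by auto
      ultimately show ?thesis by simp
    next
      case True
      have pos: "(\<forall>i\<le>n. 0 < (\<lambda>i\<in>{..n}. c \<mu> i * \<Gamma> i) i) \<longleftrightarrow> (\<forall>i\<le>n. 0 < \<Gamma> i)" for \<Gamma>
      proof -
        have "0 < c \<mu> i * \<Gamma> i \<longleftrightarrow> 0 < \<Gamma> i" if "i \<le> n" for i
          using c[of \<mu> i] True that by (metis mult_pos_pos zero_less_mult_pos)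
        then show ?thesis by simp
      qed
      let ?G = "\<lambda>\<Gamma>. ennreal (\<Prod>i\<le>n. c \<mu> i) * F (\<lambda>i\<in>{..n}. c \<mu> i * \<Gamma> i) \<mu>"
      have Gm [measurable]: "(\<lambda>\<Gamma>. F (\<lambda>i\<in>{..n}. c \<mu> i * \<Gamma> i) \<mu>) \<in> borel_measurable ?PM"
        by (rule measurable_compose[OF scale Fm1])
      have "(\<integral>\<^sup>+\<Gamma>. ?F \<Gamma> \<mu> \<partial>?PM) =
          (\<integral>\<^sup>+\<Gamma>. (if (\<forall>i\<le>n. 0 < \<Gamma> i) then F \<Gamma> \<mu> else 0) \<partial>?PM)"
        by (intro nn_integral_cong) (use True in auto)
      also have "\<dots> = ennreal (\<Prod>i\<le>n. c \<mu> i) *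
          (\<integral>\<^sup>+\<Gamma>. (if \<forall>i\<le>n. 0 < (\<lambda>i\<in>{..n}. c \<mu> i * \<Gamma> i) i then F (\<lambda>i\<in>{..n}. c \<mu> i * \<Gamma> i) \<mu> else 0) \<partial>?PM)"
        using c True Fm1[of \<mu>] by (intro nn_integral_PiM_scale) auto
      also have "\<dots> = (\<integral>\<^sup>+\<Gamma>. ennreal (\<Prod>i\<le>n. c \<mu> i) * (if \<forall>i\<le>n. 0 < \<Gamma> i then F (\<lambda>i\<in>{..n}. c \<mu> i * \<Gamma> i) \<mu> else 0) \<partial>?PM)"
        unfolding pos by (rule nn_integral_cmult[symmetric]) measurable
      also have "\<dots> = (\<integral>\<^sup>+\<Gamma>. (if \<forall>i\<le>n. 0 < \<Gamma> i then ?G \<Gamma> else 0) \<partial>?PM)"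
        by (intro nn_integral_cong) auto
      also have "\<dots> = (\<integral>\<^sup>+S. \<integral>\<^sup>+x. resid_integrand ?G n a S x \<partial>?PX \<partial>lborel)"
      proof (rule Suc.IH)
        show "?G \<in> borel_measurable ?PM" using Gm by (intro borel_measurable_times_ennreal borel_measurable_const)
      qed (use dec in auto)
      also have "\<dots> = (\<integral>\<^sup>+S. \<integral>\<^sup>+x. T S x \<mu> \<partial>?PX \<partial>lborel)"
      proof (intro nn_integral_cong)
        fix S x
        show "resid_integrand ?G n a S x = T S x \<mu>"
        proof (cases "0 < S \<and> interlaced n a x")
          case True': True
          have "resid_integrand ?G n a S x = ennreal (\<Prod>i\<le>n. c \<mu> i) * (F (\<lambda>i\<in>{..n}. c \<mu> i * (\<lambda>i\<in>{..n}. S * resid n a x i) i) \<mu>) * ennreal (S ^ n * vdm 1 n x / vdm 0 n a)"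
            unfolding resid_integrand_def by (rule if_P[OF True'])
          also have "\<dots> = T S x \<mu>" by (rule key) (use True' True in auto)
          finally show ?thesis .
        next
          case False
          then show ?thesis using T0[of S x \<mu>] by (auto simp: resid_integrand_def)
        qed
      qed
      finally show ?thesis .
    qed
  qed
  \<comment> \<open>So far \<mu> is the outermost variable; two exchanges move it inside, where it
    becomes the last coordinate of \<open>x\<close>.\<close>
  also have "\<dots> = (\<integral>\<^sup>+S. \<integral>\<^sup>+\<mu>. \<integral>\<^sup>+x. T S x \<mu> \<partial>?PX \<partial>lborel \<partial>lborel)"
  proof (rule nn_integral_swap_sigma_finite[OF sf(3) sf(3)])
    have "(\<lambda>w. ((fst (fst w)), (snd w, snd (fst w)))) \<in> measurable ((lborel \<Otimes>\<^sub>M lborel) \<Otimes>\<^sub>M ?PX) (lborel \<Otimes>\<^sub>M (?PX \<Otimes>\<^sub>M lborel))"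
      by measurable
    from measurable_compose[OF this Tm] show "(\<lambda>(S, \<mu>). \<integral>\<^sup>+x. T S x \<mu> \<partial>?PX) \<in> borel_measurable (lborel \<Otimes>\<^sub>M lborel)"
      unfolding split_beta' by (intro PX.borel_measurable_nn_integral) (simp add: split_beta')
  qed
  also have "\<dots> = (\<integral>\<^sup>+S. \<integral>\<^sup>+x. \<integral>\<^sup>+\<mu>. T S x \<mu> \<partial>lborel \<partial>?PX \<partial>lborel)"
  proof (rule nn_integral_cong, rule nn_integral_swap_sigma_finite[OF sf(2) sf(3)])
    fix S :: real
    show "(\<lambda>(x, \<mu>). T S x \<mu>) \<in> borel_measurable (?PX \<Otimes>\<^sub>M lborel)"
      using measurable_compose[OF measurable_Pair1'[of S lborel "?PX \<Otimes>\<^sub>M lborel"] Tm] by (simp add: split_beta')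
  qed
  also have "\<dots> = (\<integral>\<^sup>+S. \<integral>\<^sup>+x. resid_integrand G (Suc n) a S x \<partial>?PX' \<partial>lborel)"
  proof (rule nn_integral_cong)
    fix S :: real
    have eq: "{1..Suc n} = insert (Suc n) {1..n}" by auto
    have "(\<lambda>x. resid_integrand G (Suc n) a S x) \<in> borel_measurable ?PX'"
      using measurable_compose[OF measurable_Pair1'[of S lborel ?PX'] measurable_resid_integrand[OF G]] by simp
    then show "(\<integral>\<^sup>+x. \<integral>\<^sup>+\<mu>. T S x \<mu> \<partial>lborel \<partial>?PX) = (\<integral>\<^sup>+x. resid_integrand G (Suc n) a S x \<partial>?PX')"
      unfolding T_def eq by (intro lborel_prod.product_nn_integral_insert[symmetric]) auto
  qed
  finally show ?case .
qed

section \<open>Eigenvalues of a compression with repeated nodes\<close>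

definition compress :: "nat \<Rightarrow> (nat \<Rightarrow> complex) \<Rightarrow> real list \<Rightarrow> complex mat" where
  "compress N g l = projection (normalized_vec N g) * real_diag l * projection (normalized_vec N g)"

lemma dim_normalized_vec [simp]: "dim_vec (normalized_vec N g) = N"
  by (simp add: normalized_vec_def)

lemma compress_carrier [simp]: "length l = N \<Longrightarrow> compress N g l \<in> carrier_mat N N"
  using projection_carrier[of "normalized_vec N g"]
  by (auto simp: compress_def real_diag_def mat_diag_def intro!: mult_carrier_mat)

lemma mult_mat_index:
  fixes A B :: "complex mat"
  assumes "A \<in> carrier_mat r m" "B \<in> carrier_mat m c" "i < r" "j < c"
  shows "(A * B) $$ (i, j) = (\<Sum>k<m. A $$ (i, k) * B $$ (k, j))"
  using assms by (auto simp: scalar_prod_def atLeast0LessThan)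

lemma compress_index:
  assumes l: "length l = N" and ij: "i < N" "j < N"
  shows "compress N g l $$ (i, j) =
    (\<Sum>k<N. projection (normalized_vec N g) $$ (i, k) * of_real (l ! k) * projection (normalized_vec N g) $$ (k, j))"
proof -
  let ?P = "projection (normalized_vec N g)"
  have P: "?P \<in> carrier_mat N N" using projection_carrier[of "normalized_vec N g"] by simp
  have D: "real_diag l \<in> carrier_mat N N" using l by (simp add: real_diag_def mat_diag_def)
  have PD: "(?P * real_diag l) $$ (i, k) = ?P $$ (i, k) * of_real (l ! k)" if "k < N" for k
  proof -
    have "(?P * real_diag l) $$ (i, k) = (\<Sum>h<N. ?P $$ (i, h) * (if h = k then of_real (l ! h) else 0))"
      unfolding mult_mat_index[OF P D ij(1) that]
      using that l by (intro sum.cong) (auto simp: real_diag_def mat_diag_def)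
    also have "\<dots> = (\<Sum>h<N. if h = k then ?P $$ (i, k) * of_real (l ! k) else 0)"
      by (intro sum.cong) auto
    also have "\<dots> = ?P $$ (i, k) * of_real (l ! k)" using that by simp
    finally show ?thesis .
  qed
  have "compress N g l $$ (i, j) = (\<Sum>k<N. (?P * real_diag l) $$ (i, k) * ?P $$ (k, j))"
    unfolding compress_def using P D ij by (intro mult_mat_index[of _ N]) auto
  then show ?thesis using PD by simp
qed

lemma compress_hermitian:
  assumes l: "length l = N" and ij: "i < N" "j < N"
  shows "compress N g l $$ (i, j) = cnj (compress N g l $$ (j, i))"
  unfolding compress_index[OF l ij] compress_index[OF l ij(2,1)] cnj_sum
proof (intro sum.cong refl)
  let ?P = "projection (normalized_vec N g)"
  have P: "cnj (?P $$ (i, j)) = ?P $$ (j, i)" if "i < N" "j < N" for i j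
    using that by (simp add: projection_index mult.commute)
  fix k assume "k \<in> {..<N}"
  then show "?P $$ (i, k) * of_real (l ! k) * ?P $$ (k, j) = cnj (?P $$ (j, k) * of_real (l ! k) * ?P $$ (k, i))"
    using ij by (simp add: P mult_ac)
qed

lemma measurable_real_spectrum_compress:
  assumes g: "\<And>k. k < N \<Longrightarrow> (\<lambda>\<omega>. g \<omega> k) \<in> borel_measurable Q"
    and len: "\<And>\<omega>. \<omega> \<in> space Q \<Longrightarrow> length (l \<omega>) = N"
    and l: "\<And>k. k < N \<Longrightarrow> (\<lambda>\<omega>. l \<omega> ! k) \<in> borel_measurable Q"
  shows "measurable_real_spectrum Q (\<lambda>\<omega>. compress N (g \<omega>) (l \<omega>)) N"
proof
  fix i j assume ij: "i < N" "j < N"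
  have P: "(\<lambda>\<omega>. projection (normalized_vec N (g \<omega>)) $$ (i, j)) \<in> borel_measurable Q" if "i < N" "j < N" for i j
  proof -
    have n [measurable]: "(\<lambda>\<omega>. sqrt (\<Sum>k<N. (cmod (g \<omega> k))\<^sup>2)) \<in> borel_measurable Q"
    proof -
      have [measurable]: "(\<lambda>\<omega>. g \<omega> k) \<in> borel_measurable Q" if "k \<in> {..<N}" for k using g that by auto
      show ?thesis by measurable
    qed
    have nc: "(\<lambda>\<omega>. complex_of_real (sqrt (\<Sum>k<N. (cmod (g \<omega> k))\<^sup>2))) \<in> borel_measurable Q"
      by measurable
    have cnj: "(\<lambda>\<omega>. cnj (f \<omega>)) \<in> borel_measurable Q" if "f \<in> borel_measurable Q" for f
      by (rule borel_measurable_continuous_on[OF continuous_on_cnj[OF continuous_on_id] that])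
    have "(\<lambda>\<omega>. (if i = j then 1 else 0) - g \<omega> i / of_real (sqrt (\<Sum>k<N. (cmod (g \<omega> k))\<^sup>2)) *
        cnj (g \<omega> j / of_real (sqrt (\<Sum>k<N. (cmod (g \<omega> k))\<^sup>2)))) \<in> borel_measurable Q"
      using that by (intro borel_measurable_diff borel_measurable_times borel_measurable_divide borel_measurable_const
          nc cnj g)
    moreover have "projection (normalized_vec N (g \<omega>)) $$ (i, j) =
        (if i = j then 1 else 0) - g \<omega> i / of_real (sqrt (\<Sum>k<N. (cmod (g \<omega> k))\<^sup>2)) *
        cnj (g \<omega> j / of_real (sqrt (\<Sum>k<N. (cmod (g \<omega> k))\<^sup>2)))" for \<omega>
      using that by (simp add: projection_index normalized_vec_def)
    ultimately show ?thesis by (simp only:)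
  qed
  have "(\<lambda>\<omega>. \<Sum>k<N. projection (normalized_vec N (g \<omega>)) $$ (i, k) * of_real (l \<omega> ! k) * projection (normalized_vec N (g \<omega>)) $$ (k, j)) \<in> borel_measurable Q"
    using ij P l by (intro borel_measurable_sum borel_measurable_times borel_measurable_of_real) auto
  then show "(\<lambda>\<omega>. compress N (g \<omega>) (l \<omega>) $$ (i, j)) \<in> borel_measurable Q"
    using compress_index[OF len ij] by (simp cong: measurable_cong)
next
  fix \<omega> z assume \<omega>: "\<omega> \<in> space Q" and z: "z \<in># proots (char_poly (compress N (g \<omega>) (l \<omega>)))"
  show "Im z = 0"
    using compress_carrier[OF len[OF \<omega>]] compress_hermitian[OF len[OF \<omega>]] z by (rule real_roots_hermitian)
qed (use len in auto)

section \<open>Positive residues and interlacing zeros\<close>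

text \<open>Numerators and denominators are paired to have equal signs: below index \<open>i\<close>
  the zero \<open>k + 1\<close> goes with the node \<open>k\<close>, above it the zero
  \<open>k\<close> goes with the node \<open>k\<close>.\<close>

lemma resid_pos:
  assumes dec: "\<And>i. i < n \<Longrightarrow> a (Suc i) < a i" and x: "interlaced n a x" and i: "i \<le> n"
  shows "0 < resid n a x i"
proof -
  have less: "a l < a k" if "k < l" "l \<le> n" for k l using decseq_on_less[of n a k l] dec that by blast
  have le: "a l \<le> a k" if "k \<le> l" "l \<le> n" for k l using less[of k l] that by (cases "k = l") auto
  have "(\<Prod>j\<in>{1..n}. a i - x j) = (\<Prod>j\<in>{1..i}. a i - x j) * (\<Prod>j\<in>{Suc i..n}. a i - x j)"
    using i by (subst prod.union_disjoint[symmetric]) (auto intro!: prod.cong)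
  also have "(\<Prod>j\<in>{1..i}. a i - x j) = (\<Prod>k<i. a i - x (Suc k))"
    by (simp add: prod.atLeast1_atMost_eq)
  finally have num: "(\<Prod>j\<in>{1..n}. a i - x j) = (\<Prod>k<i. a i - x (Suc k)) * (\<Prod>j\<in>{Suc i..n}. a i - x j)" .
  have "{..n} - {i} = {..<i} \<union> {Suc i..n}" using i by auto
  moreover have "{..<i} \<inter> {Suc i..n} = {}" by auto
  ultimately have den: "(\<Prod>k\<in>{..n} - {i}. a i - a k) = (\<Prod>k<i. a i - a k) * (\<Prod>k\<in>{Suc i..n}. a i - a k)"
    using prod.union_disjoint[of "{..<i}" "{Suc i..n}" "\<lambda>k. a i - a k"] by (simp only: finite_lessThan finite_atLeastAtMost simp_thms)
  have "resid n a x i = (\<Prod>k<i. (a i - x (Suc k)) / (a i - a k)) * (\<Prod>k\<in>{Suc i..n}. (a i - x k) / (a i - a k))"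
    unfolding resid_def num den by (simp add: prod_dividef)
  also have "\<dots> > 0"
  proof (intro mult_pos_pos prod_pos)
    fix k assume "k \<in> {..<i}"
    then have "a (Suc k) < x (Suc k)" "a i \<le> a (Suc k)" "a i < a k"
      using x i le[of "Suc k" i] less[of k i] by (auto simp: interlaced_def)
    then show "0 < (a i - x (Suc k)) / (a i - a k)" by (intro divide_neg_neg) auto
  next
    fix k assume "k \<in> {Suc i..n}"
    then have "x k < a (k - 1)" "a (k - 1) \<le> a i" "a k < a i"
      using x i le[of i "k - 1"] less[of i k] by (auto simp: interlaced_def)
    then show "0 < (a i - x k) / (a i - a k)" by (intro divide_pos_pos) auto
  qed
  finally show ?thesis .
qed

text \<open>The converse of \<open>resid_pos\<close>. The numerator of a partial fraction with
  positive residues changes sign between neighbouring nodes, which gives \<open>n\<close> zeros;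
  together with the leading coefficient they determine it, and its values at the nodes return the
  residues.\<close>

lemma ex_interlaced:
  assumes dec: "\<And>i. i < n \<Longrightarrow> a (Suc i) < a i" and \<Gamma>: "\<And>i. i \<le> n \<Longrightarrow> 0 < \<Gamma> i"
  shows "\<exists>x. interlaced n a x \<and> (\<forall>i\<le>n. \<Gamma> i = (\<Sum>i\<le>n. \<Gamma> i) * resid n a x i)"
proof -
  have less: "a l < a k" if "k < l" "l \<le> n" for k l using decseq_on_less[of n a k l] dec that by blast
  have inj: "inj_on a {..n}" using dec by (rule decseq_on_inj)
  define p where "p = (\<Sum>i\<le>n. Polynomial.smult (\<Gamma> i) (\<Prod>k\<in>{..n} - {i}. [:- a k, 1:]))"
  define S where "S = (\<Sum>i\<le>n. \<Gamma> i)"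
  have pa: "poly p (a i) = \<Gamma> i * (\<Prod>k\<in>{..n} - {i}. a i - a k)" if i: "i \<le> n" for i
  proof -
    have "poly p (a i) = (\<Sum>l\<le>n. \<Gamma> l * (\<Prod>k\<in>{..n} - {l}. a i - a k))"
      by (simp add: p_def poly_sum poly_prod)
    also have "\<dots> = (\<Sum>l\<le>n. if l = i then \<Gamma> i * (\<Prod>k\<in>{..n} - {i}. a i - a k) else 0)"
      using i by (intro sum.cong refl) (auto simp: prod_zero_iff)
    finally show ?thesis using i by simp
  qed
  have "\<exists>y. a j < y \<and> y < a (j - 1) \<and> poly p y = 0" if j: "j \<in> {1..n}" for j
  proof -
    obtain h where h: "j = Suc h" "h < n" using j by (cases j) auto
    let ?C = "{..n} - {h, Suc h}"
    have s1: "{..n} - {Suc h} = insert h ?C" "{..n} - {h} = insert (Suc h) ?C" using h by auto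
    \<comment> \<open>Every other node lies on the same side of both neighbours, so only the factor
      of the pair itself is negative.\<close>
    have "poly p (a (Suc h)) * poly p (a h) = (\<Gamma> (Suc h) * \<Gamma> h) * ((a (Suc h) - a h) * (a h - a (Suc h))) *
        (\<Prod>k\<in>?C. (a (Suc h) - a k) * (a h - a k))"
    proof -
      have fin: "finite ?C" "h \<notin> ?C" "Suc h \<notin> ?C" by auto
      have "poly p (a (Suc h)) = \<Gamma> (Suc h) * ((a (Suc h) - a h) * (\<Prod>k\<in>?C. a (Suc h) - a k))"
        using pa[of "Suc h"] h unfolding s1(1) prod.insert[OF fin(1,2)] by simp
      moreover have "poly p (a h) = \<Gamma> h * ((a h - a (Suc h)) * (\<Prod>k\<in>?C. a h - a k))"
        using pa[of h] h unfolding s1(2) prod.insert[OF fin(1,3)] by simp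
      ultimately show ?thesis unfolding prod.distrib by (simp only: mult_ac)
    qed
    also have "\<dots> < 0"
    proof (rule mult_neg_pos)
      show "\<Gamma> (Suc h) * \<Gamma> h * ((a (Suc h) - a h) * (a h - a (Suc h))) < 0"
        using \<Gamma>[of h] \<Gamma>[of "Suc h"] dec[of h] h by (intro mult_pos_neg mult_pos_pos mult_neg_pos) auto
      show "0 < (\<Prod>k\<in>?C. (a (Suc h) - a k) * (a h - a k))"
      proof (rule prod_pos)
        fix k assume k: "k \<in> ?C"
        show "0 < (a (Suc h) - a k) * (a h - a k)"
        proof (cases "k < h")
          case True
          then show ?thesis using less[of k h] less[of k "Suc h"] h by (intro mult_neg_neg) auto
        next
          case False
          then show ?thesis using k less[of h k] less[of "Suc h" k] h by (intro mult_pos_pos) auto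
        qed
      qed
    qed
    finally have "poly p (a (Suc h)) * poly p (a h) < 0" .
    then show ?thesis using poly_IVT[of "a (Suc h)" "a h" p] dec[of h] h by auto
  qed
  then obtain x where x: "\<And>j. j \<in> {1..n} \<Longrightarrow> a j < x j \<and> x j < a (j - 1) \<and> poly p (x j) = 0" by metis
  then have int: "interlaced n a x" by (auto simp: interlaced_def)
  have xinj: "inj_on x {1..n}"
  proof (rule linorder_inj_onI)
    fix i j assume ij: "i < j" "i \<in> {1..n}" "j \<in> {1..n}"
    have "a (j - 1) \<le> a i"
    proof (cases "i = j - 1")
      case False
      then have "i < j - 1" using ij by simp
      with less[of i "j - 1"] ij show ?thesis by fastforce
    qed simp
    then show "x i \<noteq> x j" using x[OF ij(2)] x[OF ij(3)] by auto
  qed auto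
  \<comment> \<open>The leading coefficients agree, so \<open>q\<close> has degree below
    \<open>n\<close> unless it is 0, yet it vanishes at the \<open>n\<close> distinct zeros.\<close>
  define q where "q = p - Polynomial.smult S (\<Prod>j\<in>{1..n}. [:- x j, 1:])"
  have "q = 0"
  proof (rule ccontr)
    assume ne: "q \<noteq> 0"
    have "degree p \<le> n" unfolding p_def
      by (intro degree_sum_le) (auto intro!: order_trans[OF degree_smult_le] simp: coeff_prod_linear)
    moreover have "degree (Polynomial.smult S (\<Prod>j\<in>{1..n}. [:- x j, 1:])) \<le> n"
      by (intro order_trans[OF degree_smult_le]) (simp add: coeff_prod_linear)
    ultimately have dq: "degree q \<le> n" unfolding q_def by (rule degree_diff_le)
    have "coeff (\<Prod>k\<in>{..n} - {i}. [:- a k, 1:]) n = 1" if "i \<le> n" for i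
      using coeff_prod_linear(2)[of "{..n} - {i}" a] that by simp
    moreover have "coeff (\<Prod>j\<in>{1..n}. [:- x j, 1:]) n = 1" using coeff_prod_linear(2)[of "{1..n}" x] by simp
    ultimately have "coeff q n = 0" unfolding q_def p_def S_def by (simp add: coeff_sum)
    with ne dq have dl: "degree q < n" by (metis leading_coeff_0_iff le_neq_implies_less)
    have "x ` {1..n} \<subseteq> {y. poly q y = 0}"
    proof safe
      fix j assume j: "j \<in> {1..n}"
      then have "(\<Prod>l\<in>{1..n}. x j - x l) = 0" by (intro prod_zero) auto
      then show "poly q (x j) = 0" using x[OF j] by (simp add: q_def poly_prod)
    qed
    moreover have "finite {y. poly q y = 0}" using ne by (rule poly_roots_finite)
    ultimately have "card (x ` {1..n}) \<le> card {y. poly q y = 0}" by (intro card_mono)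
    also have "\<dots> \<le> degree q" using ne by (rule card_poly_roots_bound)
    finally show False using dl xinj by (simp add: card_image)
  qed
  then have pS: "p = Polynomial.smult S (\<Prod>j\<in>{1..n}. [:- x j, 1:])" by (simp add: q_def)
  have "\<Gamma> i = S * resid n a x i" if i: "i \<le> n" for i
  proof -
    have "(\<Prod>k\<in>{..n} - {i}. a i - a k) \<noteq> 0"
      using inj i by (auto simp: prod_zero_iff inj_on_def)
    moreover have "\<Gamma> i * (\<Prod>k\<in>{..n} - {i}. a i - a k) = S * (\<Prod>j\<in>{1..n}. a i - x j)"
      unfolding pa[OF i, symmetric] pS by (simp add: poly_prod)
    ultimately show ?thesis by (simp add: resid_def field_simps)
  qed
  then show ?thesis using int unfolding S_def by blast
qed

text \<open>Here \<open>grp\<close> sends a diagonal position to the index of its value. The set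
  \<open>E\<close> contains 0 and every repeated node and avoids the gaps: precisely what is needed
  for the filter to keep the zeros of the partial fraction and nothing else.\<close>

locale grouped_nodes =
  fixes N n :: nat and a :: "nat \<Rightarrow> real" and grp :: "nat \<Rightarrow> nat" and E :: "complex set"
  assumes dec: "\<And>i. i < n \<Longrightarrow> a (Suc i) < a i"
    and grp: "\<And>k. k < N \<Longrightarrow> grp k \<le> n"
    and surj: "\<And>i. i \<le> n \<Longrightarrow> \<exists>k<N. grp k = i"
    and finE: "finite E" and zeroE: "0 \<in> E"
    and multE: "\<And>i. i \<le> n \<Longrightarrow> 1 < card {k. k < N \<and> grp k = i} \<Longrightarrow> of_real (a i) \<in> E"
    and gapE: "\<And>j x. j \<in> {1..n} \<Longrightarrow> a j < x \<Longrightarrow> x < a (j - 1) \<Longrightarrow> of_real x \<notin> E"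
begin

definition nodes :: "real list" where "nodes = map (\<lambda>k. a (grp k)) [0..<N]"

definition mult :: "nat \<Rightarrow> nat" where "mult i = card {k. k < N \<and> grp k = i}"

definition group_sum :: "(nat \<Rightarrow> complex) \<Rightarrow> nat \<Rightarrow> real" where
  "group_sum g i = (\<Sum>k | k < N \<and> grp k = i. (cmod (g k))\<^sup>2)"

definition eigs :: "(nat \<Rightarrow> complex) \<Rightarrow> real list" where
  "eigs g = eigenvalues_outside E (compress N g nodes)"

lemma inj_a: "inj_on a {..n}"
  using dec by (rule decseq_on_inj)

lemma length_nodes [simp]: "length nodes = N" by (simp add: nodes_def)

lemma mult_pos: "i \<le> n \<Longrightarrow> 0 < mult i"
  unfolding mult_def using surj by (auto simp: card_gt_0_iff)

lemma sum_group_sum: "(\<Sum>i\<le>n. group_sum g i) = (\<Sum>k<N. (cmod (g k))\<^sup>2)"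
proof -
  have "(\<Sum>i\<le>n. \<Sum>k | k \<in> {..<N} \<and> grp k = i. (cmod (g k))\<^sup>2) = (\<Sum>k<N. (cmod (g k))\<^sup>2)"
    by (rule sum.group) (use grp in auto)
  then show ?thesis by (simp add: group_sum_def)
qed

lemma sum_mult: "(\<Sum>i\<le>n. mult i) = N"
proof -
  have "(\<Sum>i\<le>n. \<Sum>k | k \<in> {..<N} \<and> grp k = i. 1) = (\<Sum>k<N. 1 :: nat)"
    by (rule sum.group) (use grp in auto)
  then show ?thesis by (simp add: mult_def)
qed

text \<open>Deleting a diagonal entry lowers the exponent of its own group by one. Once the common
  factor is pulled out, every other group keeps one linear factor and the group of \<open>k\<close>
  keeps none.\<close>

lemma prod_nodes_remove:
  fixes L :: "nat \<Rightarrow> 'c :: comm_ring_1"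
  assumes k: "k < N"
  shows "(\<Prod>l\<in>{..<N} - {k}. L (grp l)) = (\<Prod>i\<le>n. L i ^ (mult i - 1)) * (\<Prod>i\<in>{..n} - {grp k}. L i)"
proof -
  have gk: "grp k \<le> n" using grp k by auto
  have "(\<Prod>l\<in>{..<N} - {k}. L (grp l)) = (\<Prod>i\<le>n. \<Prod>l | l \<in> {..<N} - {k} \<and> grp l = i. L (grp l))"
    by (rule prod.group[symmetric]) (use grp in auto)
  also have "\<dots> = (\<Prod>i\<le>n. L i ^ (mult i - 1) * (if i = grp k then 1 else L i))"
  proof (intro prod.cong refl)
    fix i assume i: "i \<in> {..n}"
    have "(\<Prod>l | l \<in> {..<N} - {k} \<and> grp l = i. L (grp l)) = L i ^ card {l. l \<in> {..<N} - {k} \<and> grp l = i}"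
      by simp
    also have "\<dots> = L i ^ (mult i - 1) * (if i = grp k then 1 else L i)"
    proof (cases "i = grp k")
      case True
      then have "{l. l \<in> {..<N} - {k} \<and> grp l = i} = {l. l < N \<and> grp l = i} - {k}" by auto
      then show ?thesis using True k by (simp add: mult_def)
    next
      case False
      then have "{l. l \<in> {..<N} - {k} \<and> grp l = i} = {l. l < N \<and> grp l = i}" by auto
      then have "card {l. l \<in> {..<N} - {k} \<and> grp l = i} = Suc (mult i - 1)"
        using mult_pos[of i] i by (simp add: mult_def)
      then show ?thesis using False by (simp add: mult.commute)
    qed
    finally show "(\<Prod>l | l \<in> {..<N} - {k} \<and> grp l = i. L (grp l)) = L i ^ (mult i - 1) * (if i = grp k then 1 else L i)" .
  qed
  also have "\<dots> = (\<Prod>i\<le>n. L i ^ (mult i - 1)) * (\<Prod>i\<le>n. if i = grp k then 1 else L i)"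
    by (rule prod.distrib)
  also have "(\<Prod>i\<le>n. if i = grp k then 1 else L i) = (\<Prod>i\<in>{..n} - {grp k}. L i)"
    using gk by (simp add: prod.remove[of "{..n}" "grp k"])
  finally show ?thesis .
qed

lemma complex_lagrange_resid:
  "(\<Prod>j\<in>{1..n}. [:- complex_of_real (x j), 1:]) =
    (\<Sum>i\<le>n. Polynomial.smult (of_real (resid n a x i)) (\<Prod>k\<in>{..n} - {i}. [:- of_real (a k), 1:]))"
    (is "?p = ?q")
\<comment> \<open>Real evaluation points carry the real identity over to complex
  coefficients.\<close>
proof (rule poly_eqI_many_roots[where A = "(\<lambda>i. of_real (real i)) ` {..n}"])
  show "degree ?p \<le> n" by (subst coeff_prod_linear) auto
  show "degree ?q \<le> n"
    by (intro degree_sum_le) (auto intro!: order_trans[OF degree_smult_le] simp: coeff_prod_linear)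
  show "n < card ((\<lambda>i. complex_of_real (real i)) ` {..n})" by (subst card_image) (auto intro: inj_onI)
  fix y :: complex assume "y \<in> (\<lambda>i. of_real (real i)) ` {..n}"
  then obtain t where y: "y = of_real t" by blast
  have "poly ?p y = of_real (poly (\<Prod>j\<in>{1..n}. [:- x j, 1:]) t)"
    by (simp add: y poly_prod)
  also have "\<dots> = poly ?q y"
    unfolding lagrange_resid[OF inj_a, of x]
    by (simp add: y poly_prod poly_sum)
  finally show "poly ?p y = poly ?q y" .
qed

text \<open>All entries of a group have the same cofactor, so their weights add up to the normalized
  group sum. Repetition therefore only contributes a common factor in front of the partial fraction
  numerator.\<close>

lemma char_poly_compress:
  assumes S: "0 < S" and g: "\<And>i. i \<le> n \<Longrightarrow> group_sum g i = S * resid n a x i"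
  shows "char_poly (compress N g nodes) =
    [:0, 1:] * ((\<Prod>i\<le>n. [:- of_real (a i), 1:] ^ (mult i - 1)) * (\<Prod>j\<in>{1..n}. [:- of_real (x j), 1:]))"
proof -
  let ?v = "normalized_vec N g" and ?L = "\<lambda>i. [:- complex_of_real (a i), 1:]"
  let ?R = "\<Prod>i\<le>n. ?L i ^ (mult i - 1)"
  have S': "(\<Sum>k<N. (cmod (g k))\<^sup>2) = S"
    using g sum_resid[OF inj_a, of x] unfolding sum_group_sum[symmetric]
    by (simp add: sum_distrib_left[symmetric])
  have v: "(cmod (?v $ k))\<^sup>2 = (cmod (g k))\<^sup>2 / S" if "k < N" for k
    using that S by (simp add: normalized_vec_def S' norm_divide power_divide)
  have unit: "(\<Sum>k<N. (cmod (?v $ k))\<^sup>2) = 1"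
    using v S by (simp add: sum_divide_distrib[symmetric] S')
  have "char_poly (compress N g nodes) = [:0, 1:] *
      (\<Sum>k<N. Polynomial.smult (of_real ((cmod (?v $ k))\<^sup>2)) (\<Prod>l\<in>{..<N} - {k}. [:- of_real (nodes ! l), 1:]))"
    unfolding compress_def by (rule char_poly_compress_diag[OF _ _ unit]) (auto intro: carrier_vecI)
  also have "(\<Sum>k<N. Polynomial.smult (of_real ((cmod (?v $ k))\<^sup>2)) (\<Prod>l\<in>{..<N} - {k}. [:- of_real (nodes ! l), 1:])) =
      (\<Sum>k<N. Polynomial.smult (of_real ((cmod (g k))\<^sup>2 / S)) (?R * (\<Prod>i\<in>{..n} - {grp k}. ?L i)))"
  proof (intro sum.cong refl)
    fix k assume k: "k \<in> {..<N}"
    have "(\<Prod>l\<in>{..<N} - {k}. [:- complex_of_real (nodes ! l), 1:]) = (\<Prod>l\<in>{..<N} - {k}. ?L (grp l))"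
      by (intro prod.cong refl) (auto simp: nodes_def)
    also have "\<dots> = ?R * (\<Prod>i\<in>{..n} - {grp k}. ?L i)" using k by (intro prod_nodes_remove) auto
    finally show "Polynomial.smult (of_real ((cmod (?v $ k))\<^sup>2)) (\<Prod>l\<in>{..<N} - {k}. [:- of_real (nodes ! l), 1:]) =
      Polynomial.smult (of_real ((cmod (g k))\<^sup>2 / S)) (?R * (\<Prod>i\<in>{..n} - {grp k}. ?L i))"
      using k v by simp
  qed
  also have "\<dots> = (\<Sum>i\<le>n. \<Sum>k | k \<in> {..<N} \<and> grp k = i. Polynomial.smult (of_real ((cmod (g k))\<^sup>2 / S)) (?R * (\<Prod>i\<in>{..n} - {grp k}. ?L i)))"
    by (rule sum.group[symmetric]) (use grp in auto)
  also have "\<dots> = (\<Sum>i\<le>n. Polynomial.smult (of_real (resid n a x i)) (?R * (\<Prod>i\<in>{..n} - {i}. ?L i)))"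
  proof (intro sum.cong refl)
    fix i assume i: "i \<in> {..n}"
    let ?T = "?R * (\<Prod>i\<in>{..n} - {i}. ?L i)"
    have "(\<Sum>k | k \<in> {..<N} \<and> grp k = i. Polynomial.smult (of_real ((cmod (g k))\<^sup>2 / S)) (?R * (\<Prod>i\<in>{..n} - {grp k}. ?L i))) =
        (\<Sum>k | k \<in> {..<N} \<and> grp k = i. Polynomial.smult (of_real ((cmod (g k))\<^sup>2 / S)) ?T)"
      by (intro sum.cong refl) auto
    also have "\<dots> = Polynomial.smult (of_real (group_sum g i / S)) ?T"
      unfolding group_sum_def sum_divide_distrib of_real_sum by (simp add: smult_sum)
    also have "group_sum g i / S = resid n a x i" using g[of i] i S by simp
    finally show "(\<Sum>k | k \<in> {..<N} \<and> grp k = i. Polynomial.smult (of_real ((cmod (g k))\<^sup>2 / S)) (?R * (\<Prod>i\<in>{..n} - {grp k}. ?L i))) =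
       Polynomial.smult (of_real (resid n a x i)) ?T" .
  qed
  also have "\<dots> = ?R * (\<Sum>i\<le>n. Polynomial.smult (of_real (resid n a x i)) (\<Prod>i\<in>{..n} - {i}. ?L i))"
    by (simp add: sum_distrib_left mult_smult_right)
  finally show ?thesis unfolding complex_lagrange_resid .
qed

lemma interlaced_decreasing:
  assumes x: "interlaced n a x" and ij: "1 \<le> i" "i < j" "j \<le> n"
  shows "x j < x i"
proof -
  have "a (j - 1) \<le> a i"
  proof (cases "i = j - 1")
    case False
    then have "i < j - 1" using ij by simp
    with decseq_on_less[of n a i "j - 1"] dec ij show ?thesis by fastforce
  qed simp
  moreover have "x j < a (j - 1)" "a i < x i" using x ij by (auto simp: interlaced_def)
  ultimately show ?thesis by simp
qed

text \<open>Of the roots 0, the repeated nodes with one copy lost, and the zeros \<open>x\<close>,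
  the first two kinds lie in \<open>E\<close> and the third does not.\<close>

lemma eigs_eq:
  assumes S: "0 < S" and x: "interlaced n a x"
    and g: "\<And>i. i \<le> n \<Longrightarrow> group_sum g i = S * resid n a x i"
  shows "eigs g = map x [1..<Suc n]"
proof -
  let ?R = "\<Prod>i\<le>n. [:- complex_of_real (a i), 1:] ^ (mult i - 1)"
  let ?X = "\<Prod>j\<in>{1..n}. [:- complex_of_real (x j), 1:]"
  have nz: "?R \<noteq> 0" "?X \<noteq> 0" by auto
  have cp: "char_poly (compress N g nodes) = [:0, 1:] * (?R * ?X)"
    using S g by (rule char_poly_compress)
  have "proots ([:0, 1:] * (?R * ?X)) = proots [:0, 1:] + proots (?R * ?X)"
    by (rule proots_mult) (use nz in auto)
  also have "proots (?R * ?X) = proots ?R + proots ?X" using nz by (rule proots_mult)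
  also have "proots ?R = (\<Sum>i\<le>n. repeat_mset (mult i - 1) {#complex_of_real (a i)#})"
    by (subst proots_prod) (auto simp: proots_power)
  also have "proots ?X = (\<Sum>j\<in>{1..n}. {#complex_of_real (x j)#})"
    by (subst proots_prod) auto
  finally have pr: "proots (char_poly (compress N g nodes)) =
     {#0#} + ((\<Sum>i\<le>n. repeat_mset (mult i - 1) {#complex_of_real (a i)#}) + (\<Sum>j\<in>{1..n}. {#complex_of_real (x j)#}))"
    unfolding cp by simp
  have filt: "filter_mset P (\<Sum>i\<in>I. f i) = (\<Sum>i\<in>I. filter_mset P (f i))" for P and f :: "nat \<Rightarrow> complex multiset" and I
    by (induction I rule: infinite_finite_induct) auto
  have f1: "filter_mset (\<lambda>z. z \<notin> E) (repeat_mset (mult i - 1) {#complex_of_real (a i)#}) = {#}" if "i \<le> n" for i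
  proof (cases "1 < mult i")
    case True
    then have "of_real (a i) \<in> E" using multE[OF that] by (simp add: mult_def)
    then show ?thesis by (intro multiset_eqI) auto
  next
    case False
    then have "mult i - 1 = 0" by simp
    then show ?thesis by simp
  qed
  have f2: "filter_mset (\<lambda>z. z \<notin> E) {#complex_of_real (x j)#} = {#complex_of_real (x j)#}" if "j \<in> {1..n}" for j
    using gapE[OF that, of "x j"] x that by (auto simp: interlaced_def)
  have f3: "filter_mset (\<lambda>z. z \<notin> E) (\<Sum>j\<in>{1..n}. {#complex_of_real (x j)#}) = (\<Sum>j\<in>{1..n}. {#complex_of_real (x j)#})"
    unfolding filt by (intro sum.cong refl f2)
  have f4: "filter_mset (\<lambda>z. z \<notin> E) (\<Sum>i\<le>n. repeat_mset (mult i - 1) {#complex_of_real (a i)#}) = {#}"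
    unfolding filt by (intro sum.neutral ballI f1) auto
  have img: "image_mset Re (\<Sum>j\<in>A. {#complex_of_real (x j)#}) = (\<Sum>j\<in>A. {#x j#})" for A
    by (induction A rule: infinite_finite_induct) auto
  have "image_mset Re (filter_mset (\<lambda>z. z \<notin> E) (proots (char_poly (compress N g nodes)))) = (\<Sum>j\<in>{1..n}. {#x j#})"
    unfolding pr by (simp only: filter_union_mset f3 f4 image_mset_union img) (simp add: zeroE)
  also have "\<dots> = mset (rev (map x [1..<Suc n]))"
  proof -
    have "(\<Sum>j\<in>A. {#x j#}) = image_mset x (mset_set A)" if "finite A" for A
      using that by induction auto
    moreover have "mset (rev (map x [1..<Suc n])) = image_mset x (mset_set {1..<Suc n})"
      by (simp only: mset_rev mset_map mset_upt)
    moreover have "{1..<Suc n} = {1..n}" by auto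
    ultimately show ?thesis by simp
  qed
  finally have m: "image_mset Re (filter_mset (\<lambda>z. z \<notin> E) (proots (char_poly (compress N g nodes)))) = mset (rev (map x [1..<Suc n]))" .
  have "sorted (rev (map x [1..<Suc n]))"
    unfolding sorted_wrt_rev sorted_wrt_map
    using sorted_wrt_upt[of 1 "Suc n"]
    by (rule sorted_wrt_mono_rel[rotated]) (use interlaced_decreasing[OF x] in \<open>auto simp: less_Suc_eq_le intro: less_imp_le\<close>)
  then have "sorted_list_of_multiset (mset (rev (map x [1..<Suc n]))) = rev (map x [1..<Suc n])"
    unfolding sorted_list_of_multiset_mset by (rule sorted_sort_id)
  then show ?thesis unfolding eigs_def eigenvalues_outside_def m by simp
qed

text \<open>Concentrating each group sum in a single entry turns the new eigenvalues into a measurable function of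
  the group sums.\<close>

definition rep :: "nat \<Rightarrow> nat" where "rep i = (SOME k. k < N \<and> grp k = i)"

definition spread :: "(nat \<Rightarrow> real) \<Rightarrow> nat \<Rightarrow> complex" where
  "spread \<Gamma> k = (if k = rep (grp k) then of_real (sqrt (\<Gamma> (grp k))) else 0)"

lemma group_sum_spread:
  assumes i: "i \<le> n" and \<Gamma>: "0 \<le> \<Gamma> i"
  shows "group_sum (spread \<Gamma>) i = \<Gamma> i"
proof -
  have r: "rep i < N" "grp (rep i) = i"
    using someI_ex[OF surj[OF i]] by (auto simp: rep_def)
  have "group_sum (spread \<Gamma>) i = (\<Sum>k | k < N \<and> grp k = i. if k = rep i then \<Gamma> i else 0)"
    unfolding group_sum_def using \<Gamma> by (intro sum.cong refl) (auto simp: spread_def)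
  also have "\<dots> = \<Gamma> i" using r by (simp add: sum.delta')
  finally show ?thesis .
qed

lemma eigs_spread:
  assumes S: "0 < S" and x: "interlaced n a x" and \<Gamma>: "\<And>i. i \<le> n \<Longrightarrow> \<Gamma> i = S * resid n a x i"
  shows "eigs (spread \<Gamma>) = map x [1..<Suc n]"
proof (rule eigs_eq[OF S x])
  fix i assume i: "i \<le> n"
  have "0 < \<Gamma> i" unfolding \<Gamma>[OF i] using S resid_pos[of n a x i] dec x i by (intro mult_pos_pos) auto
  then have "group_sum (spread \<Gamma>) i = \<Gamma> i" using i by (intro group_sum_spread) auto
  then show "group_sum (spread \<Gamma>) i = S * resid n a x i" using \<Gamma>[OF i] by simp
qed

text \<open>Both lists are determined by the same interlacing zeros, which exist as soon as every
  group sum is positive; in the Gaussian case this fails only on a null event.\<close>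

lemma eigs_spread_group_sum:
  assumes pos: "\<And>i. i \<le> n \<Longrightarrow> 0 < group_sum g i"
  shows "eigs (spread (\<lambda>i\<in>{..n}. group_sum g i)) = eigs g"
    and "\<exists>x. interlaced n a x \<and> eigs g = map x [1..<Suc n]"
proof -
  let ?S = "\<Sum>i\<le>n. group_sum g i"
  obtain x where x: "interlaced n a x" "\<forall>i\<le>n. group_sum g i = ?S * resid n a x i"
    using ex_interlaced[of n a "group_sum g"] dec pos by blast
  have S: "0 < ?S" using pos by (intro sum_pos) auto
  have 1: "eigs g = map x [1..<Suc n]" by (rule eigs_eq[OF S x(1)]) (use x(2) in blast)
  have 2: "eigs (spread (\<lambda>i\<in>{..n}. group_sum g i)) = map x [1..<Suc n]"
  proof (rule eigs_spread[OF S x(1)])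
    fix i assume i: "i \<le> n"
    then have "(\<lambda>i\<in>{..n}. group_sum g i) i = group_sum g i" by simp
    also have "\<dots> = ?S * resid n a x i" using i x(2) by blast
    finally show "(\<lambda>i\<in>{..n}. group_sum g i) i = ?S * resid n a x i" .
  qed
  show "eigs (spread (\<lambda>i\<in>{..n}. group_sum g i)) = eigs g" unfolding 1 2 ..
  show "\<exists>x. interlaced n a x \<and> eigs g = map x [1..<Suc n]" using 1 x(1) by blast
qed

lemma measurable_entry_eigs:
  assumes "\<And>k. k < N \<Longrightarrow> (\<lambda>\<omega>. g \<omega> k) \<in> borel_measurable Q"
  shows "(\<lambda>\<omega>. entry (eigs (g \<omega>)) j) \<in> borel_measurable Q"
proof -
  interpret measurable_real_spectrum Q "\<lambda>\<omega>. compress N (g \<omega>) nodes" N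
    using assms by (intro measurable_real_spectrum_compress) auto
  show ?thesis unfolding eigs_def by (rule entry_eigenvalues_outside_measurable[OF finE])
qed

end

section \<open>The law of the eigenvalues of one step\<close>

text \<open>The sublevel set is a disc of radius \<open>sqrt u\<close> and area pi times
  \<open>u\<close>.\<close>

lemma distr_norm_square_complex:
  "distr (lborel :: complex measure) borel (\<lambda>z. (cmod z)\<^sup>2) = density lborel (\<lambda>u. ennreal pi * indicator {0..} u)"
proof (rule measure_eqI_generator_eq[where E = "range atMost" and \<Omega> = UNIV and A = "\<lambda>i. {..real i}"])
  show "Int_stable (range (atMost :: real \<Rightarrow> real set))"
  proof -
    have "{..u} \<inter> {..v} = {..min u v}" for u v :: real by auto
    then show ?thesis by (auto simp: Int_stable_def)
  qed
  have L: "emeasure (distr (lborel :: complex measure) borel (\<lambda>z. (cmod z)\<^sup>2)) {..u} = ennreal (pi * max 0 u)" for u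
  proof (cases "0 \<le> u")
    case True
    have "(\<lambda>z. (cmod z)\<^sup>2) -` {..u} = cball 0 (sqrt u)"
    proof -
      have "(cmod z)\<^sup>2 \<le> u \<longleftrightarrow> cmod z \<le> sqrt u" for z
        using real_sqrt_le_iff[of "(cmod z)\<^sup>2" u] by simp
      then show ?thesis by auto
    qed
    then show ?thesis
      using True by (subst emeasure_distr) (auto simp: emeasure_cball unit_ball_vol_2)
  next
    case False
    have "{z :: complex. (cmod z)\<^sup>2 \<le> u} = {}" using False by (auto intro: order_trans[OF zero_le_power2])
    then have "(\<lambda>z :: complex. (cmod z)\<^sup>2) -` {..u} = {}" by auto
    then show ?thesis using False by (subst emeasure_distr) auto
  qed
  have R: "emeasure (density lborel (\<lambda>u. ennreal pi * indicator {0..} u)) {..u} = ennreal (pi * max 0 u)" for u :: real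
  proof -
    have "emeasure (density lborel (\<lambda>u. ennreal pi * indicator {0..} u)) {..u} = (\<integral>\<^sup>+x. ennreal pi * indicator {0..u} x \<partial>lborel)"
      by (subst emeasure_density) (auto intro!: nn_integral_cong simp: indicator_def)
    also have "\<dots> = ennreal (pi * max 0 u)"
      by (subst nn_integral_cmult_indicator) (auto simp: ennreal_mult' max_def)
    finally show ?thesis .
  qed
  show "emeasure (distr lborel borel (\<lambda>z :: complex. (cmod z)\<^sup>2)) X = emeasure (density lborel (\<lambda>u. ennreal pi * indicator {0..} u)) X"
    if "X \<in> range atMost" for X using that L R by auto
  show "emeasure (distr lborel borel (\<lambda>z :: complex. (cmod z)\<^sup>2)) {..real i} \<noteq> \<infinity>" for i
    unfolding L by simp
  show "(\<Union>i. {..real i}) = UNIV" using real_arch_simple by auto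
qed (auto simp: borel_eq_atMost)

text \<open>The Gaussian density depends on the squared modulus only, and the pi from the area
  cancels its normalization.\<close>

lemma std_complex_gaussian_norm_square:
  assumes "std_complex_gaussian M Z"
  shows "distributed M lborel (\<lambda>\<omega>. (cmod (Z \<omega>))\<^sup>2) (exponential_density 1)"
proof -
  let ?k = "\<lambda>u. ennreal (exp (- u) / pi)" and ?s = "\<lambda>z. (cmod z)\<^sup>2"
  have D: "distr M lborel Z = density lborel (\<lambda>z. ?k (?s z))" and Z [measurable]: "Z \<in> borel_measurable M"
    using assms by (auto simp: std_complex_gaussian_def distributed_def)
  have "distr M lborel (\<lambda>\<omega>. ?s (Z \<omega>)) = distr (distr M lborel Z) lborel ?s"
    by (subst distr_distr) (auto simp: comp_def)
  also have "\<dots> = distr (density lborel (\<lambda>z. ?k (?s z))) borel ?s"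
    unfolding D by (rule distr_cong) auto
  also have "\<dots> = density (distr lborel borel ?s) ?k"
    by (rule density_distr[symmetric]) auto
  also have "\<dots> = density lborel (\<lambda>u. ennreal pi * indicator {0..} u * ?k u)"
    unfolding distr_norm_square_complex by (rule density_density_eq) auto
  also have "\<dots> = density lborel (exponential_density 1)"
    by (rule density_cong) (auto simp: exponential_density_def ennreal_mult'[symmetric] indicator_def)
  finally show ?thesis by (auto simp: distributed_def)
qed

lemma PiM_density_lborel:
  fixes f :: "'i \<Rightarrow> real \<Rightarrow> ennreal"
  assumes I: "finite I" and f [measurable]: "\<And>i. f i \<in> borel_measurable borel"
    and prob: "\<And>i. prob_space (density lborel (f i))"
  shows "(\<Pi>\<^sub>M i\<in>I. density lborel (f i)) = density (lborel_PiM I) (\<lambda>x. \<Prod>i\<in>I. f i (x i))"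
proof -
  interpret D: product_sigma_finite "\<lambda>i. density lborel (f i)"
    unfolding product_sigma_finite_def using prob by (auto intro: prob_space_imp_sigma_finite)
  have fm: "(\<lambda>x. \<Prod>i\<in>I. f i (x i)) \<in> borel_measurable (lborel_PiM I)"
    by (intro borel_measurable_prod_ennreal) measurable
  show ?thesis
  proof (rule D.PiM_eqI[symmetric, OF I])
    show "sets (density (lborel_PiM I) (\<lambda>x. \<Prod>i\<in>I. f i (x i))) = sets (\<Pi>\<^sub>M i\<in>I. density lborel (f i))"
      by (auto intro!: sets_PiM_cong)
    fix A assume A: "\<And>i. i \<in> I \<Longrightarrow> A i \<in> sets (density lborel (f i))"
    then have A': "\<And>i. i \<in> I \<Longrightarrow> A i \<in> sets borel" by simp
    have "emeasure (density (lborel_PiM I) (\<lambda>x. \<Prod>i\<in>I. f i (x i))) (Pi\<^sub>E I A) =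
        (\<integral>\<^sup>+x. (\<Prod>i\<in>I. f i (x i)) * indicator (Pi\<^sub>E I A) x \<partial>(lborel_PiM I))"
      using A' by (intro emeasure_density fm sets_PiM_I_finite I) auto
    also have "\<dots> = (\<integral>\<^sup>+x. (\<Prod>i\<in>I. f i (x i) * indicator (A i) (x i)) \<partial>(lborel_PiM I))"
    proof (rule nn_integral_cong)
      fix x assume "x \<in> space (lborel_PiM I)"
      then have "x \<in> extensional I" by (simp add: space_PiM PiE_def)
      then have "indicator (Pi\<^sub>E I A) x = (\<Prod>i\<in>I. indicator (A i) (x i) :: ennreal)"
        using I by (auto simp: indicator_def PiE_def Pi_def prod_zero_iff)
      then show "(\<Prod>i\<in>I. f i (x i)) * indicator (Pi\<^sub>E I A) x = (\<Prod>i\<in>I. f i (x i) * indicator (A i) (x i))"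
        by (simp add: prod.distrib)
    qed
    also have "\<dots> = (\<Prod>i\<in>I. \<integral>\<^sup>+y. f i y * indicator (A i) y \<partial>lborel)"
      by (rule lborel_prod.product_nn_integral_prod) (use I A' in auto)
    also have "\<dots> = (\<Prod>i\<in>I. emeasure (density lborel (f i)) (A i))"
      using A' by (intro prod.cong refl emeasure_density[symmetric]) auto
    finally show "emeasure (density (lborel_PiM I) (\<lambda>x. \<Prod>i\<in>I. f i (x i))) (Pi\<^sub>E I A) =
      (\<Prod>i\<in>I. emeasure (density lborel (f i)) (A i))" .
  qed
qed

lemma entry_map_upt: "j \<in> {1..n} \<Longrightarrow> entry (map x [1..<Suc n]) j = x j"
  by (auto simp: entry_def simp del: upt_Suc)

section \<open>Group sums of a Gaussian vector\<close>

locale gaussian_grouped_nodes = prob_space M + grouped_nodes N n a grp E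
  for M :: "'w measure" and N n a grp E +
  fixes Z :: "nat \<Rightarrow> 'w \<Rightarrow> complex"
  assumes gauss: "\<And>k. k < N \<Longrightarrow> std_complex_gaussian M (Z k)"
    and indep: "indep_vars (\<lambda>_. borel) Z {..<N}"
begin

abbreviation gsum :: "'w \<Rightarrow> nat \<Rightarrow> real" where
  "gsum \<omega> i \<equiv> group_sum (\<lambda>k. Z k \<omega>) i"

lemma Z_measurable: "k < N \<Longrightarrow> Z k \<in> borel_measurable M"
  using gauss by (auto simp: std_complex_gaussian_def distributed_def)

lemma gsum_measurable [measurable]: "(\<lambda>\<omega>. gsum \<omega> i) \<in> borel_measurable M"
  unfolding group_sum_def using Z_measurable
  by (intro borel_measurable_sum borel_measurable_power borel_measurable_norm) auto

text \<open>A sum of \<open>mult i\<close> independent unit exponentials;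
  \<open>erlang_density k\<close> has shape k + 1, hence the index
  \<open>mult i - 1\<close>.\<close>

lemma gsum_erlang:
  assumes i: "i \<le> n"
  shows "distributed M lborel (\<lambda>\<omega>. gsum \<omega> i) (erlang_density (mult i - 1) 1)"
proof -
  let ?K = "{k. k < N \<and> grp k = i}"
  have "indep_vars (\<lambda>_. borel) (\<lambda>k \<omega>. (cmod (Z k \<omega>))\<^sup>2) ?K"
    using indep_vars_compose2[OF indep_vars_subset[OF indep], of ?K "\<lambda>_ z. (cmod z)\<^sup>2" "\<lambda>_. borel"] by auto
  then show ?thesis
    unfolding group_sum_def mult_def
    using surj[OF i] gauss by (intro exponential_distributed_sum std_complex_gaussian_norm_square) auto
qed

lemma gsum_indep: "indep_vars (\<lambda>_. borel) (\<lambda>i \<omega>. gsum \<omega> i) {..n}"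
proof -
  let ?K = "\<lambda>i. {k. k < N \<and> grp k = i}"
  have "indep_vars (\<lambda>i. \<Pi>\<^sub>M k\<in>?K i. borel) (\<lambda>i \<omega>. restrict (\<lambda>k. Z k \<omega>) (?K i)) {..n}"
    using indep by (rule indep_vars_restrict) (auto simp: disjoint_family_on_def)
  then have "indep_vars (\<lambda>_. borel) (\<lambda>i \<omega>. \<Sum>k\<in>?K i. (cmod (restrict (\<lambda>k. Z k \<omega>) (?K i) k))\<^sup>2) {..n}"
  proof (rule indep_vars_compose2)
    fix i
    have [measurable]: "(\<lambda>v. v k) \<in> borel_measurable (\<Pi>\<^sub>M k\<in>?K i. borel :: complex measure)" if "k \<in> ?K i" for k
      using that by (rule measurable_component_singleton)
    show "(\<lambda>v. \<Sum>k\<in>?K i. (cmod (v k))\<^sup>2) \<in> borel_measurable (\<Pi>\<^sub>M k\<in>?K i. borel)"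
      by measurable
  qed
  moreover have "(\<lambda>i \<omega>. \<Sum>k\<in>?K i. (cmod (restrict (\<lambda>k. Z k \<omega>) (?K i) k))\<^sup>2) = (\<lambda>i \<omega>. gsum \<omega> i)"
    by (auto simp: group_sum_def fun_eq_iff intro!: sum.cong)
  ultimately show ?thesis by simp
qed

lemma distr_gsum:
  "distr M (lborel_PiM {..n}) (\<lambda>\<omega>. \<lambda>i\<in>{..n}. gsum \<omega> i) =
    density (lborel_PiM {..n}) (\<lambda>\<Gamma>. \<Prod>i\<le>n. ennreal (erlang_density (mult i - 1) 1 (\<Gamma> i)))"
proof -
  have "distr M (lborel_PiM {..n}) (\<lambda>\<omega>. \<lambda>i\<in>{..n}. gsum \<omega> i) =
      distr M (\<Pi>\<^sub>M i\<in>{..n}. borel) (\<lambda>\<omega>. \<lambda>i\<in>{..n}. gsum \<omega> i)"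
    by (intro distr_cong sets_PiM_cong) auto
  also have "\<dots> = (\<Pi>\<^sub>M i\<in>{..n}. distr M borel (\<lambda>\<omega>. gsum \<omega> i))"
    using gsum_indep by (subst indep_vars_iff_distr_eq_PiM'[symmetric]) auto
  also have "\<dots> = (\<Pi>\<^sub>M i\<in>{..n}. density lborel (\<lambda>x. ennreal (erlang_density (mult i - 1) 1 x)))"
  proof (rule PiM_cong)
    fix i assume "i \<in> {..n}"
    then have "distr M lborel (\<lambda>\<omega>. gsum \<omega> i) = density lborel (erlang_density (mult i - 1) 1)"
      using gsum_erlang by (intro distributed_distr_eq_density) auto
    moreover have "distr M borel (\<lambda>\<omega>. gsum \<omega> i) = distr M lborel (\<lambda>\<omega>. gsum \<omega> i)"
      by (rule distr_cong) auto
    ultimately show "distr M borel (\<lambda>\<omega>. gsum \<omega> i) = density lborel (\<lambda>x. ennreal (erlang_density (mult i - 1) 1 x))"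
      by simp
  qed simp
  also have "\<dots> = density (lborel_PiM {..n}) (\<lambda>\<Gamma>. \<Prod>i\<le>n. ennreal (erlang_density (mult i - 1) 1 (\<Gamma> i)))"
    by (rule PiM_density_lborel) (auto intro: prob_space_erlang_density)
  finally show ?thesis .
qed

lemma AE_gsum_pos: "AE \<omega> in M. \<forall>i\<in>{..n}. 0 < gsum \<omega> i"
proof (rule AE_finite_allI)
  fix i assume "i \<in> {..n}"
  then have e: "distr M lborel (\<lambda>\<omega>. gsum \<omega> i) = density lborel (erlang_density (mult i - 1) 1)"
    using gsum_erlang by (intro distributed_distr_eq_density) auto
  have "AE x in lborel. 0 < ennreal (erlang_density (mult i - 1) 1 x) \<longrightarrow> 0 < x"
    using AE_lborel_singleton[of "0 :: real"] by eventually_elim (auto simp: erlang_density_def)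
  then have "AE x in density lborel (erlang_density (mult i - 1) 1). 0 < x"
    by (subst AE_density) auto
  then have "AE x in distr M lborel (\<lambda>\<omega>. gsum \<omega> i). 0 < x" unfolding e .
  then show "AE \<omega> in M. 0 < gsum \<omega> i" by (subst (asm) AE_distr_iff) auto
qed simp

text \<open>The normalization of the Dirichlet law of the normalized group sums: the denominators
  come from the individual Erlang densities, the numerator from the Erlang density of the
  total.\<close>

definition kernel_const :: real where
  "kernel_const = fact (N - 1) / (\<Prod>i\<le>n. fact (mult i - 1))"

definition eigs_density :: "(nat \<Rightarrow> real) \<Rightarrow> real" where
  "eigs_density x = (if interlaced n a x
    then kernel_const * ((\<Prod>i\<le>n. resid n a x i ^ (mult i - 1)) * (vdm 1 n x / vdm 0 n a)) else 0)"

text \<open>The residues sum to 1, so the exponentials multiply to \<open>exp (- S)\<close>, and the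
  powers of \<open>S\<close> can be collected. The total thus separates from the zeros.\<close>

lemma erlang_prod:
  assumes S: "0 < S" and x: "interlaced n a x"
  shows "(\<Prod>i\<le>n. erlang_density (mult i - 1) 1 (S * resid n a x i)) * (S ^ n * vdm 1 n x / vdm 0 n a) =
    erlang_density (N - 1) 1 S * eigs_density x"
proof -
  have r: "0 < resid n a x i" if "i \<le> n" for i using resid_pos[of n a x i] dec x that by auto
  have "(\<Prod>i\<le>n. erlang_density (mult i - 1) 1 (S * resid n a x i)) =
      (\<Prod>i\<le>n. S ^ (mult i - 1) * resid n a x i ^ (mult i - 1) * exp (- S * resid n a x i) / fact (mult i - 1))"
    using r S by (intro prod.cong refl) (auto simp: erlang_density_def power_mult_distrib mult_less_0_iff less_imp_le not_less)
  also have "\<dots> = S ^ (\<Sum>i\<le>n. mult i - 1) * (\<Prod>i\<le>n. resid n a x i ^ (mult i - 1)) * exp (\<Sum>i\<le>n. - S * resid n a x i) / (\<Prod>i\<le>n. fact (mult i - 1))"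
    by (simp add: prod.distrib prod_dividef power_sum exp_sum)
  also have "(\<Sum>i\<le>n. - S * resid n a x i) = - S"
    unfolding sum_distrib_left[symmetric] sum_resid[OF inj_a] by simp
  finally have 1: "(\<Prod>i\<le>n. erlang_density (mult i - 1) 1 (S * resid n a x i)) =
     S ^ (\<Sum>i\<le>n. mult i - 1) * (\<Prod>i\<le>n. resid n a x i ^ (mult i - 1)) * exp (- S) / (\<Prod>i\<le>n. fact (mult i - 1))" .
  \<comment> \<open>Degree count: each of the \<open>n + 1\<close> groups loses one from the total
    \<open>N\<close>, and the Jacobian gives back \<open>n\<close>.\<close>
  have "(\<Sum>i\<le>n. mult i - 1) + Suc n = (\<Sum>i\<le>n. (mult i - 1) + 1)" by (simp only: sum.distrib) simp
  also have "\<dots> = (\<Sum>i\<le>n. mult i)" using mult_pos by (intro sum.cong) (auto simp: Suc_le_eq)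
  finally have "(\<Sum>i\<le>n. mult i - 1) + n = N - 1" unfolding sum_mult by simp
  then have 2: "S ^ (\<Sum>i\<le>n. mult i - 1) * S ^ n = S ^ (N - 1)" by (simp add: power_add[symmetric])
  have "(\<Prod>i\<le>n. erlang_density (mult i - 1) 1 (S * resid n a x i)) * (S ^ n * vdm 1 n x / vdm 0 n a) =
      (S ^ (\<Sum>i\<le>n. mult i - 1) * S ^ n) * exp (- S) * ((\<Prod>i\<le>n. resid n a x i ^ (mult i - 1)) * (vdm 1 n x / vdm 0 n a)) / (\<Prod>i\<le>n. fact (mult i - 1))"
    unfolding 1 by (simp add: mult_ac)
  also have "\<dots> = erlang_density (N - 1) 1 S * eigs_density x"
    unfolding 2 using S x by (simp add: erlang_density_def eigs_density_def kernel_const_def mult_ac)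
  finally show ?thesis .
qed

lemma measurable_eigs_density [measurable]:
  "eigs_density \<in> borel_measurable (lborel_PiM {1..n})"
proof -
  have [measurable]: "(\<lambda>x. \<Prod>i\<le>n. resid n a x i ^ (mult i - 1)) \<in> borel_measurable (lborel_PiM {1..n})"
    using measurable_resid by (intro borel_measurable_prod borel_measurable_power) auto
  show ?thesis unfolding eigs_density_def[abs_def] by measurable
qed

text \<open>The integral is moved to the law of the group sums and then to the coordinates
  \<open>S\<close> and \<open>x\<close>. The eigenvalues do not depend on \<open>S\<close>, whose
  density integrates to 1.\<close>

theorem nn_integral_eigs:
  assumes F [measurable]: "F \<in> borel_measurable (lborel_PiM {1..n})"
  shows "(\<integral>\<^sup>+\<omega>. F (\<lambda>j\<in>{1..n}. entry (eigs (\<lambda>k. Z k \<omega>)) j) \<partial>M) =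
    (\<integral>\<^sup>+x. F x * ennreal (eigs_density x) \<partial>(lborel_PiM {1..n}))"
proof -
  let ?PM = "lborel_PiM {..n}" and ?PX = "lborel_PiM {1..n}"
  interpret PX: sigma_finite_measure ?PX by (rule sigma_finite_PiM_lborel) simp
  \<comment> \<open>Going through \<open>spread\<close> gives a measurable function of the group
    sums alone, agreeing almost surely with the eigenvalues of the original vector.\<close>
  define R where "R \<Gamma> = (\<lambda>j\<in>{1..n}. entry (eigs (spread \<Gamma>)) j)" for \<Gamma>
  define erl where "erl \<Gamma> = (\<Prod>i\<le>n. ennreal (erlang_density (mult i - 1) 1 (\<Gamma> i)))" for \<Gamma> :: "nat \<Rightarrow> real"
  have comp: "(\<lambda>\<Gamma>. \<Gamma> i) \<in> borel_measurable ?PM" if "i \<le> n" for i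
    using measurable_component_singleton[of i "{..n}" "\<lambda>_. lborel :: real measure"] that by simp
  have R [measurable]: "R \<in> measurable ?PM ?PX"
  proof -
    have "(\<lambda>\<Gamma>. spread \<Gamma> k) \<in> borel_measurable ?PM" if "k < N" for k
    proof -
      note [measurable] = comp[OF grp[OF that]]
      show ?thesis unfolding spread_def by measurable
    qed
    from measurable_entry_eigs[OF this] show ?thesis
      unfolding R_def[abs_def] by (intro measurable_restrict) simp
  qed
  have erl [measurable]: "erl \<in> borel_measurable ?PM"
    unfolding erl_def[abs_def] using comp
    by (intro borel_measurable_prod_ennreal measurable_compose[OF _ measurable_ennreal] measurable_compose[OF _ borel_measurable_erlang_density]) auto
  have [measurable]: "(\<lambda>\<omega>. \<lambda>i\<in>{..n}. gsum \<omega> i) \<in> measurable M ?PM"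
    by (intro measurable_restrict) simp
  have [measurable]: "Measurable.pred ?PM (\<lambda>\<Gamma>. \<forall>i\<le>n. 0 < \<Gamma> i)"
  proof -
    have "Measurable.pred ?PM (\<lambda>\<Gamma>. \<forall>i\<in>{..n}. 0 < \<Gamma> i)" by measurable
    then show ?thesis by (simp add: atMost_def)
  qed
  define G where "G \<Gamma> = F (R \<Gamma>) * erl \<Gamma>" for \<Gamma>
  have G [measurable]: "G \<in> borel_measurable ?PM" unfolding G_def[abs_def] by measurable

  \<comment> \<open>Evaluated at residues built from \<open>x\<close>, the map \<open>R\<close>
    returns \<open>x\<close> itself, so what remains is a product of a function of \<open>S\<close>
    and a function of \<open>x\<close>.\<close>
  have integrand: "resid_integrand G n a S x =
      ennreal (if 0 < S then erlang_density (N - 1) 1 S else 0) * (F x * ennreal (eigs_density x))"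
    if xs: "x \<in> space ?PX" for S x
  proof (cases "0 < S \<and> interlaced n a x")
    case True
    then have S: "0 < S" and x: "interlaced n a x" by auto
    let ?\<Gamma> = "\<lambda>i\<in>{..n}. S * resid n a x i"
    have r: "0 < resid n a x i" if "i \<le> n" for i using resid_pos[of n a x i] dec x that by auto
    have "eigs (spread ?\<Gamma>) = map x [1..<Suc n]" by (rule eigs_spread[OF S x]) simp
    then have "R ?\<Gamma> = (\<lambda>j\<in>{1..n}. x j)" unfolding R_def by (intro restrict_ext) (simp only: entry_map_upt)
    also have "\<dots> = x" using xs by (auto simp: space_PiM PiE_def extensional_def fun_eq_iff)
    finally have Rx: "R ?\<Gamma> = x" .
    have "erl ?\<Gamma> = ennreal (\<Prod>i\<le>n. erlang_density (mult i - 1) 1 (S * resid n a x i))"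
      unfolding erl_def by (subst prod_ennreal[symmetric]) (auto intro: erlang_density_nonneg)
    then have "resid_integrand G n a S x = F x * (ennreal (\<Prod>i\<le>n. erlang_density (mult i - 1) 1 (S * resid n a x i)) * ennreal (S ^ n * vdm 1 n x / vdm 0 n a))"
      unfolding resid_integrand_def G_def Rx if_P[OF True] by (simp only: mult.assoc)
    also have "\<dots> = F x * ennreal (erlang_density (N - 1) 1 S * eigs_density x)"
      unfolding erlang_prod[OF S x, symmetric]
      by (subst ennreal_mult') (auto intro!: prod_nonneg erlang_density_nonneg)
    also have "\<dots> = ennreal (if 0 < S then erlang_density (N - 1) 1 S else 0) * (F x * ennreal (eigs_density x))"
      using S by (subst ennreal_mult') (auto intro: erlang_density_nonneg simp: mult_ac)
    finally show ?thesis .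
  next
    case False
    then show ?thesis by (auto simp: resid_integrand_def eigs_density_def)
  qed

  have "(\<integral>\<^sup>+\<omega>. F (\<lambda>j\<in>{1..n}. entry (eigs (\<lambda>k. Z k \<omega>)) j) \<partial>M) =
      (\<integral>\<^sup>+\<omega>. (\<lambda>\<Gamma>. if \<forall>i\<le>n. 0 < \<Gamma> i then F (R \<Gamma>) else 0) (\<lambda>i\<in>{..n}. gsum \<omega> i) \<partial>M)"
  proof (rule nn_integral_cong_AE, use AE_gsum_pos in eventually_elim)
    case (elim \<omega>)
    then have "eigs (spread (\<lambda>i\<in>{..n}. gsum \<omega> i)) = eigs (\<lambda>k. Z k \<omega>)"
      by (intro eigs_spread_group_sum) auto
    with elim show ?case by (simp add: R_def)
  qed
  also have "\<dots> = (\<integral>\<^sup>+\<Gamma>. (if \<forall>i\<le>n. 0 < \<Gamma> i then F (R \<Gamma>) else 0) \<partial>distr M ?PM (\<lambda>\<omega>. \<lambda>i\<in>{..n}. gsum \<omega> i))"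
    by (rule nn_integral_distr[symmetric]) measurable
  also have "\<dots> = (\<integral>\<^sup>+\<Gamma>. erl \<Gamma> * (if \<forall>i\<le>n. 0 < \<Gamma> i then F (R \<Gamma>) else 0) \<partial>?PM)"
    unfolding distr_gsum erl_def[symmetric] by (rule nn_integral_density) measurable
  also have "\<dots> = (\<integral>\<^sup>+\<Gamma>. (if \<forall>i\<le>n. 0 < \<Gamma> i then G \<Gamma> else 0) \<partial>?PM)"
    by (intro nn_integral_cong) (auto simp: G_def mult.commute)
  also have "\<dots> = (\<integral>\<^sup>+S. \<integral>\<^sup>+x. resid_integrand G n a S x \<partial>?PX \<partial>lborel)"
    by (rule nn_integral_residues) (use dec G in auto)
  also have "\<dots> = (\<integral>\<^sup>+S. \<integral>\<^sup>+x. ennreal (if 0 < S then erlang_density (N - 1) 1 S else 0) * (F x * ennreal (eigs_density x)) \<partial>?PX \<partial>lborel)"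
    by (rule nn_integral_cong, rule nn_integral_cong) (rule integrand)
  also have "\<dots> = (\<integral>\<^sup>+S. ennreal (if 0 < S then erlang_density (N - 1) 1 S else 0) * (\<integral>\<^sup>+x. F x * ennreal (eigs_density x) \<partial>?PX) \<partial>lborel)"
    by (rule nn_integral_cong, rule nn_integral_cmult) measurable
  also have "\<dots> = (\<integral>\<^sup>+S. ennreal (if 0 < S then erlang_density (N - 1) 1 S else 0) \<partial>lborel) * (\<integral>\<^sup>+x. F x * ennreal (eigs_density x) \<partial>?PX)"
    by (rule nn_integral_multc) measurable
  \<comment> \<open>The total mass of the Erlang law is taken as its moment of order 0, which
    explains the factor \<open>S ^ 0\<close>.\<close>
  also have "(\<integral>\<^sup>+S. ennreal (if 0 < S then erlang_density (N - 1) 1 S else 0) \<partial>lborel) = (\<integral>\<^sup>+S. ennreal (erlang_density (N - 1) 1 S * S ^ 0) \<partial>lborel)"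
    by (rule nn_integral_cong_AE, use AE_lborel_singleton[of "0 :: real"] in eventually_elim) (auto simp: erlang_density_def)
  also have "\<dots> = 1" by (subst nn_integral_erlang_ith_moment) auto
  finally show ?thesis unfolding mult_1_left .
qed

end

section \<open>The nodes of each step\<close>

lemma vdm_head: "vdm 0 n x = (\<Prod>k\<in>{1..n}. x 0 - x k) * vdm 1 n x"
proof -
  have "vdm 0 n x = (\<Prod>k\<in>{1..n}. \<Prod>j\<in>{0..<k}. x j - x k)"
    unfolding vdm_def by (subst prod.atLeast_Suc_atMost) auto
  also have "\<dots> = (\<Prod>k\<in>{1..n}. (x 0 - x k) * (\<Prod>j\<in>{1..<k}. x j - x k))"
    by (intro prod.cong refl) (subst prod.atLeast_Suc_lessThan, auto)
  finally show ?thesis by (simp add: prod.distrib vdm_def)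
qed

lemma vdm_shift: "vdm 0 n (\<lambda>i. x (Suc i)) = vdm 1 (Suc n) x"
proof (induction n)
  case (Suc n)
  have "(\<Prod>j\<in>{0..n}. x (Suc j) - x (Suc (Suc n))) = (\<Prod>j\<in>{1..Suc n}. x j - x (Suc (Suc n)))"
    unfolding One_nat_def by (rule prod.shift_bounds_cl_Suc_ivl[symmetric])
  with Suc show ?case using vdm_Suc[of 0 n "\<lambda>i. x (Suc i)"] vdm_Suc[of 1 "Suc n" x] by simp
qed (simp add: vdm_def)

lemma interlaced_imp_decreasing:
  assumes dec: "\<And>i. i < n \<Longrightarrow> a (Suc i) < a i"
    and x: "interlaced n a x" and j: "j \<in> {1..<n}"
  shows "x (Suc j) < x j"
proof -
  have "j \<in> {1..n}" "Suc j \<in> {1..n}" using j by auto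
  with x have "a j < x j" "x (Suc j) < a j" unfolding interlaced_def by force+
  then show ?thesis by simp
qed

definition good_line :: "nat \<Rightarrow> (nat \<Rightarrow> real) \<Rightarrow> bool" where
  "good_line k y \<longleftrightarrow> (\<forall>j\<in>{1..k}. 0 < y j \<and> y j < 1) \<and> (\<forall>j\<in>{1..<k}. y (Suc j) < y j)"

lemma vdm_pos: "good_line n x \<Longrightarrow> 0 < vdm 1 n x"
proof -
  assume x: "good_line n x"
  have "x k < x j" if "1 \<le> j" "j < k" "k \<le> n" for j k
    using that(2,3)
  proof (induction k)
    case (Suc k)
    then show ?case using x that(1) by (cases "j = k") (auto simp: good_line_def intro: less_trans)
  qed simp
  then show ?thesis unfolding vdm_def by (intro prod_pos) auto
qed

lemma resid_first:
  assumes "a 0 = 1"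
  shows "resid n a x 0 = (\<Prod>j\<in>{1..n}. 1 - x j) / (\<Prod>k\<in>{1..n}. 1 - a k)"
proof -
  have "{..n} - {0} = {1..n}" by auto
  then show ?thesis using assms by (simp add: resid_def)
qed

lemma resid_last:
  assumes "a n = 0" "0 < n"
  shows "resid n a x n = (\<Prod>j\<in>{1..n}. x j) / (\<Prod>k\<in>{0..<n}. a k)"
proof -
  have "{..n} - {n} = {0..<n}" by auto
  moreover have "(\<Prod>j\<in>A. - f j) = (- 1) ^ card A * (\<Prod>j\<in>A. f j)" for A and f :: "nat \<Rightarrow> real"
    by (rule prod_uminus)
  ultimately show ?thesis using assms by (simp add: resid_def)
qed

locale bead_params =
  fixes p q :: nat
  assumes p1: "1 \<le> p" and pq: "p \<le> q"
begin

abbreviation np :: "nat \<Rightarrow> nat" where "np \<equiv> num_part p q"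

text \<open>The distinct eigenvalues of the matrix of step \<open>s\<close> in decreasing order, and the index among them
  of its \<open>k\<close>-th diagonal entry.\<close>

definition node :: "nat \<Rightarrow> (nat \<Rightarrow> real) \<Rightarrow> nat \<Rightarrow> real" where
  "node s y i = (if s \<le> q then (if i = 0 then 1 else if i \<le> np (s - 1) then y i else 0) else y (Suc i))"

definition node_index :: "nat \<Rightarrow> nat \<Rightarrow> nat" where
  "node_index s k = (if k < p + 1 - s then np s
     else if k < p + 1 - s + np (s - 1) then k - (p + 1 - s) + (if s \<le> q then 1 else 0) else 0)"

definition diag_entries :: "nat \<Rightarrow> real list \<Rightarrow> real list" where
  "diag_entries s l = (if s \<le> p then replicate (p + 1 - s) 0 @ l @ replicate (q + 1 - s) 1
      else if s \<le> q then l @ replicate (q + 1 - s) 1 else l)"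

definition excluded :: "nat \<Rightarrow> complex set" where
  "excluded s = (if s \<le> q then {0, 1} else {0})"

lemma A_mat_diag_entries: "A_mat p q s l = real_diag (diag_entries s l)"
  by (simp add: A_mat_def diag_entries_def)

lemma step_cases [consumes 1, case_names first second third]:
  assumes "s \<in> {1..<p + q}"
  obtains "s \<le> p" "s \<le> q" "np s = s" "np (s - 1) = s - 1" "A_size p q s = p + q + 1 - s"
  | "p < s" "s \<le> q" "np s = p" "np (s - 1) = p" "A_size p q s = p + q + 1 - s" "p + 1 - s = 0"
  | "p < s" "q < s" "np s = p + q - s" "np (s - 1) = Suc (p + q - s)" "A_size p q s = Suc (p + q - s)" "p + 1 - s = 0" "0 < p + q - s"
proof -
  consider "s \<le> p" | "p < s" "s \<le> q" | "q < s" by linarith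
  then show thesis
  proof cases
    case 1
    then show ?thesis using assms pq by (intro that(1)) (auto simp: num_part_def A_size_def)
  next
    case 2
    then have "np (s - 1) = p" by (cases "s = Suc p") (auto simp: num_part_def)
    with 2 show ?thesis using assms by (intro that(2)) (auto simp: num_part_def A_size_def)
  next
    case 3
    have "np (s - 1) = Suc (p + q - s)"
      using assms 3 pq by (cases "s = Suc q"; cases "p = q") (auto simp: num_part_def)
    with 3 show ?thesis using assms pq by (intro that(3)) (auto simp: num_part_def A_size_def)
  qed
qed

lemma length_diag_entries:
  assumes "s \<in> {1..<p + q}" "length l = np (s - 1)"
  shows "length (diag_entries s l) = A_size p q s"
proof -
  have "1 \<le> s" using assms(1) by simp
  then show ?thesis
    using assms(2) pq by (cases rule: step_cases[OF assms(1)]) (auto simp: diag_entries_def)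
qed

lemma diag_entries_nth:
  assumes s: "s \<in> {1..<p + q}" and k: "k < A_size p q s"
  shows "diag_entries s (map y [1..<np (s - 1) + 1]) ! k = node s y (node_index s k)"
  using s
proof (cases rule: step_cases)
  case first
  then show ?thesis using s k
    by (auto simp: diag_entries_def node_def node_index_def nth_append simp del: upt_Suc)
next
  case second
  then show ?thesis using s k
    by (auto simp: diag_entries_def node_def node_index_def nth_append simp del: upt_Suc)
next
  case third
  then show ?thesis using s k
    by (auto simp: diag_entries_def node_def node_index_def nth_append simp del: upt_Suc)
qed

lemma node_decreasing:
  assumes s: "s \<in> {1..<p + q}" and y: "good_line (np (s - 1)) y" and i: "i < np s"
  shows "node s y (Suc i) < node s y i"
  using s
proof (cases rule: step_cases)
  case first
  then show ?thesis using s y i by (cases "i = 0"; cases "Suc i = s") (auto simp: node_def good_line_def)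
next
  case second
  then show ?thesis using s y i by (cases "i = 0") (auto simp: node_def good_line_def)
next
  case third
  then show ?thesis using s y i by (auto simp: node_def good_line_def)
qed

lemma node_bounds:
  assumes s: "s \<in> {1..<p + q}" and y: "good_line (np (s - 1)) y" and i: "i \<le> np s"
  shows "0 \<le> node s y i" "node s y i \<le> 1"
proof -
  have y': "0 < y j" "y j < 1" if "1 \<le> j" "j \<le> np (s - 1)" for j using y that by (auto simp: good_line_def)
  have "0 \<le> node s y i \<and> node s y i \<le> 1"
  proof (cases "s \<le> q")
    case True
    then show ?thesis using y'[of i] by (auto simp: node_def less_imp_le)
  next
    case False
    then have "Suc i \<le> np (s - 1)" using i by (cases rule: step_cases[OF s]) auto
    then show ?thesis using y'[of "Suc i"] False by (auto simp: node_def less_imp_le)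
  qed
  then show "0 \<le> node s y i" "node s y i \<le> 1" by auto
qed

abbreviation fiber :: "nat \<Rightarrow> nat \<Rightarrow> nat set" where
  "fiber s i \<equiv> {k. k < A_size p q s \<and> node_index s k = i}"

lemma card_node_index:
  assumes s: "s \<in> {1..<p + q}" and i: "i \<le> np s"
  shows "card (fiber s i) =
    (if s \<le> q \<and> i = 0 then q + 1 - s else if s \<le> p \<and> i = np s then p + 1 - s else 1)"
  using s
proof (cases rule: step_cases)
  case first
  consider "i = 0" | "i = s" "i \<noteq> 0" | "0 < i" "i < s" using i first by linarith
  then show ?thesis
  proof cases
    case 1
    then have "fiber s i = {p..<p + q + 1 - s}"
      using s first by (auto simp: node_index_def split: if_splits)
    then show ?thesis using 1 first by simp
  next
    case 2
    then have "fiber s i = {..<p + 1 - s}"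
      using s first by (auto simp: node_index_def split: if_splits)
    then show ?thesis using 2 first by simp
  next
    case 3
    then have "fiber s i = {p - s + i}"
      using s first pq by (auto simp: node_index_def split: if_splits)
    then show ?thesis using 3 first by simp
  qed
next
  case second
  show ?thesis
  proof (cases "i = 0")
    case True
    then have "fiber s i = {p..<p + q + 1 - s}"
      using s second by (auto simp: node_index_def split: if_splits)
    then show ?thesis using True second by simp
  next
    case False
    then have "fiber s i = {i - 1}"
      using s second i by (auto simp: node_index_def split: if_splits)
    then show ?thesis using False second by simp
  qed
next
  case third
  then have "fiber s i = {i}"
    using s i by (auto simp: node_index_def split: if_splits)
  then show ?thesis using third by simp
qed

lemma grouped_nodes_step:
  assumes s: "s \<in> {1..<p + q}" and y: "good_line (np (s - 1)) y"
  shows "grouped_nodes (A_size p q s) (np s) (node s y) (node_index s) (excluded s)"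
proof
  show "node s y (Suc i) < node s y i" if "i < np s" for i using s y that by (rule node_decreasing)
  show "node_index s k \<le> np s" if "k < A_size p q s" for k
    using that s by (cases rule: step_cases[OF s]) (auto simp: node_index_def)
  show "\<exists>k<A_size p q s. node_index s k = i" if i: "i \<le> np s" for i
  proof -
    have "card (fiber s i) \<noteq> 0"
      unfolding card_node_index[OF s i] by auto
    then have "fiber s i \<noteq> {}" by (metis card.empty)
    then show ?thesis by blast
  qed
  show "finite (excluded s)" "0 \<in> excluded s" by (auto simp: excluded_def)
  show "complex_of_real (node s y i) \<in> excluded s"
    if i: "i \<le> np s" and c: "1 < card (fiber s i)" for i
  proof -
    have "(s \<le> q \<and> i = 0) \<or> (s \<le> p \<and> i = np s)"
      using c unfolding card_node_index[OF s i] by (auto split: if_splits)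
    then show ?thesis
    proof
      assume "s \<le> p \<and> i = np s"
      then show ?thesis using s pq by (auto simp: node_def excluded_def num_part_def)
    qed (auto simp: node_def excluded_def)
  qed
  show "complex_of_real x \<notin> excluded s" if j: "j \<in> {1..np s}" and x: "node s y j < x" "x < node s y (j - 1)" for j x
  proof -
    have "j \<le> np s" "j - 1 \<le> np s" using j by auto
    then have "0 < x" "x < 1" using node_bounds(1)[OF s y, of j] node_bounds(2)[OF s y, of "j - 1"] x by linarith+
    then show ?thesis by (auto simp: excluded_def)
  qed
qed

lemma good_line_interlaced:
  assumes s: "s \<in> {1..<p + q}" and y: "good_line (np (s - 1)) y"
    and x: "interlaced (np s) (node s y) x"
  shows "good_line (np s) x"
  unfolding good_line_def
proof safe
  fix j assume j: "j \<in> {1..np s}"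
  then have "node s y j < x j" "x j < node s y (j - 1)" using x by (auto simp: interlaced_def)
  moreover have "j \<le> np s" "j - 1 \<le> np s" using j by auto
  ultimately show "0 < x j" "x j < 1"
    using node_bounds(1)[OF s y, of j] node_bounds(2)[OF s y, of "j - 1"] by linarith+
next
  fix j assume "j \<in> {1..<np s}"
  with node_decreasing[OF s y] x show "x (Suc j) < x j" by (rule interlaced_imp_decreasing)
qed

text \<open>While 0 and 1 are nodes, the exponents are their multiplicities \<open>p + 1 - s\<close>
  and \<open>q + 1 - s\<close> in the matrix of step \<open>s\<close>, less one.\<close>

definition line_weight :: "nat \<Rightarrow> (nat \<Rightarrow> real) \<Rightarrow> real" where
  "line_weight s x = vdm 1 (np s) x * (\<Prod>j\<in>{1..np s}. x j ^ (p - s) * (1 - x j) ^ (q - s))"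

lemma line_weight_pos: "good_line (np s) x \<Longrightarrow> 0 < line_weight s x"
  unfolding line_weight_def
  by (intro mult_pos_pos vdm_pos prod_pos zero_less_power) (auto simp: good_line_def)

text \<open>Only the residues at the nodes 1 and 0 carry powers, and these residues are quotients of
  products of 1 - x and x over the same products for \<open>y\<close>. The Vandermonde product of
  the nodes supplies one more factor 1 - y or y wherever 1 or 0 is a node, and this completes the
  weight of the previous line.\<close>

lemma resid_prod_line_weight:
  assumes s: "s \<in> {1..<p + q}" and y: "good_line (np (s - 1)) y"
  shows "(\<Prod>i\<le>np s. resid (np s) (node s y) x i ^ (card (fiber s i) - 1)) *
      (vdm 1 (np s) x / vdm 0 (np s) (node s y)) = line_weight s x / line_weight (s - 1) y"
    (is "?P * _ = _")
proof -
  \<comment> \<open>Multiplicity less one; it can be nonzero only at the node 1, of index 0, and in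
    the first phase at the node 0, of index \<open>np s\<close>.\<close>
  define c where "c i = (if s \<le> q \<and> i = 0 then q - s else if s \<le> p \<and> i = np s then p - s else 0)" for i
  have Pc: "?P = (\<Prod>i\<le>np s. resid (np s) (node s y) x i ^ c i)"
  proof (intro prod.cong refl)
    fix i assume "i \<in> {..np s}"
    then have "card (fiber s i) - 1 = c i"
      using card_node_index[OF s, of i] by (auto simp: c_def)
    then show "resid (np s) (node s y) x i ^ (card (fiber s i) - 1) =
      resid (np s) (node s y) x i ^ c i" by simp
  qed
  have "(\<Prod>i\<le>np s. resid (np s) (node s y) x i ^ c i) * (vdm 1 (np s) x / vdm 0 (np s) (node s y)) =
      line_weight s x / line_weight (s - 1) y"
    using s
  proof (cases rule: step_cases)
    case first
    let ?a = "node s y"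
    obtain m where m: "s = Suc m" using s by (cases s) auto
    have a: "?a 0 = 1" "?a s = 0" "\<And>k. k \<in> {1..m} \<Longrightarrow> ?a k = y k"
      using first s m by (auto simp: node_def)
    let ?Q = "\<Prod>i\<le>s. resid s ?a x i ^ c i"
    have "?Q = (\<Prod>i\<in>{0, s}. resid s ?a x i ^ c i)"
      using first s by (intro prod.mono_neutral_right) (auto simp: c_def)
    also have "\<dots> = resid s ?a x 0 ^ (q - s) * resid s ?a x s ^ (p - s)"
      using first s by (simp add: c_def)
    also have "resid s ?a x 0 = (\<Prod>j\<in>{1..s}. 1 - x j) / (\<Prod>k\<in>{1..m}. 1 - y k)"
      unfolding resid_first[of "node s y", OF a(1)] using a m by simp
    also have "resid s ?a x s = (\<Prod>j\<in>{1..s}. x j) / (\<Prod>k\<in>{1..m}. y k)"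
    proof -
      have "(\<Prod>k\<in>{0..<s}. ?a k) = ?a 0 * (\<Prod>k\<in>{1..m}. ?a k)"
        unfolding m by (simp add: prod.atLeast_Suc_atMost atLeastLessThanSuc_atLeastAtMost)
      also have "\<dots> = (\<Prod>k\<in>{1..m}. y k)" using a by simp
      finally show ?thesis using resid_last[of ?a s x] a s by simp
    qed
    finally have P: "?Q = ((\<Prod>j\<in>{1..s}. 1 - x j) / (\<Prod>k\<in>{1..m}. 1 - y k)) ^ (q - s) * ((\<Prod>j\<in>{1..s}. x j) / (\<Prod>k\<in>{1..m}. y k)) ^ (p - s)" .
    have "vdm 0 s ?a = (\<Prod>k\<in>{1..s}. 1 - ?a k) * vdm 1 s ?a" unfolding vdm_head a(1) ..
    also have "(\<Prod>k\<in>{1..s}. 1 - ?a k) = (\<Prod>k\<in>{1..m}. 1 - y k)" using a m by simp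
    also have "vdm 1 s ?a = vdm 1 m y * (\<Prod>k\<in>{1..m}. y k)"
    proof -
      have "vdm 1 m ?a = vdm 1 m y" using a by (intro vdm_cong) auto
      then show ?thesis using a unfolding m by (simp add: vdm_Suc)
    qed
    finally have V: "vdm 0 s ?a = (\<Prod>k\<in>{1..m}. 1 - y k) * (vdm 1 m y * (\<Prod>k\<in>{1..m}. y k))" .
    \<comment> \<open>The previous line has both exponents larger by one; the extra factors are
      those found in the node Vandermonde product \<open>V\<close>.\<close>
    have e: "p - m = Suc (p - s)" "q - m = Suc (q - s)" using first m by auto
    have npm: "np s = s" "np (s - 1) = m" using first m by auto
    have L: "line_weight (s - 1) y = vdm 1 m y * ((\<Prod>k\<in>{1..m}. y k) ^ Suc (p - s) * (\<Prod>k\<in>{1..m}. 1 - y k) ^ Suc (q - s))"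
      unfolding line_weight_def npm by (simp add: m e[unfolded m] prod.distrib prod_power_distrib[symmetric])
    have L': "line_weight s x = vdm 1 s x * ((\<Prod>k\<in>{1..s}. x k) ^ (p - s) * (\<Prod>k\<in>{1..s}. 1 - x k) ^ (q - s))"
      unfolding line_weight_def npm by (simp add: prod.distrib prod_power_distrib[symmetric])
    show ?thesis unfolding npm P V L L' by (simp add: power_divide mult_ac)
  next
    case second
    let ?a = "node s y"
    have a: "?a 0 = 1" "\<And>k. k \<in> {1..p} \<Longrightarrow> ?a k = y k"
      using second s by (auto simp: node_def)
    let ?Q = "\<Prod>i\<le>p. resid p ?a x i ^ c i"
    have "?Q = (\<Prod>i\<in>{0}. resid p ?a x i ^ c i)"
      using second s by (intro prod.mono_neutral_right) (auto simp: c_def)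
    also have "\<dots> = resid p ?a x 0 ^ (q - s)"
      using second s by (simp add: c_def)
    also have "resid p ?a x 0 = (\<Prod>j\<in>{1..p}. 1 - x j) / (\<Prod>k\<in>{1..p}. 1 - y k)"
      unfolding resid_first[of "node s y", OF a(1)] using a by simp
    finally have P: "?Q = ((\<Prod>j\<in>{1..p}. 1 - x j) / (\<Prod>k\<in>{1..p}. 1 - y k)) ^ (q - s)" .
    have "vdm 0 p ?a = (\<Prod>k\<in>{1..p}. 1 - ?a k) * vdm 1 p ?a" unfolding vdm_head a(1) ..
    also have "(\<Prod>k\<in>{1..p}. 1 - ?a k) = (\<Prod>k\<in>{1..p}. 1 - y k)" using a by simp
    also have "vdm 1 p ?a = vdm 1 p y" using a by (intro vdm_cong) auto
    finally have V: "vdm 0 p ?a = (\<Prod>k\<in>{1..p}. 1 - y k) * vdm 1 p y" .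
    have e: "p - (s - 1) = 0" "p - s = 0" "q - (s - 1) = Suc (q - s)" using second by auto
    have L: "line_weight (s - 1) y = vdm 1 p y * (\<Prod>k\<in>{1..p}. 1 - y k) ^ Suc (q - s)"
      unfolding line_weight_def second(4) e by (simp add: prod.distrib prod_power_distrib[symmetric])
    have L': "line_weight s x = vdm 1 p x * (\<Prod>k\<in>{1..p}. 1 - x k) ^ (q - s)"
      unfolding line_weight_def second(3) e by (simp add: prod.distrib prod_power_distrib[symmetric])
    show ?thesis unfolding second(3) P V L L' by (simp add: power_divide mult_ac)
  next
    case third
    let ?n = "p + q - s"
    have "(\<Prod>i\<le>?n. resid ?n (node s y) x i ^ c i) = 1" using third s by (intro prod.neutral) (auto simp: c_def)
    \<comment> \<open>Neither 0 nor 1 is a node any more: the nodes are the previous line itself,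
      with indices shifted by one.\<close>
    moreover have "vdm 0 ?n (node s y) = vdm 1 (Suc ?n) y"
      unfolding vdm_shift[symmetric] using third by (intro vdm_cong) (auto simp: node_def)
    moreover have "line_weight (s - 1) y = vdm 1 (Suc ?n) y"
      unfolding line_weight_def third(4) using third by simp
    moreover have "line_weight s x = vdm 1 ?n x"
      unfolding line_weight_def third(3) using third by simp
    ultimately show ?thesis unfolding third(3) by simp
  qed
  then show ?thesis unfolding Pc .
qed

end

section \<open>Interlacing on consecutive lines\<close>

lemma desc_set:
  assumes "sorted_wrt (>) xs" shows "desc (set xs) = xs"
proof -
  have "sorted_wrt (<) (rev xs)" using assms by (simp add: sorted_wrt_rev)
  then have "sorted_list_of_set (set (rev xs)) = rev xs"
    unfolding strict_sorted_iff by (intro sorted_list_of_set.idem_if_sorted_distinct) auto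
  then show ?thesis by (simp add: desc_def)
qed

lemma chi_lists:
  assumes ys: "sorted_wrt (>) ys" and zs: "sorted_wrt (>) zs"
  shows "chi (set ys) (set zs) = (if length zs = length ys + 1 \<and>
    (\<forall>i<length ys. zs ! Suc i < ys ! i \<and> ys ! i < zs ! i) then 1 else 0)"
proof -
  have d: "distinct xs" if "sorted_wrt (>) xs" for xs :: "real list"
    using that by (induction xs) auto
  show ?thesis
    using distinct_card[OF d[OF ys]] distinct_card[OF d[OF zs]] by (simp add: chi_def desc_set[OF ys] desc_set[OF zs])
qed

lemma prod_of_bool_ball:
  "finite A \<Longrightarrow> (\<Prod>t\<in>A. if P t then 1 else 0 :: real) = (if \<forall>t\<in>A. P t then 1 else 0)"
  by (induction A rule: finite_induct) auto

lemma good_line_sorted: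
  assumes "good_line k y" shows "sorted_wrt (>) (map y [1..<k + 1])"
proof -
  have l: "y j < y i" if "1 \<le> i" "i < j" "j \<le> k" for i j
    using that(2,3)
  proof (induction j)
    case (Suc j)
    then show ?case using assms that(1) by (cases "i = j") (auto simp: good_line_def intro: less_trans)
  qed simp
  show ?thesis unfolding sorted_wrt_map
    using sorted_wrt_upt[of 1 "k + 1"]
  proof (rule sorted_wrt_mono_rel[rotated])
    fix i j assume "i \<in> set [1..<k + 1]" "j \<in> set [1..<k + 1]" "i < j"
    then show "y j < y i" by (intro l) auto
  qed
qed

context bead_params
begin

definition line_list :: "(nat \<times> nat \<Rightarrow> real) \<Rightarrow> nat \<Rightarrow> real list" where
  "line_list x t = map (\<lambda>j. x (t, j)) [1..<np t + 1]"

lemma set_line_list: "set (line_list x t) = line p q x t"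
  by (auto simp: line_list_def line_def image_iff)

lemma length_line_list [simp]: "length (line_list x t) = np t"
  by (simp add: line_list_def)

lemma line_list_nth: "i < np t \<Longrightarrow> line_list x t ! i = x (t, Suc i)"
  by (simp add: line_list_def del: upt_Suc)

text \<open>The outer set of the \<open>chi\<close> factor whose inner set is line
  \<open>s - 1\<close>; it lets the three phases share one formula.\<close>

definition upper :: "(nat \<times> nat \<Rightarrow> real) \<Rightarrow> nat \<Rightarrow> real set" where
  "upper x s = (if s \<le> p then line p q x s else if s \<le> q then line p q x s \<union> {0} else line p q x s \<union> {0, 1})"

abbreviation good :: "(nat \<times> nat \<Rightarrow> real) \<Rightarrow> nat \<Rightarrow> bool" where
  "good x t \<equiv> good_line (np t) (\<lambda>j. x (t, j))"

text \<open>Interlacing as one matrix step produces it: the new line fills the gaps of the nodes,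
  whereas \<open>chi\<close> puts the old line into the gaps of the completed new one.\<close>

definition step :: "(nat \<times> nat \<Rightarrow> real) \<Rightarrow> nat \<Rightarrow> bool" where
  "step x s \<longleftrightarrow> interlaced (np s) (node s (\<lambda>j. x (s - 1, j))) (\<lambda>j. x (s, j))"

lemma sorted_line_list:
  assumes "good x t"
  shows "sorted_wrt (>) (line_list x t)" "sorted_wrt (>) (line_list x t @ [0])"
    "sorted_wrt (>) (1 # line_list x t @ [0])"
proof -
  show 1: "sorted_wrt (>) (line_list x t)" unfolding line_list_def by (rule good_line_sorted[OF assms])
  have b: "0 < z \<and> z < 1" if "z \<in> set (line_list x t)" for z
    using that assms by (auto simp: line_list_def good_line_def simp del: upt_Suc)
  show 2: "sorted_wrt (>) (line_list x t @ [0])" using 1 b by (auto simp: sorted_wrt_append)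
  show "sorted_wrt (>) (1 # line_list x t @ [0])" using 2 b by auto
qed

text \<open>The two descriptions share all comparisons between particles and differ only in
  comparisons with 0 and 1. \<open>step\<close> has them where 0 and 1 are nodes, \<open>chi\<close>
  where they are adjoined to the later line, and the \<open>good\<close> hypotheses supply whichever
  are missing.\<close>

lemma chi_step:
  assumes s: "s \<in> {2..<p + q}" and g: "good x (s - 1)" "good x s"
  shows "chi (line p q x (s - 1)) (upper x s) = (if step x s then 1 else 0)"
proof -
  have s': "s \<in> {1..<p + q}" using s by auto
  let ?y = "\<lambda>j. x (s - 1, j)" and ?u = "\<lambda>j. x (s, j)"
  have ub: "0 < ?u j" "?u j < 1" if "1 \<le> j" "j \<le> np s" for j using g(2) that by (auto simp: good_line_def)
  note L = set_line_list[symmetric]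
  show ?thesis using s'
  proof (cases rule: step_cases)
    case first
    obtain m where m: "s = Suc m" using s' by (cases s) auto
    have npm: "np (s - 1) = m" "np s = Suc m" using first m by auto
    have "chi (line p q x (s - 1)) (upper x s) = chi (set (line_list x (s - 1))) (set (line_list x s))"
      using first by (simp add: upper_def L)
    also have "\<dots> = (if (\<forall>i<m. ?u (Suc (Suc i)) < ?y (Suc i) \<and> ?y (Suc i) < ?u (Suc i)) then 1 else 0)"
      unfolding chi_lists[OF sorted_line_list(1)[OF g(1)] sorted_line_list(1)[OF g(2)]] length_line_list npm
      using npm by (auto simp: line_list_nth)
    also have "(\<forall>i<m. ?u (Suc (Suc i)) < ?y (Suc i) \<and> ?y (Suc i) < ?u (Suc i)) \<longleftrightarrow> step x s"
    proof
      assume H: "\<forall>i<m. ?u (Suc (Suc i)) < ?y (Suc i) \<and> ?y (Suc i) < ?u (Suc i)"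
      show "step x s" unfolding step_def interlaced_def
      proof
        fix j assume j: "j \<in> {1..np s}"
        have "node s ?y j < ?u j"
          using H[rule_format, of "j - 1"] ub[of j] j npm first by (cases "j \<le> m") (auto simp: node_def)
        moreover have "?u j < node s ?y (j - 1)"
          using H[rule_format, of "j - 2"] ub[of j] j npm first by (cases "j = 1") (auto simp: node_def Suc_diff_Suc numeral_2_eq_2)
        ultimately show "node s ?y j < ?u j \<and> ?u j < node s ?y (j - 1)" ..
      qed
    next
      assume H: "step x s"
      show "\<forall>i<m. ?u (Suc (Suc i)) < ?y (Suc i) \<and> ?y (Suc i) < ?u (Suc i)"
      proof safe
        fix i assume i: "i < m"
        show "?u (Suc (Suc i)) < ?y (Suc i)"
          using H[unfolded step_def interlaced_def, rule_format, of "Suc (Suc i)"] i npm first by (auto simp: node_def)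
        show "?y (Suc i) < ?u (Suc i)"
          using H[unfolded step_def interlaced_def, rule_format, of "Suc i"] i npm first by (auto simp: node_def)
      qed
    qed
    finally show ?thesis .
  next
    case second
    have "chi (line p q x (s - 1)) (upper x s) = chi (set (line_list x (s - 1))) (set (line_list x s @ [0]))"
      using second by (simp add: upper_def L)
    also have "\<dots> = (if (\<forall>i<p. (line_list x s @ [0]) ! Suc i < ?y (Suc i) \<and> ?y (Suc i) < ?u (Suc i)) then 1 else 0)"
      unfolding chi_lists[OF sorted_line_list(1)[OF g(1)] sorted_line_list(2)[OF g(2)]] 
      using second by (auto simp: line_list_nth nth_append)
    also have "(\<forall>i<p. (line_list x s @ [0]) ! Suc i < ?y (Suc i) \<and> ?y (Suc i) < ?u (Suc i)) \<longleftrightarrow> step x s"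
    proof
      assume H: "\<forall>i<p. (line_list x s @ [0]) ! Suc i < ?y (Suc i) \<and> ?y (Suc i) < ?u (Suc i)"
      show "step x s" unfolding step_def interlaced_def
      proof
        fix j assume j: "j \<in> {1..np s}"
        have "node s ?y j < ?u j"
          using H[rule_format, of "j - 1"] j second by (auto simp: node_def)
        moreover have "?u j < node s ?y (j - 1)"
        proof (cases "j = 1")
          case True
          then show ?thesis using ub[of 1] j second by (simp add: node_def)
        next
          case False
          define i where "i = j - 2"
          have i: "j = Suc (Suc i)" using False j by (auto simp: i_def)
          then show ?thesis using H[rule_format, of i] j second by (simp add: node_def nth_append line_list_nth)
        qed
        ultimately show "node s ?y j < ?u j \<and> ?u j < node s ?y (j - 1)" ..
      qed
    next
      assume H: "step x s"
      show "\<forall>i<p. (line_list x s @ [0]) ! Suc i < ?y (Suc i) \<and> ?y (Suc i) < ?u (Suc i)"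
      proof safe
        fix i assume i: "i < p"
        have "0 < ?y (Suc i)" using g(1) i second by (auto simp: good_line_def)
        then show "(line_list x s @ [0]) ! Suc i < ?y (Suc i)"
          using H[unfolded step_def interlaced_def, rule_format, of "Suc (Suc i)"] i second
          by (cases "Suc i < p") (auto simp: node_def nth_append line_list_nth)
        show "?y (Suc i) < ?u (Suc i)"
          using H[unfolded step_def interlaced_def, rule_format, of "Suc i"] i second by (auto simp: node_def)
      qed
    qed
    finally show ?thesis .
  next
    case third
    define n where "n = np s"
    have npn: "np s = n" "np (s - 1) = Suc n" using third by (auto simp: n_def)
    have "chi (line p q x (s - 1)) (upper x s) = chi (set (line_list x (s - 1))) (set (1 # line_list x s @ [0]))"
      using third by (simp add: upper_def L insert_commute)
    also have "\<dots> = (if (\<forall>i<Suc n. (line_list x s @ [0]) ! i < ?y (Suc i) \<and> ?y (Suc i) < (1 # line_list x s) ! i) then 1 else 0)"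
    proof -
      let ?L = "line_list x s" and ?K = "line_list x (s - 1)"
      have e: "(1 # ?L @ [0]) ! Suc i = (?L @ [0]) ! i" "(1 # ?L @ [0]) ! i = (1 # ?L) ! i" "?K ! i = ?y (Suc i)"
        if "i < Suc n" for i
        using that npn nth_append[of "1 # ?L" "[0]" i] by (simp_all add: line_list_nth)
      have "(\<forall>i<Suc n. (1 # ?L @ [0]) ! Suc i < ?K ! i \<and> ?K ! i < (1 # ?L @ [0]) ! i) \<longleftrightarrow>
          (\<forall>i<Suc n. (?L @ [0]) ! i < ?y (Suc i) \<and> ?y (Suc i) < (1 # ?L) ! i)"
        by (intro all_cong) (simp only: e)
      moreover have "length (1 # ?L @ [0]) = length ?K + 1" "length ?K = Suc n" using npn by simp_all
      ultimately show ?thesis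
        unfolding chi_lists[OF sorted_line_list(1)[OF g(1)] sorted_line_list(3)[OF g(2)]] by (simp only: simp_thms)
    qed
    also have "(\<forall>i<Suc n. (line_list x s @ [0]) ! i < ?y (Suc i) \<and> ?y (Suc i) < (1 # line_list x s) ! i) \<longleftrightarrow> step x s"
    proof
      assume H: "\<forall>i<Suc n. (line_list x s @ [0]) ! i < ?y (Suc i) \<and> ?y (Suc i) < (1 # line_list x s) ! i"
      show "step x s" unfolding step_def interlaced_def
      proof
        fix j assume j: "j \<in> {1..np s}"
        obtain i where i: "j = Suc i" "i < n" using j npn by (cases j) auto
        have "node s ?y j < ?u j"
          using H[rule_format, of "Suc i"] i npn third(2) by (simp add: node_def line_list_nth)
        moreover have "?u j < node s ?y (j - 1)"
          using H[rule_format, of i] i npn third(2) by (simp add: node_def line_list_nth nth_append)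
        ultimately show "node s ?y j < ?u j \<and> ?u j < node s ?y (j - 1)" ..
      qed
    next
      assume H: "step x s"
      show "\<forall>i<Suc n. (line_list x s @ [0]) ! i < ?y (Suc i) \<and> ?y (Suc i) < (1 # line_list x s) ! i"
      proof safe
        fix i assume i: "i < Suc n"
        have y: "0 < ?y (Suc i)" "?y (Suc i) < 1" using g(1) i npn by (auto simp: good_line_def)
        show "(line_list x s @ [0]) ! i < ?y (Suc i)"
          using H[unfolded step_def interlaced_def, rule_format, of "Suc i"] i y npn third(2)
          by (cases "i < n") (auto simp: node_def nth_append line_list_nth)
        show "?y (Suc i) < (1 # line_list x s) ! i"
          using H[unfolded step_def interlaced_def, rule_format, of i] i y npn third(2)
          by (cases i) (auto simp: node_def line_list_nth)
      qed
    qed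
    finally show ?thesis .
  qed
qed

definition chain :: "nat \<Rightarrow> (nat \<times> nat \<Rightarrow> real) \<Rightarrow> bool" where
  "chain s x \<longleftrightarrow> (\<forall>t\<in>{1..s}. step x t)"

lemma good_0: "good x 0"
  by (simp add: good_line_def num_part_def)

lemma chain_good:
  assumes "chain s x" "s < p + q" shows "good x s"
  using assms
proof (induction s)
  case 0
  show ?case by (rule good_0)
next
  case (Suc s)
  have "chain s x" using Suc.prems by (auto simp: chain_def)
  then have "good x s" using Suc by simp
  moreover have "step x (Suc s)" using Suc.prems by (auto simp: chain_def)
  ultimately show ?case
    using good_line_interlaced[of "Suc s" "\<lambda>j. x (s, j)"] Suc.prems(2) by (simp add: step_def)
qed

lemma admissible_iff_good: "admissible p q x \<longleftrightarrow> (\<forall>t\<in>{1..<p + q}. good x t)"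
  by (auto simp: admissible_def good_line_def)

text \<open>Step 1 only says that the single particle lies between the nodes 0 and 1, which
  admissibility already contains; this is why the first line has no \<open>chi\<close> factor of its
  own.\<close>

lemma chain_iff: "chain (p + q - 1) x \<longleftrightarrow> admissible p q x \<and> (\<forall>s\<in>{2..<p + q}. step x s)"
proof
  assume c: "chain (p + q - 1) x"
  have "good x t" if "t \<in> {1..<p + q}" for t
    using that c by (intro chain_good) (auto simp: chain_def)
  moreover have "step x s" if "s \<in> {2..<p + q}" for s
    using that c by (auto simp: chain_def)
  ultimately show "admissible p q x \<and> (\<forall>s\<in>{2..<p + q}. step x s)"
    by (simp add: admissible_iff_good)
next
  assume a: "admissible p q x \<and> (\<forall>s\<in>{2..<p + q}. step x s)"
  then have "good x 1" using p1 pq by (auto simp: admissible_iff_good)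
  then have "step x 1" using p1 pq
    by (auto simp: step_def interlaced_def node_def good_line_def num_part_def)
  show "chain (p + q - 1) x" unfolding chain_def
  proof
    fix t assume "t \<in> {1..p + q - 1}"
    then show "step x t" using a \<open>step x 1\<close> by (cases "t = 1") auto
  qed
qed

text \<open>One particle between 0 and 1: the last factor of the bead weight, with an empty outer
  line, is constant.\<close>

lemma chi_final:
  assumes "admissible p q x"
  shows "chi (line p q x (p + q - 1)) (line p q x (p + q) \<union> {0, 1}) = 1"
proof -
  let ?t = "p + q - 1"
  have np: "np (p + q) = 0" "np ?t = 1" using p1 pq by (auto simp: num_part_def)
  have g: "good x ?t" using assms p1 pq by (auto simp: admissible_iff_good)
  then have b: "0 < x (?t, 1)" "x (?t, 1) < 1" unfolding good_line_def np by auto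
  have "line p q x (p + q) \<union> {0, 1} = set [1, 0]" using np by (auto simp: line_def)
  moreover have "line p q x ?t = set [x (?t, 1)]" using np by (simp add: line_def)
  moreover have "chi (set [x (?t, 1)]) (set [1, 0]) = 1"
    using b by (subst chi_lists) auto
  ultimately show ?thesis by simp
qed

lemma bead_weight_eq: "bead_weight p q x = (if chain (p + q - 1) x then 1 else 0)"
proof (cases "admissible p q x")
  case True
  have c: "chi (line p q x t) (upper x (t + 1)) = (if step x (t + 1) then 1 else 0)" if "t \<in> {1..<p + q - 1}" for t
  proof -
    have "t + 1 \<in> {2..<p + q}" "good x (t + 1 - 1)" "good x (t + 1)"
      using that True by (auto simp: admissible_iff_good)
    from chi_step[OF this] show ?thesis by simp
  qed
  have 1: "(\<Prod>t\<in>{1..<p}. chi (line p q x t) (line p q x (t + 1))) = (\<Prod>t\<in>{1..<p}. if step x (t + 1) then 1 else 0)"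
  proof (intro prod.cong refl)
    fix t assume t: "t \<in> {1..<p}"
    then have "t \<in> {1..<p + q - 1}" using p1 pq by auto
    from c[OF this] t show "chi (line p q x t) (line p q x (t + 1)) = (if step x (t + 1) then 1 else 0)"
      by (simp add: upper_def)
  qed
  have 2: "(\<Prod>t\<in>{p..<q}. chi (line p q x t) (line p q x (t + 1) \<union> {0})) = (\<Prod>t\<in>{p..<q}. if step x (t + 1) then 1 else 0)"
  proof (intro prod.cong refl)
    fix t assume t: "t \<in> {p..<q}"
    then have "t \<in> {1..<p + q - 1}" using p1 pq by auto
    from c[OF this] t show "chi (line p q x t) (line p q x (t + 1) \<union> {0}) = (if step x (t + 1) then 1 else 0)"
      by (simp add: upper_def)
  qed
  \<comment> \<open>The factor at \<open>t = p + q - 1\<close> has no matrix step behind it and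
    equals 1 by \<open>chi_final\<close>.\<close>
  have 3: "(\<Prod>t\<in>{q..<p + q}. chi (line p q x t) (line p q x (t + 1) \<union> {0, 1})) =
      (\<Prod>t\<in>{q..<p + q}. if t = p + q - 1 \<or> step x (t + 1) then 1 else 0)"
  proof (intro prod.cong refl)
    fix t assume t: "t \<in> {q..<p + q}"
    show "chi (line p q x t) (line p q x (t + 1) \<union> {0, 1}) = (if t = p + q - 1 \<or> step x (t + 1) then 1 else 0)"
    proof (cases "t = p + q - 1")
      case True
      then show ?thesis using chi_final[OF \<open>admissible p q x\<close>] p1 by simp
    next
      case False
      then have "t \<in> {1..<p + q - 1}" using t p1 pq by auto
      from c[OF this] t pq False show ?thesis by (simp add: upper_def)
    qed
  qed
  have "(\<forall>t\<in>{1..<p}. step x (t + 1)) \<and> (\<forall>t\<in>{p..<q}. step x (t + 1)) \<and>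
      (\<forall>t\<in>{q..<p + q}. t = p + q - 1 \<or> step x (t + 1)) \<longleftrightarrow> (\<forall>s\<in>{2..<p + q}. step x s)" (is "?l \<longleftrightarrow> ?r")
  proof
    assume l: ?l
    show ?r
    proof
      fix s assume s: "s \<in> {2..<p + q}"
      then have e: "s = (s - 1) + 1" by auto
      consider "s - 1 \<in> {1..<p}" | "s - 1 \<in> {p..<q}" | "s - 1 \<in> {q..<p + q}" "s - 1 \<noteq> p + q - 1" using s by force
      then have "step x ((s - 1) + 1)" using l by cases blast+
      then show "step x s" using e by simp
    qed
  next
    assume r: ?r
    then have "step x (t + 1)" if "1 \<le> t" "t + 1 < p + q" for t using that by auto
    moreover have "t = p + q - 1 \<or> t + 1 < p + q" if "t < p + q" for t using that by auto
    ultimately show ?l using p1 pq by (intro conjI ballI) fastforce+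
  qed
  then show ?thesis
    unfolding bead_weight_def 1 2 3 chain_iff using True by (auto simp: prod_of_bool_ball)
next
  case False
  then show ?thesis unfolding bead_weight_def chain_iff by simp
qed

text \<open>The products of the bead weight reindexed by the later line, with the constant last
  factor gone; both weights are the indicator of \<open>chain\<close>.\<close>

lemma chi_products_eq:
  "(if admissible p q x then
      (\<Prod>r\<in>{2..p}. chi (line p q x (r - 1)) (line p q x r)) *
      (\<Prod>r\<in>{p + 1..q}. chi (line p q x (r - 1)) (line p q x r \<union> {0})) *
      (\<Prod>r\<in>{q + 1..p + q - 1}. chi (line p q x (r - 1)) (line p q x r \<union> {0, 1}))
    else 0) = (if chain (p + q - 1) x then 1 else 0)"
proof (cases "admissible p q x")
  case True
  have c: "chi (line p q x (s - 1)) (upper x s) = (if step x s then 1 else 0)" if "s \<in> {2..<p + q}" for s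
  proof (rule chi_step[OF that])
    have "s - 1 \<in> {1..<p + q}" "s \<in> {1..<p + q}" using that by auto
    then show "good x (s - 1)" "good x s" using True unfolding admissible_iff_good by blast+
  qed
  have 1: "(\<Prod>r\<in>{2..p}. chi (line p q x (r - 1)) (line p q x r)) = (\<Prod>r\<in>{2..p}. if step x r then 1 else 0)"
  proof (intro prod.cong refl)
    fix r assume r: "r \<in> {2..p}"
    then have "r \<in> {2..<p + q}" using p1 pq by auto
    from c[OF this] r show "chi (line p q x (r - 1)) (line p q x r) = (if step x r then 1 else 0)"
      by (simp add: upper_def)
  qed
  have 2: "(\<Prod>r\<in>{p + 1..q}. chi (line p q x (r - 1)) (line p q x r \<union> {0})) = (\<Prod>r\<in>{p + 1..q}. if step x r then 1 else 0)"
  proof (intro prod.cong refl)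
    fix r assume r: "r \<in> {p + 1..q}"
    then have "r \<in> {2..<p + q}" using p1 by auto
    from c[OF this] r show "chi (line p q x (r - 1)) (line p q x r \<union> {0}) = (if step x r then 1 else 0)"
      by (simp add: upper_def)
  qed
  have 3: "(\<Prod>r\<in>{q + 1..p + q - 1}. chi (line p q x (r - 1)) (line p q x r \<union> {0, 1})) = (\<Prod>r\<in>{q + 1..p + q - 1}. if step x r then 1 else 0)"
  proof (intro prod.cong refl)
    fix r assume r: "r \<in> {q + 1..p + q - 1}"
    then have "r \<in> {2..<p + q}" using p1 pq by auto
    from c[OF this] r pq show "chi (line p q x (r - 1)) (line p q x r \<union> {0, 1}) = (if step x r then 1 else 0)"
      by (simp add: upper_def)
  qed
  have "{2..<p + q} = {2..p} \<union> {p + 1..q} \<union> {q + 1..p + q - 1}" using p1 pq by auto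
  then have "(\<forall>s\<in>{2..<p + q}. step x s) \<longleftrightarrow> (\<forall>r\<in>{2..p}. step x r) \<and> (\<forall>r\<in>{p + 1..q}. step x r) \<and> (\<forall>r\<in>{q + 1..p + q - 1}. step x r)"
    by (simp only: ball_Un conj_assoc)
  then show ?thesis
    unfolding 1 2 3 chain_iff using True by (simp add: prod_of_bool_ball)
next
  case False
  then show ?thesis unfolding chain_iff by simp
qed

end

section \<open>The joint law of all lines\<close>

lemma normalized_vec_cong:
  "(\<And>i. i < n \<Longrightarrow> g i = h i) \<Longrightarrow> normalized_vec n g = normalized_vec n h"
  by (auto simp: normalized_vec_def intro!: eq_vecI)

lemma interlaced_cong:
  assumes "\<And>i. i \<le> n \<Longrightarrow> a i = b i" "\<And>j. j \<in> {1..n} \<Longrightarrow> x j = y j"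
  shows "interlaced n a x \<longleftrightarrow> interlaced n b y"
  unfolding interlaced_def
proof (intro ball_cong refl)
  fix j assume "j \<in> {1..n}"
  then have "j \<le> n" "j - 1 \<le> n" "j \<in> {1..n}" by auto
  then show "(a j < x j \<and> x j < a (j - 1)) = (b j < y j \<and> y j < b (j - 1))" by (simp only: assms)
qed

text \<open>Relabelling of coordinates: one line is integrated with indices 1 to \<open>n\<close>,
  while configurations are indexed by pairs.\<close>

lemma distr_PiM_pair_index:
  fixes s n :: nat
  shows "distr (lborel_PiM {1..n}) (lborel_PiM ({s} \<times> {1..n})) (\<lambda>u. \<lambda>k\<in>{s} \<times> {1..n}. u (snd k)) =
    (lborel_PiM ({s} \<times> {1..n}))"
proof (rule lborel_prod.PiM_eqI)
  let ?J = "{s} \<times> {1..n}" and ?PU = "lborel_PiM {1..n}"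
  fix A :: "nat \<times> nat \<Rightarrow> real set" assume A: "\<And>k. k \<in> ?J \<Longrightarrow> A k \<in> sets lborel"
  have m: "(\<lambda>u. \<lambda>k\<in>?J. u (snd k)) \<in> measurable ?PU (lborel_PiM ?J)"
    by (intro measurable_restrict measurable_component_singleton) auto
  have "(\<lambda>u. \<lambda>k\<in>?J. u (snd k)) -` Pi\<^sub>E ?J A \<inter> space ?PU = Pi\<^sub>E {1..n} (\<lambda>j. A (s, j))"
    by (auto simp: space_PiM PiE_def Pi_def)
  then have "emeasure (distr ?PU (lborel_PiM ?J) (\<lambda>u. \<lambda>k\<in>?J. u (snd k))) (Pi\<^sub>E ?J A) =
      emeasure ?PU (Pi\<^sub>E {1..n} (\<lambda>j. A (s, j)))"
    using A by (subst emeasure_distr[OF m]) (auto intro!: sets_PiM_I_finite)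
  also have "\<dots> = (\<Prod>j\<in>{1..n}. emeasure lborel (A (s, j)))"
    using A by (intro lborel_prod.emeasure_PiM) auto
  also have "\<dots> = (\<Prod>k\<in>?J. emeasure lborel (A k))"
    by (rule prod.reindex_bij_witness[where i = snd and j = "\<lambda>j. (s, j)"]) auto
  finally show "emeasure (distr ?PU (lborel_PiM ?J) (\<lambda>u. \<lambda>k\<in>?J. u (snd k))) (Pi\<^sub>E ?J A) =
      (\<Prod>k\<in>?J. emeasure lborel (A k))" .
qed auto

section \<open>Adding one line to a configuration\<close>

context bead_params
begin

definition idx :: "nat \<Rightarrow> (nat \<times> nat) set" where
  "idx s = (SIGMA t:{1..s}. {1..np t})"

abbreviation PI :: "nat \<Rightarrow> (nat \<times> nat \<Rightarrow> real) measure" where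
  "PI s \<equiv> lborel_PiM (idx s)"

lemma finite_idx [simp]: "finite (idx s)"
  by (simp add: idx_def)

lemma idx_Suc: "idx (Suc s) = idx s \<union> {Suc s} \<times> {1..np (Suc s)}"
  by (auto simp: idx_def le_Suc_eq)

lemma idx_component:
  assumes "t \<le> s" "j \<in> {1..np t}" shows "(t, j) \<in> idx s"
  using assms by (cases "t = 0") (auto simp: idx_def num_part_def)

lemma measurable_component:
  "t \<le> s \<Longrightarrow> j \<in> {1..np t} \<Longrightarrow> (\<lambda>x. x (t, j)) \<in> borel_measurable (PI s)"
  using measurable_component_singleton[OF idx_component, of t s j "\<lambda>_. lborel :: real measure"] by simp

lemma node_index_le: "s \<in> {1..<p + q} \<Longrightarrow> k < A_size p q s \<Longrightarrow> node_index s k \<le> np s"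
  by (erule step_cases) (auto simp: node_index_def)

lemma node_cong:
  assumes s: "s \<in> {1..<p + q}" and i: "i \<le> np s" and y: "\<And>j. j \<in> {1..np (s - 1)} \<Longrightarrow> y j = z j"
  shows "node s y i = node s z i"
proof (cases "s \<le> q")
  case True
  then show ?thesis using y[of i] by (auto simp: node_def)
next
  case False
  then have "Suc i \<le> np (s - 1)" using i by (cases rule: step_cases[OF s]) auto
  then show ?thesis using y[of "Suc i"] False by (simp add: node_def)
qed

lemma measurable_node:
  assumes t: "t \<le> Suc s" "t \<in> {1..<p + q}" and i: "i \<le> np t"
  shows "(\<lambda>x. node t (\<lambda>j. x (t - 1, j)) i) \<in> borel_measurable (PI s)"
proof (cases "t \<le> q")
  case True
  show ?thesis
  proof (cases "1 \<le> i \<and> i \<le> np (t - 1)")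
    case True': True
    then have "(\<lambda>x. x (t - 1, i)) \<in> borel_measurable (PI s)" using t by (intro measurable_component) auto
    then show ?thesis using True True' by (simp add: node_def)
  next
    case False
    then show ?thesis using True by (auto simp: node_def)
  qed
next
  case False
  then have "Suc i \<le> np (t - 1)" using i by (cases rule: step_cases[OF t(2)]) auto
  then have "(\<lambda>x. x (t - 1, Suc i)) \<in> borel_measurable (PI s)" using t by (intro measurable_component) auto
  then show ?thesis using False by (simp add: node_def)
qed

lemma step_cong:
  assumes t: "t \<in> {1..<p + q}" "t \<le> s" and x: "\<And>k. k \<in> idx s \<Longrightarrow> x k = y k"
  shows "step x t \<longleftrightarrow> step y t"
  unfolding step_def
proof (rule interlaced_cong)
  fix i assume i: "i \<le> np t"
  show "node t (\<lambda>j. x (t - 1, j)) i = node t (\<lambda>j. y (t - 1, j)) i"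
    using t by (intro node_cong i x idx_component) auto
next
  fix j assume "j \<in> {1..np t}"
  then show "x (t, j) = y (t, j)" using t by (intro x idx_component) auto
qed

lemma chain_Suc: "chain (Suc s) x \<longleftrightarrow> chain s x \<and> step x (Suc s)"
proof -
  have "{1..Suc s} = insert (Suc s) {1..s}" by auto
  then show ?thesis unfolding chain_def by auto
qed

lemma chain_cong:
  assumes "s < p + q" "\<And>k. k \<in> idx s \<Longrightarrow> x k = y k"
  shows "chain s x \<longleftrightarrow> chain s y"
  unfolding chain_def using assms step_cong[of _ s x y] by auto

lemma measurable_step:
  assumes t: "t \<in> {1..<p + q}" "t \<le> s"
  shows "Measurable.pred (PI s) (\<lambda>x. step x t)"
  unfolding step_def interlaced_def
proof (intro pred_intros_finite pred_intros_logic)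
  fix j assume j: "j \<in> {1..np t}"
  have [measurable]: "(\<lambda>x. x (t, j)) \<in> borel_measurable (PI s)"
    using t j by (intro measurable_component) auto
  have [measurable]: "(\<lambda>x. node t (\<lambda>j. x (t - 1, j)) j) \<in> borel_measurable (PI s)"
    "(\<lambda>x. node t (\<lambda>j. x (t - 1, j)) (j - 1)) \<in> borel_measurable (PI s)"
    using t j by (intro measurable_node; auto)+
  show "Measurable.pred (PI s) (\<lambda>x. node t (\<lambda>j. x (t - 1, j)) j < x (t, j))"
    "Measurable.pred (PI s) (\<lambda>x. x (t, j) < node t (\<lambda>j. x (t - 1, j)) (j - 1))"
    by measurable
qed simp

lemma measurable_chain: "s < p + q \<Longrightarrow> Measurable.pred (PI s) (chain s)"
  unfolding chain_def[abs_def] by (intro pred_intros_finite measurable_step) auto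

lemma line_weight_cong:
  assumes "\<And>j. j \<in> {1..np s} \<Longrightarrow> x j = y j" shows "line_weight s x = line_weight s y"
  unfolding line_weight_def using assms vdm_cong[of 1 "np s" x y] by (auto intro!: prod.cong)

lemma measurable_line_weight: "(\<lambda>x. line_weight s (\<lambda>j. x (s, j))) \<in> borel_measurable (PI s)"
proof -
  have c: "(\<lambda>x. x (s, j)) \<in> borel_measurable (PI s)" if "j \<in> {1..np s}" for j
    using that by (intro measurable_component) auto
  have "(\<lambda>x. \<lambda>j\<in>{1..np s}. x (s, j)) \<in> measurable (PI s) (lborel_PiM {1..np s})"
    using c by (intro measurable_restrict) simp
  from measurable_compose[OF this measurable_vdm]
  have "(\<lambda>x. vdm 1 (np s) (\<lambda>j\<in>{1..np s}. x (s, j))) \<in> borel_measurable (PI s)" .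
  moreover have "vdm 1 (np s) (\<lambda>j\<in>{1..np s}. x (s, j)) = vdm 1 (np s) (\<lambda>j. x (s, j))" for x :: "nat \<times> nat \<Rightarrow> real"
    by (rule vdm_cong) simp
  ultimately have "(\<lambda>x. vdm 1 (np s) (\<lambda>j. x (s, j))) \<in> borel_measurable (PI s)" by simp
  then show ?thesis unfolding line_weight_def using c
    by (intro borel_measurable_times borel_measurable_prod borel_measurable_power borel_measurable_diff borel_measurable_const) auto
qed

definition new_eigs :: "nat \<Rightarrow> (nat \<times> nat \<Rightarrow> real) \<Rightarrow> (nat \<Rightarrow> complex) \<Rightarrow> real list" where
  "new_eigs s x z = eigenvalues_outside (excluded (Suc s))
     (compress (A_size p q (Suc s)) z (diag_entries (Suc s) (map (\<lambda>j. x (s, j)) [1..<np s + 1])))"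

definition join :: "nat \<Rightarrow> (nat \<times> nat \<Rightarrow> real) \<Rightarrow> (nat \<Rightarrow> real) \<Rightarrow> nat \<times> nat \<Rightarrow> real" where
  "join s x u = (\<lambda>k\<in>idx (Suc s). if k \<in> idx s then x k else u (snd k))"

definition step_map :: "nat \<Rightarrow> (nat \<times> nat \<Rightarrow> real) \<Rightarrow> (nat \<Rightarrow> complex) \<Rightarrow> nat \<times> nat \<Rightarrow> real" where
  "step_map s x z = join s x (entry (new_eigs s x z))"

lemma join_index: "k \<in> idx s \<Longrightarrow> join s x u k = x k" "j \<in> {1..np (Suc s)} \<Longrightarrow> join s x u (Suc s, j) = u j"
proof -
  show "k \<in> idx s \<Longrightarrow> join s x u k = x k" by (auto simp: join_def idx_Suc)
  assume "j \<in> {1..np (Suc s)}"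
  then have "(Suc s, j) \<in> idx (Suc s)" "(Suc s, j) \<notin> idx s" by (auto simp: idx_def)
  then show "join s x u (Suc s, j) = u j" by (simp add: join_def)
qed

lemma join_cong:
  assumes "\<And>j. j \<in> {1..np (Suc s)} \<Longrightarrow> u j = v j" shows "join s x u = join s x v"
  unfolding join_def using assms by (intro restrict_ext) (auto simp: idx_Suc)

lemma nn_integral_join:
  assumes H: "H \<in> borel_measurable (PI (Suc s))"
  shows "(\<integral>\<^sup>+x. \<integral>\<^sup>+u. H (join s x u) \<partial>(lborel_PiM {1..np (Suc s)}) \<partial>PI s) = (\<integral>\<^sup>+x. H x \<partial>PI (Suc s))"
proof -
  let ?J = "{Suc s} \<times> {1..np (Suc s)}" and ?PU = "lborel_PiM {1..np (Suc s)}"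
  have disj: "idx s \<inter> ?J = {}" by (auto simp: idx_def)
  have H': "H \<in> borel_measurable (lborel_PiM (idx s \<union> ?J))" using H by (simp add: idx_Suc)
  have m: "(\<lambda>u. \<lambda>k\<in>?J. u (snd k)) \<in> measurable ?PU (lborel_PiM ?J)"
    by (intro measurable_restrict measurable_component_singleton) auto
  have "(\<integral>\<^sup>+x. H x \<partial>PI (Suc s)) = (\<integral>\<^sup>+x. \<integral>\<^sup>+y. H (merge (idx s) ?J (x, y)) \<partial>(lborel_PiM ?J) \<partial>PI s)"
    unfolding idx_Suc by (rule lborel_prod.product_nn_integral_fold[OF disj _ _ H']) auto
  also have "\<dots> = (\<integral>\<^sup>+x. \<integral>\<^sup>+u. H (join s x u) \<partial>?PU \<partial>PI s)"
  proof (rule nn_integral_cong)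
    fix x assume x: "x \<in> space (PI s)"
    have mm: "(\<lambda>y. H (merge (idx s) ?J (x, y))) \<in> borel_measurable (lborel_PiM ?J)"
      using measurable_compose[OF measurable_Pair1'[OF x] measurable_compose[OF measurable_merge H']] .
    have "(\<integral>\<^sup>+y. H (merge (idx s) ?J (x, y)) \<partial>(lborel_PiM ?J)) =
        (\<integral>\<^sup>+y. H (merge (idx s) ?J (x, y)) \<partial>distr ?PU (lborel_PiM ?J) (\<lambda>u. \<lambda>k\<in>?J. u (snd k)))"
      by (simp only: distr_PiM_pair_index)
    also have "\<dots> = (\<integral>\<^sup>+u. H (merge (idx s) ?J (x, \<lambda>k\<in>?J. u (snd k))) \<partial>?PU)"
      by (rule nn_integral_distr[OF m]) (use mm in simp)
    also have "\<dots> = (\<integral>\<^sup>+u. H (join s x u) \<partial>?PU)"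
    proof (intro nn_integral_cong arg_cong[where f = H] ext)
      fix u k show "merge (idx s) ?J (x, \<lambda>k\<in>?J. u (snd k)) k = join s x u k"
        by (auto simp: merge_def join_def idx_Suc)
    qed
    finally show "(\<integral>\<^sup>+y. H (merge (idx s) ?J (x, y)) \<partial>(lborel_PiM ?J)) = (\<integral>\<^sup>+u. H (join s x u) \<partial>?PU)" .
  qed
  finally show ?thesis ..
qed

lemma measurable_join:
  assumes x: "x \<in> space (PI s)"
  shows "join s x \<in> measurable (lborel_PiM {1..np (Suc s)}) (PI (Suc s))"
  unfolding join_def[abs_def]
proof (rule measurable_restrict)
  fix k assume k: "k \<in> idx (Suc s)"
  show "(\<lambda>u. if k \<in> idx s then x k else u (snd k)) \<in> measurable (lborel_PiM {1..np (Suc s)}) lborel"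
  proof (cases "k \<in> idx s")
    case False
    then have "snd k \<in> {1..np (Suc s)}" using k by (auto simp: idx_Suc)
    then show ?thesis using False by (simp add: measurable_component_singleton)
  qed simp
qed

text \<open>Joint measurability in the previous configuration and the fresh vector, with no
  genericity assumed of either; Fubini needs it in this form.\<close>

lemma measurable_step_map:
  assumes s: "Suc s < p + q"
    and X: "X \<in> measurable Q (PI s)"
    and Z: "\<And>k. k < A_size p q (Suc s) \<Longrightarrow> (\<lambda>\<omega>. Z \<omega> k) \<in> borel_measurable Q"
  shows "(\<lambda>\<omega>. step_map s (X \<omega>) (Z \<omega>)) \<in> measurable Q (PI (Suc s))"
  unfolding step_map_def join_def
proof (rule measurable_restrict)
  fix k assume k: "k \<in> idx (Suc s)"
  have s': "Suc s \<in> {1..<p + q}" using s by auto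
  let ?N = "A_size p q (Suc s)" and ?l = "\<lambda>x. diag_entries (Suc s) (map (\<lambda>j. x (s, j)) [1..<np s + 1])"
  show "(\<lambda>\<omega>. if k \<in> idx s then X \<omega> k else entry (new_eigs s (X \<omega>) (Z \<omega>)) (snd k)) \<in> measurable Q lborel"
  proof (cases "k \<in> idx s")
    case True
    then show ?thesis using measurable_compose[OF X measurable_component_singleton] by simp
  next
    case False
    have "measurable_real_spectrum Q (\<lambda>\<omega>. compress ?N (Z \<omega>) (?l (X \<omega>))) ?N"
    proof (rule measurable_real_spectrum_compress[OF Z])
      show "length (?l (X \<omega>)) = ?N" for \<omega> using s' by (intro length_diag_entries) auto
      show "(\<lambda>\<omega>. ?l (X \<omega>) ! k) \<in> borel_measurable Q" if k: "k < ?N" for k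
      proof -
        have "(\<lambda>x. node (Suc s) (\<lambda>j. x (Suc s - 1, j)) (node_index (Suc s) k)) \<in> borel_measurable (PI s)"
          using s' k by (intro measurable_node node_index_le) auto
        from measurable_compose[OF X this] show ?thesis
          using diag_entries_nth[OF s' k] by simp
      qed
    qed
    then interpret measurable_real_spectrum Q "\<lambda>\<omega>. compress ?N (Z \<omega>) (?l (X \<omega>))" ?N .
    have "(\<lambda>\<omega>. entry (new_eigs s (X \<omega>) (Z \<omega>)) (snd k)) \<in> borel_measurable Q"
      unfolding new_eigs_def by (rule entry_eigenvalues_outside_measurable) (simp add: excluded_def)
    then show ?thesis using False by simp
  qed
qed

section \<open>The configuration as a function of the Gaussian entries\<close>

definition config :: "nat \<Rightarrow> (nat \<Rightarrow> nat \<Rightarrow> complex) \<Rightarrow> nat \<times> nat \<Rightarrow> real" where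
  "config s G = (\<lambda>k\<in>idx s. lam p q G k)"

lemma eig_list_Suc: "eig_list p q G (Suc s) = new_eigs s (lam p q G) (G (Suc s))"
  by (simp add: new_eigs_def excluded_def M_mat_def compress_def A_mat_diag_entries Let_def lam_def del: upt_Suc)

lemma new_eigs_cong:
  assumes "\<And>j. j \<in> {1..np s} \<Longrightarrow> x (s, j) = y (s, j)" "\<And>k. k < A_size p q (Suc s) \<Longrightarrow> z k = w k"
  shows "new_eigs s x z = new_eigs s y w"
proof -
  have "map (\<lambda>j. x (s, j)) [1..<np s + 1] = map (\<lambda>j. y (s, j)) [1..<np s + 1]"
    using assms(1) by (intro map_cong) auto
  moreover have "normalized_vec (A_size p q (Suc s)) z = normalized_vec (A_size p q (Suc s)) w"
    using assms(2) by (rule normalized_vec_cong)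
  ultimately show ?thesis by (simp only: new_eigs_def compress_def)
qed

text \<open>The Markov structure: the next configuration is a fixed measurable function of the
  present one and of the fresh vector, restricted to the coordinates in use so that it lives in a
  product space.\<close>

lemma config_Suc: "config (Suc s) G = step_map s (config s G) (\<lambda>i\<in>{..<A_size p q (Suc s)}. G (Suc s) i)"
proof -
  have e: "new_eigs s (lam p q G) (G (Suc s)) = new_eigs s (config s G) (\<lambda>i\<in>{..<A_size p q (Suc s)}. G (Suc s) i)"
  proof (rule new_eigs_cong)
    fix j assume "j \<in> {1..np s}"
    then have "(s, j) \<in> idx s" by (intro idx_component) auto
    then show "lam p q G (s, j) = config s G (s, j)" by (simp add: config_def)
  qed simp
  show ?thesis
    unfolding step_map_def join_def config_def[of "Suc s"]
  proof (rule restrict_ext)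
    fix k assume k: "k \<in> idx (Suc s)"
    show "lam p q G k = (if k \<in> idx s then config s G k
        else entry (new_eigs s (config s G) (\<lambda>i\<in>{..<A_size p q (Suc s)}. G (Suc s) i)) (snd k))"
    proof (cases "k \<in> idx s")
      case False
      then have "fst k = Suc s" using k by (auto simp: idx_Suc)
      then have "lam p q G k = entry (eig_list p q G (Suc s)) (snd k)" by (simp add: lam_def split_beta)
      then show ?thesis using False unfolding eig_list_Suc e by simp
    qed (simp add: config_def)
  qed
qed

lemma config_cong:
  assumes "\<And>t i. t \<in> {1..s} \<Longrightarrow> i < A_size p q t \<Longrightarrow> G t i = H t i"
  shows "config s G = config s H"
  using assms
proof (induction s)
  case 0
  show ?case by (simp add: config_def idx_def)
next
  case (Suc s)
  have "(\<lambda>i\<in>{..<A_size p q (Suc s)}. G (Suc s) i) = (\<lambda>i\<in>{..<A_size p q (Suc s)}. H (Suc s) i)"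
    using Suc.prems by (intro restrict_ext) auto
  moreover have "config s G = config s H" using Suc by auto
  ultimately show ?case by (simp only: config_Suc)
qed

lemma measurable_config:
  assumes "s < p + q" "\<And>t i. t \<in> {1..s} \<Longrightarrow> i < A_size p q t \<Longrightarrow> (\<lambda>\<omega>. G \<omega> t i) \<in> borel_measurable Q"
  shows "(\<lambda>\<omega>. config s (G \<omega>)) \<in> measurable Q (PI s)"
  using assms
proof (induction s)
  case 0
  show ?case unfolding config_def by (intro measurable_restrict) (auto simp: idx_def)
next
  case (Suc s)
  have "(\<lambda>\<omega>. config s (G \<omega>)) \<in> measurable Q (PI s)" using Suc by auto
  then show ?case unfolding config_Suc using Suc.prems by (intro measurable_step_map) auto
qed

lemma grouped_nodes_new_eigs:
  assumes s: "Suc s < p + q" and y: "good x s"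
  shows "grouped_nodes.eigs (A_size p q (Suc s)) (node (Suc s) (\<lambda>j. x (s, j))) (node_index (Suc s)) (excluded (Suc s)) z
    = new_eigs s x z"
proof -
  have s': "Suc s \<in> {1..<p + q}" using s by auto
  interpret grouped_nodes "A_size p q (Suc s)" "np (Suc s)" "node (Suc s) (\<lambda>j. x (s, j))" "node_index (Suc s)" "excluded (Suc s)"
    using s' y by (intro grouped_nodes_step) auto
  have "nodes = diag_entries (Suc s) (map (\<lambda>j. x (s, j)) [1..<np s + 1])"
  proof (rule nth_equalityI)
    show "length nodes = length (diag_entries (Suc s) (map (\<lambda>j. x (s, j)) [1..<np s + 1]))"
      using length_diag_entries[OF s', of "map (\<lambda>j. x (s, j)) [1..<np s + 1]"] by simp
    fix k assume "k < length nodes"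
    then have k: "k < A_size p q (Suc s)" by simp
    then show "nodes ! k = diag_entries (Suc s) (map (\<lambda>j. x (s, j)) [1..<np s + 1]) ! k"
      using diag_entries_nth[OF s' k, of "\<lambda>j. x (s, j)"] by (simp add: nodes_def)
  qed
  then show ?thesis by (simp add: eigs_def new_eigs_def)
qed

text \<open>Nonzero entries make every group sum positive, so each step yields interlacing zeros and
  the list is exactly as long as the line. This is a pointwise statement, and almost every \<omega>
  satisfies its hypothesis.\<close>

lemma eig_list_generic:
  assumes s: "s < p + q" and nz: "\<And>t i. t \<in> {1..s} \<Longrightarrow> i < A_size p q t \<Longrightarrow> G t i \<noteq> 0"
  shows "chain s (lam p q G) \<and> (s \<noteq> 0 \<longrightarrow> eig_list p q G s = map (\<lambda>j. lam p q G (s, j)) [1..<np s + 1])"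
  using assms
proof (induction s)
  case 0
  show ?case by (simp add: chain_def)
next
  case (Suc s)
  let ?x = "lam p q G"
  have s': "Suc s \<in> {1..<p + q}" using Suc.prems by auto
  have ch: "chain s ?x" using Suc by auto
  have g: "good ?x s" using ch Suc.prems by (intro chain_good) auto
  interpret grouped_nodes "A_size p q (Suc s)" "np (Suc s)" "node (Suc s) (\<lambda>j. ?x (s, j))" "node_index (Suc s)" "excluded (Suc s)"
    using s' g by (intro grouped_nodes_step) auto
  have pos: "0 < group_sum (G (Suc s)) i" if i: "i \<le> np (Suc s)" for i
    unfolding group_sum_def using surj[OF i] Suc.prems(2) by (intro sum_pos) auto
  obtain u where u: "interlaced (np (Suc s)) (node (Suc s) (\<lambda>j. ?x (s, j))) u" "eigs (G (Suc s)) = map u [1..<Suc (np (Suc s))]"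
    using eigs_spread_group_sum(2)[OF pos] by blast
  have e: "eig_list p q G (Suc s) = map u [1..<Suc (np (Suc s))]"
    unfolding eig_list_Suc using u(2) grouped_nodes_new_eigs[OF Suc.prems(1) g] by simp
  have x: "?x (Suc s, j) = u j" if "j \<in> {1..np (Suc s)}" for j
    unfolding lam_def prod.case e by (rule entry_map_upt[OF that])
  have "interlaced (np (Suc s)) (node (Suc s) (\<lambda>j. ?x (s, j))) (\<lambda>j. ?x (Suc s, j))"
    using u(1) x interlaced_cong[of "np (Suc s)" "node (Suc s) (\<lambda>j. ?x (s, j))" "node (Suc s) (\<lambda>j. ?x (s, j))" "\<lambda>j. ?x (Suc s, j)" u] by simp
  then have "step ?x (Suc s)" by (simp add: step_def)
  then have "chain (Suc s) ?x" using ch by (simp add: chain_Suc)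
  moreover have "eig_list p q G (Suc s) = map (\<lambda>j. ?x (Suc s, j)) [1..<np (Suc s) + 1]"
    unfolding e using x by (intro map_cong) auto
  ultimately show ?case by blast
qed

end

section \<open>The law of the configuration by induction on the lines\<close>

locale bead_eigs = prob_space M + bead_params p q for M :: "'w measure" and p q +
  fixes g :: "nat \<Rightarrow> nat \<Rightarrow> 'w \<Rightarrow> complex"
  assumes gauss: "\<And>s i. s \<in> {1..<p + q} \<Longrightarrow> i < A_size p q s \<Longrightarrow> std_complex_gaussian M (g s i)"
    and indep: "indep_vars (\<lambda>_. borel) (\<lambda>(s, i). g s i) (SIGMA s:{1..<p + q}. {..<A_size p q s})"
begin

abbreviation gv :: "'w \<Rightarrow> nat \<Rightarrow> nat \<Rightarrow> complex" where "gv \<omega> \<equiv> \<lambda>s i. g s i \<omega>"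

abbreviation gauss_vec :: "nat \<Rightarrow> 'w \<Rightarrow> nat \<Rightarrow> complex" where
  "gauss_vec s \<omega> \<equiv> \<lambda>i\<in>{..<A_size p q s}. g s i \<omega>"

lemma g_measurable: "s \<in> {1..<p + q} \<Longrightarrow> i < A_size p q s \<Longrightarrow> g s i \<in> borel_measurable M"
  using gauss by (auto simp: std_complex_gaussian_def distributed_def)

lemma AE_g_nonzero: "AE \<omega> in M. \<forall>k\<in>(SIGMA s:{1..<p + q}. {..<A_size p q s}). gv \<omega> (fst k) (snd k) \<noteq> 0"
proof (rule AE_finite_allI)
  fix k assume "k \<in> (SIGMA s:{1..<p + q}. {..<A_size p q s})"
  then have k: "std_complex_gaussian M (g (fst k) (snd k))" by (auto intro: gauss)
  then have e: "distr M lborel (g (fst k) (snd k)) = density lborel (\<lambda>z. ennreal (exp (- (cmod z)\<^sup>2) / pi))"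
    and m [measurable]: "g (fst k) (snd k) \<in> borel_measurable M"
    by (auto simp: std_complex_gaussian_def distributed_def)
  have "AE z in density lborel (\<lambda>z. ennreal (exp (- (cmod z)\<^sup>2) / pi)). z \<noteq> 0"
    by (subst AE_density) (auto intro: AE_mp[OF AE_lborel_singleton])
  then have "AE z in distr M lborel (g (fst k) (snd k)). z \<noteq> 0" unfolding e .
  then show "AE \<omega> in M. gv \<omega> (fst k) (snd k) \<noteq> 0" by (subst (asm) AE_distr_iff) auto
qed (auto intro: finite_SigmaI)

lemma AE_eig_list:
  "AE \<omega> in M. \<forall>s\<in>{1..<p + q}. length (eig_list p q (gv \<omega>) s) = np s \<and> sorted_wrt (>) (eig_list p q (gv \<omega>) s)"
  using AE_g_nonzero
proof eventually_elim
  case (elim \<omega>)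
  show ?case
  proof
    fix s assume s: "s \<in> {1..<p + q}"
    have "chain s (lam p q (gv \<omega>)) \<and> (s \<noteq> 0 \<longrightarrow> eig_list p q (gv \<omega>) s = map (\<lambda>j. lam p q (gv \<omega>) (s, j)) [1..<np s + 1])"
      using elim s by (intro eig_list_generic) force+
    then have c: "chain s (lam p q (gv \<omega>))" and e: "eig_list p q (gv \<omega>) s = map (\<lambda>j. lam p q (gv \<omega>) (s, j)) [1..<np s + 1]"
      using s by auto
    have "good (lam p q (gv \<omega>)) s" using c s by (intro chain_good) auto
    then show "length (eig_list p q (gv \<omega>) s) = np s \<and> sorted_wrt (>) (eig_list p q (gv \<omega>) s)"
      unfolding e using good_line_sorted[of "np s" "\<lambda>j. lam p q (gv \<omega>) (s, j)"] by (simp del: upt_Suc)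
  qed
qed

text \<open>This is \<open>kernel_const\<close> with the multiplicities written as fiber sizes,
  which shows that it does not depend on the previous configuration.\<close>

definition step_const :: "nat \<Rightarrow> real" where
  "step_const s = fact (A_size p q s - 1) / (\<Prod>i\<le>np s. fact (card (fiber s i) - 1))"

lemma step_const_pos: "0 < step_const s"
  unfolding step_const_def by (intro divide_pos_pos prod_pos) auto

definition step_density :: "nat \<Rightarrow> (nat \<times> nat \<Rightarrow> real) \<Rightarrow> (nat \<Rightarrow> real) \<Rightarrow> real" where
  "step_density s x u = (if interlaced (np (Suc s)) (node (Suc s) (\<lambda>j. x (s, j))) u
     then step_const (Suc s) * (line_weight (Suc s) u / line_weight s (\<lambda>j. x (s, j))) else 0)"

text \<open>With the previous configuration frozen at a deterministic \<open>x\<close> whose last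
  line is good, the nodes are constants and the law of a single step applies.\<close>

lemma nn_integral_step:
  assumes s: "Suc s < p + q" and x: "x \<in> space (PI s)" and y: "good x s"
    and F: "F \<in> borel_measurable (PI (Suc s))"
  shows "(\<integral>\<^sup>+\<omega>. F (step_map s x (gauss_vec (Suc s) \<omega>)) \<partial>M) =
    (\<integral>\<^sup>+u. F (join s x u) * ennreal (step_density s x u)
      \<partial>(lborel_PiM {1..np (Suc s)}))"
proof -
  have s': "Suc s \<in> {1..<p + q}" using s by auto
  let ?N = "A_size p q (Suc s)"
  interpret G: grouped_nodes ?N "np (Suc s)" "node (Suc s) (\<lambda>j. x (s, j))" "node_index (Suc s)" "excluded (Suc s)"
    using s' y by (intro grouped_nodes_step) auto
  \<comment> \<open>The family is indexed by pairs; restricting to the singleton blocks of step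
    \<open>Suc s\<close> reindexes its subfamily by \<open>k\<close> alone.\<close>
  have ind: "indep_vars (\<lambda>_. borel) (\<lambda>k. g (Suc s) k) {..<?N}"
  proof -
    have "indep_vars (\<lambda>k. \<Pi>\<^sub>M i\<in>{(Suc s, k)}. borel) (\<lambda>k \<omega>. restrict (\<lambda>i. (case i of (s, i) \<Rightarrow> g s i) \<omega>) {(Suc s, k)}) {..<?N}"
      using indep by (rule indep_vars_restrict) (use s' in \<open>auto simp: disjoint_family_on_def\<close>)
    then have "indep_vars (\<lambda>_. borel) (\<lambda>k \<omega>. restrict (\<lambda>i. (case i of (s, i) \<Rightarrow> g s i) \<omega>) {(Suc s, k)} (Suc s, k)) {..<?N}"
      by (rule indep_vars_compose2) (rule measurable_component_singleton, simp)
    then show ?thesis by simp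
  qed
  interpret G: gaussian_grouped_nodes M ?N "np (Suc s)" "node (Suc s) (\<lambda>j. x (s, j))" "node_index (Suc s)" "excluded (Suc s)" "\<lambda>k. g (Suc s) k"
    using gauss s' ind by unfold_locales auto
  have m: "(\<lambda>u. F (join s x u)) \<in> borel_measurable (lborel_PiM {1..np (Suc s)})"
    by (rule measurable_compose[OF measurable_join[OF x] F])
  have "(\<integral>\<^sup>+\<omega>. F (step_map s x (gauss_vec (Suc s) \<omega>)) \<partial>M) =
      (\<integral>\<^sup>+\<omega>. F (join s x (\<lambda>j\<in>{1..np (Suc s)}. entry (G.eigs (\<lambda>k. g (Suc s) k \<omega>)) j)) \<partial>M)"
  proof (intro nn_integral_cong arg_cong[where f = F])
    fix \<omega>
    have "new_eigs s x (gauss_vec (Suc s) \<omega>) = new_eigs s x (\<lambda>k. g (Suc s) k \<omega>)"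
      by (rule new_eigs_cong) auto
    then show "step_map s x (gauss_vec (Suc s) \<omega>) = join s x (\<lambda>j\<in>{1..np (Suc s)}. entry (G.eigs (\<lambda>k. g (Suc s) k \<omega>)) j)"
      unfolding step_map_def grouped_nodes_new_eigs[OF s y] by (intro join_cong) simp
  qed
  also have "\<dots> = (\<integral>\<^sup>+u. F (join s x u) * ennreal (G.eigs_density u) \<partial>(lborel_PiM {1..np (Suc s)}))"
    by (rule G.nn_integral_eigs[OF m])
  also have "G.eigs_density = (\<lambda>u. step_density s x u)"
  proof
    fix u
    have "good_line (np (Suc s - 1)) (\<lambda>j. x (s, j))" using y by simp
    from resid_prod_line_weight[OF s' this, of u]
    show "G.eigs_density u = step_density s x u"
      unfolding G.eigs_density_def G.kernel_const_def step_density_def step_const_def G.mult_def by simp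
  qed
  finally show ?thesis .
qed

text \<open>The telescoped product of the step densities: only the weight of the last line and a
  constant \<open>C\<close> survive.\<close>

definition config_density :: "real \<Rightarrow> nat \<Rightarrow> (nat \<times> nat \<Rightarrow> real) \<Rightarrow> real" where
  "config_density C s x = (if chain s x then C * line_weight s (\<lambda>j. x (s, j)) else 0)"

lemma measurable_config_density:
  assumes "s < p + q" shows "config_density C s \<in> borel_measurable (PI s)"
proof -
  note [measurable] = measurable_chain[OF assms] measurable_line_weight[of s]
  show ?thesis unfolding config_density_def[abs_def] by measurable
qed

lemma config_density_join:
  assumes s: "Suc s < p + q" and C: "0 < C"
  shows "ennreal (config_density C s x) * ennreal (step_density s x u) =
     ennreal (config_density (C * step_const (Suc s)) (Suc s) (join s x u))"
proof -
  let ?J = "join s x u"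
  have 1: "chain s ?J \<longleftrightarrow> chain s x" using s by (intro chain_cong join_index) auto
  have st: "step ?J (Suc s) \<longleftrightarrow> interlaced (np (Suc s)) (node (Suc s) (\<lambda>j. x (s, j))) u"
    unfolding step_def
  proof (rule interlaced_cong)
    fix i assume i: "i \<le> np (Suc s)"
    show "node (Suc s) (\<lambda>j. ?J (Suc s - 1, j)) i = node (Suc s) (\<lambda>j. x (s, j)) i"
      using s by (intro node_cong i) (auto intro!: join_index idx_component)
  qed (rule join_index)
  have ch: "chain (Suc s) ?J \<longleftrightarrow> chain s x \<and> interlaced (np (Suc s)) (node (Suc s) (\<lambda>j. x (s, j))) u"
    unfolding 1[symmetric] st[symmetric] by (rule chain_Suc)
  have lw: "line_weight (Suc s) (\<lambda>j. ?J (Suc s, j)) = line_weight (Suc s) u"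
    by (intro line_weight_cong join_index)
  show ?thesis
  proof (cases "chain s x \<and> interlaced (np (Suc s)) (node (Suc s) (\<lambda>j. x (s, j))) u")
    case True
    \<comment> \<open>Positivity on a good line permits cancelling the weight of line
      \<open>s\<close> against the denominator of the step density.\<close>
    have p: "0 < line_weight s (\<lambda>j. x (s, j))"
      using True s by (intro line_weight_pos chain_good) auto
    then show ?thesis
      using True C unfolding config_density_def step_density_def ch lw by (simp add: ennreal_mult'[symmetric] mult.assoc)
  next
    case False
    then show ?thesis unfolding config_density_def step_density_def ch by auto
  qed
qed

lemma random_config: "s < p + q \<Longrightarrow> (\<lambda>\<omega>. config s (gv \<omega>)) \<in> measurable M (PI s)"
  using g_measurable by (intro measurable_config) auto

text \<open>The past is a function of the entries of steps 1 to \<open>s\<close>, the fresh vector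
  of those of step \<open>Suc s\<close>. These blocks of indices are disjoint, and the product law
  of the blocks is pushed forward along both functions.\<close>

lemma config_indep:
  assumes s: "Suc s < p + q"
  defines "PZ \<equiv> \<Pi>\<^sub>M i\<in>{..<A_size p q (Suc s)}. borel :: complex measure"
  shows "distr M (PI s \<Otimes>\<^sub>M PZ) (\<lambda>\<omega>. (config s (gv \<omega>), gauss_vec (Suc s) \<omega>)) =
    distr M (PI s) (\<lambda>\<omega>. config s (gv \<omega>)) \<Otimes>\<^sub>M distr M PZ (gauss_vec (Suc s))"
proof -
  let ?A = "SIGMA t:{1..s}. {..<A_size p q t}" and ?N = "A_size p q (Suc s)"
  let ?B = "{Suc s} \<times> {..<?N}"
  let ?PA = "\<Pi>\<^sub>M k\<in>?A. borel :: complex measure" and ?PB = "\<Pi>\<^sub>M k\<in>?B. borel :: complex measure"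
  let ?RA = "\<lambda>\<omega>. restrict (\<lambda>k. (case k of (s, i) \<Rightarrow> g s i) \<omega>) ?A"
    and ?RB = "\<lambda>\<omega>. restrict (\<lambda>k. (case k of (s, i) \<Rightarrow> g s i) \<omega>) ?B"
  let ?f = "\<lambda>\<gamma>. config s (\<lambda>t i. \<gamma> (t, i))" and ?h = "\<lambda>\<gamma>. \<lambda>i\<in>{..<?N}. \<gamma> (Suc s, i)"
  have "indep_var ?PA ?RA ?PB ?RB"
    using s by (intro indep_var_restrict[OF indep]) auto
  then have RA: "?RA \<in> measurable M ?PA" and RB: "?RB \<in> measurable M ?PB"
    and joint: "distr M ?PA ?RA \<Otimes>\<^sub>M distr M ?PB ?RB = distr M (?PA \<Otimes>\<^sub>M ?PB) (\<lambda>\<omega>. (?RA \<omega>, ?RB \<omega>))"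
    unfolding indep_var_distribution_eq by auto
  have f: "?f \<in> measurable ?PA (PI s)"
    using s by (intro measurable_config measurable_component_singleton) auto
  have h: "?h \<in> measurable ?PB PZ"
    unfolding PZ_def by (intro measurable_restrict measurable_component_singleton) auto
  have fR: "?f (?RA \<omega>) = config s (gv \<omega>)" for \<omega> by (rule config_cong) auto
  have hR: "?h (?RB \<omega>) = gauss_vec (Suc s) \<omega>" for \<omega> by (rule restrict_ext) auto
  have X: "distr M (PI s) (\<lambda>\<omega>. config s (gv \<omega>)) = distr (distr M ?PA ?RA) (PI s) ?f"
    by (subst distr_distr[OF f RA]) (simp only: comp_def fR)
  have Z: "distr M PZ (gauss_vec (Suc s)) = distr (distr M ?PB ?RB) PZ ?h"
    by (subst distr_distr[OF h RB]) (simp only: comp_def hR)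
  have f': "?f \<in> measurable (distr M ?PA ?RA) (PI s)" and h': "?h \<in> measurable (distr M ?PB ?RB) PZ"
    using f h by simp_all
  interpret RB: prob_space "distr M ?PB ?RB" by (rule prob_space_distr[OF RB])
  interpret Zp: prob_space "distr (distr M ?PB ?RB) PZ ?h" by (rule RB.prob_space_distr[OF h'])
  have fh: "(\<lambda>(x, y). (?f x, ?h y)) \<in> measurable (?PA \<Otimes>\<^sub>M ?PB) (PI s \<Otimes>\<^sub>M PZ)"
    unfolding split_beta'
    by (intro measurable_Pair measurable_compose[OF measurable_fst f] measurable_compose[OF measurable_snd h])
  have RR: "(\<lambda>\<omega>. (?RA \<omega>, ?RB \<omega>)) \<in> measurable M (?PA \<Otimes>\<^sub>M ?PB)" using RA RB by (rule measurable_Pair)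
  have "distr M (PI s) (\<lambda>\<omega>. config s (gv \<omega>)) \<Otimes>\<^sub>M distr M PZ (gauss_vec (Suc s)) =
      distr (distr M ?PA ?RA \<Otimes>\<^sub>M distr M ?PB ?RB) (PI s \<Otimes>\<^sub>M PZ) (\<lambda>(x, y). (?f x, ?h y))"
    unfolding X Z by (rule pair_measure_distr[OF f' h']) (rule Zp.sigma_finite_measure_axioms)
  also have "\<dots> = distr M (PI s \<Otimes>\<^sub>M PZ) ((\<lambda>(x, y). (?f x, ?h y)) \<circ> (\<lambda>\<omega>. (?RA \<omega>, ?RB \<omega>)))"
    unfolding joint by (rule distr_distr[OF fh RR])
  also have "\<dots> = distr M (PI s \<Otimes>\<^sub>M PZ) (\<lambda>\<omega>. (config s (gv \<omega>), gauss_vec (Suc s) \<omega>))"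
    by (simp only: comp_def prod.case fR hR)
  finally show ?thesis ..
qed

text \<open>The joint law of past and fresh vector is a product, so the fresh vector can be
  integrated first with the past frozen. The one-step kernel and the density of the past multiply to
  the density at the next line.\<close>

theorem distr_config:
  "s < p + q \<Longrightarrow> \<exists>C>0. distr M (PI s) (\<lambda>\<omega>. config s (gv \<omega>)) = density (PI s) (\<lambda>x. ennreal (config_density C s x))"
proof (induction s)
  case 0
  have i0: "idx 0 = {}" by (simp add: idx_def)
  \<comment> \<open>With no lines the space is a single point and the constant is 1.\<close>
  have "distr M (PI 0) (\<lambda>\<omega>. config 0 (gv \<omega>)) = density (PI 0) (\<lambda>x. ennreal (config_density 1 0 x))"
  proof (rule measure_eqI)
    fix A assume "A \<in> sets (distr M (PI 0) (\<lambda>\<omega>. config 0 (gv \<omega>)))"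
    then have A: "A = {} \<or> A = {\<lambda>_. undefined}" unfolding i0 by (auto simp: PiM_empty)
    have d: "config_density 1 0 x = 1" for x
      by (simp add: config_density_def chain_def line_weight_def num_part_def vdm_def)
    have c: "config 0 (gv \<omega>) = (\<lambda>_. undefined)" for \<omega> by (simp add: config_def i0 restrict_def)
    show "emeasure (distr M (PI 0) (\<lambda>\<omega>. config 0 (gv \<omega>))) A = emeasure (density (PI 0) (\<lambda>x. ennreal (config_density 1 0 x))) A"
      using A emeasure_space_1 unfolding d c i0 
      by (auto simp: PiM_empty emeasure_distr emeasure_density nn_integral_count_space_finite)
  qed simp
  then show ?case by (intro exI[of _ 1]) auto
next
  case (Suc s)
  then obtain C where C: "0 < C" and D: "distr M (PI s) (\<lambda>\<omega>. config s (gv \<omega>)) = density (PI s) (\<lambda>x. ennreal (config_density C s x))"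
    by auto
  let ?C = "C * step_const (Suc s)" and ?N = "A_size p q (Suc s)"
  let ?PZ = "\<Pi>\<^sub>M i\<in>{..<?N}. borel :: complex measure" and ?PU = "lborel_PiM {1..np (Suc s)}"
  let ?X = "\<lambda>\<omega>. config s (gv \<omega>)" and ?Z = "gauss_vec (Suc s)"
  have X [measurable]: "?X \<in> measurable M (PI s)" using Suc.prems by (intro random_config) auto
  have Z [measurable]: "?Z \<in> measurable M ?PZ"
    using Suc.prems by (intro measurable_restrict g_measurable) auto
  have X' [measurable]: "(\<lambda>\<omega>. config (Suc s) (gv \<omega>)) \<in> measurable M (PI (Suc s))" using Suc.prems by (rule random_config)
  interpret DZ: prob_space "distr M ?PZ ?Z" by (rule prob_space_distr) (rule Z)
  have joint: "distr M (PI s \<Otimes>\<^sub>M ?PZ) (\<lambda>\<omega>. (?X \<omega>, ?Z \<omega>)) = distr M (PI s) ?X \<Otimes>\<^sub>M distr M ?PZ ?Z"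
    by (rule config_indep[OF Suc.prems])
  have sm: "(\<lambda>w. step_map s (fst w) (snd w)) \<in> measurable (PI s \<Otimes>\<^sub>M ?PZ) (PI (Suc s))"
    using Suc.prems by (intro measurable_step_map measurable_fst measurable_compose[OF measurable_snd measurable_component_singleton]) auto
  have fd [measurable]: "config_density C s \<in> borel_measurable (PI s)" using Suc.prems by (intro measurable_config_density) auto
  have fd' [measurable]: "config_density ?C (Suc s) \<in> borel_measurable (PI (Suc s))" using Suc.prems by (intro measurable_config_density) auto
  have "distr M (PI (Suc s)) (\<lambda>\<omega>. config (Suc s) (gv \<omega>)) = density (PI (Suc s)) (\<lambda>x. ennreal (config_density ?C (Suc s) x))"
  proof (rule measure_eqI)
    fix A assume "A \<in> sets (distr M (PI (Suc s)) (\<lambda>\<omega>. config (Suc s) (gv \<omega>)))"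
    then have A [measurable]: "A \<in> sets (PI (Suc s))" by simp
    let ?F = "indicator A :: (nat \<times> nat \<Rightarrow> real) \<Rightarrow> ennreal"
    have F: "?F \<in> borel_measurable (PI (Suc s))" by measurable
    have Fsm: "(\<lambda>w. ?F (step_map s (fst w) (snd w))) \<in> borel_measurable (PI s \<Otimes>\<^sub>M ?PZ)"
      by (rule measurable_compose[OF sm F])
    have "emeasure (distr M (PI (Suc s)) (\<lambda>\<omega>. config (Suc s) (gv \<omega>))) A = (\<integral>\<^sup>+x. ?F x \<partial>distr M (PI (Suc s)) (\<lambda>\<omega>. config (Suc s) (gv \<omega>)))"
      by (subst nn_integral_indicator) auto
    also have "\<dots> = (\<integral>\<^sup>+\<omega>. ?F (config (Suc s) (gv \<omega>)) \<partial>M)"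
      by (rule nn_integral_distr[OF X']) (use F in simp)
    also have "\<dots> = (\<integral>\<^sup>+\<omega>. (\<lambda>w. ?F (step_map s (fst w) (snd w))) (?X \<omega>, ?Z \<omega>) \<partial>M)"
      by (simp only: config_Suc fst_conv snd_conv)
    also have "\<dots> = (\<integral>\<^sup>+w. ?F (step_map s (fst w) (snd w)) \<partial>distr M (PI s \<Otimes>\<^sub>M ?PZ) (\<lambda>\<omega>. (?X \<omega>, ?Z \<omega>)))"
      by (rule nn_integral_distr[symmetric, OF measurable_Pair[OF X Z]]) (use Fsm in simp)
    also have "\<dots> = (\<integral>\<^sup>+x. \<integral>\<^sup>+z. ?F (step_map s (fst (x, z)) (snd (x, z))) \<partial>distr M ?PZ ?Z \<partial>distr M (PI s) ?X)"
      unfolding joint by (rule DZ.nn_integral_fst[symmetric]) (use Fsm in \<open>simp cong: measurable_cong_sets\<close>)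
    also have "\<dots> = (\<integral>\<^sup>+x. \<integral>\<^sup>+\<omega>. ?F (step_map s x (?Z \<omega>)) \<partial>M \<partial>distr M (PI s) ?X)"
    proof (rule nn_integral_cong)
      fix x assume "x \<in> space (distr M (PI s) ?X)"
      then have x: "x \<in> space (PI s)" by simp
      show "(\<integral>\<^sup>+z. ?F (step_map s (fst (x, z)) (snd (x, z))) \<partial>distr M ?PZ ?Z) = (\<integral>\<^sup>+\<omega>. ?F (step_map s x (?Z \<omega>)) \<partial>M)"
        using measurable_compose[OF measurable_Pair1'[OF x] Fsm]
        by (subst nn_integral_distr[OF Z]) simp_all
    qed
    also have "\<dots> = (\<integral>\<^sup>+x. ennreal (config_density C s x) * (\<integral>\<^sup>+\<omega>. ?F (step_map s x (?Z \<omega>)) \<partial>M) \<partial>PI s)"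
      unfolding D
    proof (rule nn_integral_density)
      have "(\<lambda>w. ?F (step_map s (fst w) (?Z (snd w)))) \<in> borel_measurable (PI s \<Otimes>\<^sub>M M)"
      proof -
        have "(\<lambda>w. (fst w, ?Z (snd w))) \<in> measurable (PI s \<Otimes>\<^sub>M M) (PI s \<Otimes>\<^sub>M ?PZ)" by measurable
        from measurable_compose[OF this Fsm] show ?thesis by simp
      qed
      then show "(\<lambda>x. \<integral>\<^sup>+\<omega>. ?F (step_map s x (?Z \<omega>)) \<partial>M) \<in> borel_measurable (PI s)"
        by (intro borel_measurable_nn_integral) (simp add: split_beta')
    qed measurable
    also have "\<dots> = (\<integral>\<^sup>+x. \<integral>\<^sup>+u. ?F (join s x u) * ennreal (config_density ?C (Suc s) (join s x u)) \<partial>?PU \<partial>PI s)"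
    proof (rule nn_integral_cong)
      fix x assume x: "x \<in> space (PI s)"
      let ?k = "\<lambda>u. ennreal (step_density s x u)"
      note dj = config_density_join[OF Suc.prems C, of x]
      have Fj: "(\<lambda>u. ?F (join s x u)) \<in> borel_measurable ?PU"
        by (rule measurable_compose[OF measurable_join[OF x] F])
      show "ennreal (config_density C s x) * (\<integral>\<^sup>+\<omega>. ?F (step_map s x (?Z \<omega>)) \<partial>M) =
          (\<integral>\<^sup>+u. ?F (join s x u) * ennreal (config_density ?C (Suc s) (join s x u)) \<partial>?PU)"
      \<comment> \<open>The one-step law is available only for a good previous line, which
        \<open>chain s x\<close> guarantees; otherwise the density of the past is 0 and both sides
        vanish.\<close>
      proof (cases "chain s x")
        case True
        have y: "good x s" using True Suc.prems by (intro chain_good) auto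
        have "(\<lambda>u. line_weight (Suc s) (\<lambda>j. join s x u (Suc s, j))) \<in> borel_measurable ?PU"
          by (rule measurable_compose[OF measurable_join[OF x] measurable_line_weight])
        moreover have "line_weight (Suc s) (\<lambda>j. join s x u (Suc s, j)) = line_weight (Suc s) u" for u
          by (intro line_weight_cong join_index)
        ultimately have [measurable]: "line_weight (Suc s) \<in> borel_measurable ?PU" by simp
        have km: "?k \<in> borel_measurable ?PU" unfolding step_density_def by measurable
        have "ennreal (config_density C s x) * (\<integral>\<^sup>+\<omega>. ?F (step_map s x (?Z \<omega>)) \<partial>M) =
            ennreal (config_density C s x) * (\<integral>\<^sup>+u. ?F (join s x u) * ?k u \<partial>?PU)"
          by (simp only: nn_integral_step[OF Suc.prems x y F])
        also have "\<dots> = (\<integral>\<^sup>+u. ennreal (config_density C s x) * (?F (join s x u) * ?k u) \<partial>?PU)"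
          by (rule nn_integral_cmult[symmetric]) (intro borel_measurable_times_ennreal Fj km)
        also have "\<dots> = (\<integral>\<^sup>+u. ?F (join s x u) * ennreal (config_density ?C (Suc s) (join s x u)) \<partial>?PU)"
          by (intro nn_integral_cong) (simp only: dj[symmetric] mult.left_commute)
        finally show ?thesis .
      next
        case False
        then have z: "ennreal (config_density C s x) = 0" by (simp add: config_density_def)
        then have "ennreal (config_density ?C (Suc s) (join s x u)) = 0" for u
          unfolding dj[symmetric] by simp
        then show ?thesis using z by simp
      qed
    qed
    also have "\<dots> = (\<integral>\<^sup>+x. ?F x * ennreal (config_density ?C (Suc s) x) \<partial>PI (Suc s))"
      by (rule nn_integral_join) measurable
    also have "\<dots> = emeasure (density (PI (Suc s)) (\<lambda>x. ennreal (config_density ?C (Suc s) x))) A"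
      by (subst emeasure_density) (auto simp: mult.commute)
    finally show "emeasure (distr M (PI (Suc s)) (\<lambda>\<omega>. config (Suc s) (gv \<omega>))) A =
        emeasure (density (PI (Suc s)) (\<lambda>x. ennreal (config_density ?C (Suc s) x))) A" .
  qed simp
  then show ?case using C step_const_pos by (intro exI[of _ ?C]) auto
qed

theorem config_joint_density:
  "\<exists>c>0. has_joint_density M p q (\<lambda>k \<omega>. lam p q (gv \<omega>) k) (\<lambda>x. c * (if chain (p + q - 1) x then 1 else 0))"
proof -
  let ?s = "p + q - 1"
  have s: "?s < p + q" using p1 by auto
  obtain C where C: "0 < C" and D: "distr M (PI ?s) (\<lambda>\<omega>. config ?s (gv \<omega>)) = density (PI ?s) (\<lambda>x. ennreal (config_density C ?s x))"
    using distr_config[OF s] by auto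
  have idx: "idx ?s = positions p q"
    unfolding idx_def positions_def using s by (intro Sigma_cong) auto
  have np: "np ?s = 1" using p1 pq by (auto simp: num_part_def)
  have e: "p - ?s = 0" "q - ?s = 0" using p1 pq by auto
  \<comment> \<open>The last line has one particle and both exponents are 0, so the density becomes
    a constant multiple of an indicator.\<close>
  have lw: "line_weight ?s y = 1" for y
    unfolding line_weight_def np e by (simp add: vdm_def)
  have w: "config_density C ?s = (\<lambda>x. C * (if chain ?s x then 1 else 0))"
  proof
    fix x show "config_density C ?s x = C * (if chain ?s x then 1 else 0)"
      by (cases "chain ?s x") (simp_all only: config_density_def lw if_True if_False mult_1_right mult_zero_right)
  qed
  have "distributed M (lborel_PiM (positions p q)) (\<lambda>\<omega>. \<lambda>k\<in>positions p q. lam p q (gv \<omega>) k) (\<lambda>x. ennreal (C * (if chain ?s x then 1 else 0)))"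
    unfolding distributed_def
    using D random_config[OF s] measurable_config_density[OF s, of C]
    unfolding w config_def idx by auto
  then show ?thesis using C unfolding has_joint_density_def by blast
qed

end

text \<open>The almost sure clause ties the labelled density to the actual eigenvalues, since it
  confines the default value of \<open>entry\<close> to a null event. The two density clauses
  coincide once both weights are recognized as the indicator of \<open>chain\<close>.\<close>

theorem mainTheorem5:
  fixes M :: "'a measure"
    and g :: "nat \<Rightarrow> nat \<Rightarrow> 'a \<Rightarrow> complex"
    and p q :: nat
  assumes "1 \<le> p" and "p \<le> q"
    and "prob_space M"
    and "\<And>s i. s \<in> {1..<p + q} \<Longrightarrow> i < A_size p q s \<Longrightarrow> std_complex_gaussian M (g s i)"
    and "prob_space.indep_vars M (\<lambda>_. borel) (\<lambda>(s, i). g s i)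
           (SIGMA s:{1..<p + q}. {..<A_size p q s})"
  shows "(AE \<omega> in M. \<forall>s \<in> {1..<p + q}.
            length (eig_list p q (\<lambda>s i. g s i \<omega>) s) = num_part p q s \<and>
            sorted_wrt (>) (eig_list p q (\<lambda>s i. g s i \<omega>) s)) \<and>
         joint_density_proportional M p q (\<lambda>k \<omega>. lam p q (\<lambda>s i. g s i \<omega>) k)
           (\<lambda>x. if admissible p q x then
                  (\<Prod>r\<in>{2..p}. chi (line p q x (r - 1)) (line p q x r)) *
                  (\<Prod>r\<in>{p + 1..q}. chi (line p q x (r - 1)) (line p q x r \<union> {0})) *
                  (\<Prod>r\<in>{q + 1..p + q - 1}. chi (line p q x (r - 1)) (line p q x r \<union> {0, 1}))
                else 0) \<and>
         finitized_bead_process M p q (\<lambda>k \<omega>. lam p q (\<lambda>s i. g s i \<omega>) k)"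
proof -
  interpret prob_space M by fact
  interpret bead_eigs M p q g
    using assms by unfold_locales auto
  show ?thesis
    using AE_eig_list config_joint_density
    unfolding finitized_bead_process_def joint_density_proportional_def chi_products_eq bead_weight_eq
    by blast
qed

end
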